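(* Let $N\ge 1$ and let $\Omega\subset\mathbb{R}^N$ be a (possibly unbounded) connected, nonempty, open set with Lipschitz boundary, symmetric about the origin (i.e. $x\in\Omega \iff -x\in\Omega$), with $\gamma_N(\Omega)<1$. Let $B_R$ be the Euclidean ball centered at the origin such that $\gamma_N(B_R)=\gamma_N(\Omega)$. Then $$\mu_1(\Omega)\le \mu_1(B_R),$$ and equality holds if and only if $\Omega=B_R$. In other words, among all such sets of prescribed Gaussian measure, the ball centered at the origin is the unique maximizer of the first nontrivial Neumann eigenvalue $\mu_1$.
   Context: $\gamma_N$ denotes the normalized Gaussian measure on $\mathbb{R}^N$, $d\gamma_N=\varphi_N(x)\,dx$ with $\varphi_N(x)=(2\pi)^{-N/2}e^{-|x|^2/2}$. The weighted Sobolev space is $$H^1(\Omega,\gamma_N)=\{u\in W^{1,1}_{\mathrm{loc}}(\Omega): u\in L^2(\Omega,\gamma_N),\ |Du|\in L^2(\Omega,\gamma_N)\}.$$ $\mu_1(\Omega)$ is the first nontrivial eigenvalue of the Neumann problem $$-\sum_{i=1}^N\frac{\partial}{\partial x_i}\left(\varphi_N\frac{\partial u}{\partial x_i}\right)=\mu\,\varphi_N u\ \text{ in }\Omega,\qquad \frac{\partial u}{\partial \nu}=0\ \text{ on }\partial\Omega,$$ where $\nu$ is the outward normal, understood through the variational characterization $$\mu_1(\Omega)=\inf\left\{\frac{\int_\Omega |Dv|^2\,d\gamma_N}{\int_\Omega v^2\,d\gamma_N}: v\in H^1(\Omega,\gamma_N),\ v\ne 0,\ \int_\Omega v\,d\gamma_N=0\right\}$$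 (the infimum is a minimum when the functions of $H^1(\Omega,\gamma_N)$ with mean value zero embed compactly in $L^2(\Omega,\gamma_N)$). *)

theory Defs
  imports "HOL-Analysis.Analysis"
begin

text \<open>Euclidean space of dimension \<open>N \<ge> 1\<close> is a type \<open>'a :: euclidean_space\<close> with \<open>N = DIM('a)\<close>.\<close>

definition gauss_density :: "'a::euclidean_space \<Rightarrow> real" where
  "gauss_density x = (2 * pi) powr (- real DIM('a) / 2) * exp (- (norm x)\<^sup>2 / 2)"

definition gauss :: "'a::euclidean_space measure" where
  "gauss = density lborel (\<lambda>x. ennreal (gauss_density x))"

text \<open>Local Lipschitz boundary: near each boundary point, in suitable orthogonal coordinates with
  last axis \<open>e\<close>, the set is the strict subgraph of a Lipschitz function \<open>g\<close> defined on the
  hyperplane orthogonal to \<open>e\<close>. The Lipschitz constant may depend on the boundary point.\<close>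

definition lipschitz_boundary :: "'a::euclidean_space set \<Rightarrow> bool" where
  "lipschitz_boundary \<Omega> \<longleftrightarrow>
     (\<forall>p \<in> frontier \<Omega>. \<exists>e r L g.
        norm e = 1 \<and> 0 < r \<and> L-lipschitz_on {y. y \<bullet> e = 0} (g :: 'a \<Rightarrow> real) \<and>
        \<Omega> \<inter> ball p r = {x \<in> ball p r. x \<bullet> e < g (x - (x \<bullet> e) *\<^sub>R e)})"

primrec continuously_differentiable :: "nat \<Rightarrow> ('a::euclidean_space \<Rightarrow> real) \<Rightarrow> bool" where
  "continuously_differentiable 0 f \<longleftrightarrow> continuous_on UNIV f"
| "continuously_differentiable (Suc k) f \<longleftrightarrow>
     (\<forall>x. f differentiable (at x)) \<and>
     (\<forall>i \<in> Basis. continuously_differentiable k (\<lambda>x. frechet_derivative f (at x) i))"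

definition test_function :: "'a::euclidean_space set \<Rightarrow> ('a \<Rightarrow> real) \<Rightarrow> bool" where
  "test_function \<Omega> \<phi> \<longleftrightarrow>
     (\<forall>k. continuously_differentiable k \<phi>) \<and>
     compact (closure {x. \<phi> x \<noteq> 0}) \<and> closure {x. \<phi> x \<noteq> 0} \<subseteq> \<Omega>"

definition locally_integrable ::
    "'a::euclidean_space set \<Rightarrow> ('a \<Rightarrow> 'b::euclidean_space) \<Rightarrow> bool" where
  "locally_integrable \<Omega> f \<longleftrightarrow> (\<forall>K. compact K \<and> K \<subseteq> \<Omega> \<longrightarrow> set_integrable lborel K f)"

text \<open>\<open>u\<close> belongs to \<open>W\<^sup>1\<^sup>,\<^sup>1\<close>-loc of \<open>\<Omega>\<close> and \<open>Du\<close> is (a version of) its distributional gradient. The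
  gradient is determined only up to null sets, so it is treated as a relation. Elements of
  Lebesgue and Sobolev spaces are represented by functions on the whole type whose restriction
  to \<open>\<Omega>\<close> is Borel; values outside \<open>\<Omega>\<close> are irrelevant.\<close>

definition has_weak_gradient ::
    "'a::euclidean_space set \<Rightarrow> ('a \<Rightarrow> real) \<Rightarrow> ('a \<Rightarrow> 'a) \<Rightarrow> bool" where
  "has_weak_gradient \<Omega> u Du \<longleftrightarrow>
     locally_integrable \<Omega> u \<and> locally_integrable \<Omega> Du \<and>
     (\<forall>\<phi>. test_function \<Omega> \<phi> \<longrightarrow>
        (\<forall>i \<in> Basis. (LINT x:\<Omega>|lborel. u x * frechet_derivative \<phi> (at x) i) =
                     - (LINT x:\<Omega>|lborel. (Du x \<bullet> i) * \<phi> x)))"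

text \<open>The weighted Sobolev space as a set of pairs \<open>(u, Du)\<close>, i.e. \<open>u \<in> H\<^sup>1(\<Omega>, \<gamma>\<^sub>N)\<close>
  together with a version of its gradient.\<close>

definition gauss_H1 :: "'a::euclidean_space set \<Rightarrow> (('a \<Rightarrow> real) \<times> ('a \<Rightarrow> 'a)) set" where
  "gauss_H1 \<Omega> = {(u, Du). has_weak_gradient \<Omega> u Du \<and>
     set_integrable gauss \<Omega> (\<lambda>x. (u x)\<^sup>2) \<and>
     set_integrable gauss \<Omega> (\<lambda>x. (norm (Du x))\<^sup>2)}"

text \<open>For nonempty open \<open>\<Omega>\<close> the infimum is over a nonempty set of nonnegative reals. The condition
  \<open>v \<noteq> 0\<close> is meant in \<open>L\<^sup>2(\<Omega>, \<gamma>\<^sub>N)\<close>, i.e. \<open>v\<close> does not vanish almost everywhere on \<open>\<Omega>\<close>.\<close>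

definition neumann_mu1 :: "'a::euclidean_space set \<Rightarrow> real" where
  "neumann_mu1 \<Omega> =
     Inf {(LINT x:\<Omega>|gauss. (norm (Dv x))\<^sup>2) / (LINT x:\<Omega>|gauss. (v x)\<^sup>2) | v Dv.
            (v, Dv) \<in> gauss_H1 \<Omega> \<and> \<not> (AE x in gauss. x \<in> \<Omega> \<longrightarrow> v x = 0) \<and>
            (LINT x:\<Omega>|gauss. v x) = 0}"

end

theory Submission
  imports Defs "HOL-Probability.Probability" "HOL-Complex_Analysis.Complex_Analysis"
begin

text \<open>
  Weinberger's argument. On the ball of radius \<open>R\<close> the functions \<open>h\<^sub>n(x) = (x \<bullet> n) \<kappa>(|x|\<^sup>2 / 2)\<close>, with
  \<open>\<kappa>\<close> a Kummer function, solve the Neumann problem for an eigenvalue \<open>\<mu>\<close>. Extending \<open>|x| \<kappa>\<close> by a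
  constant outside the ball gives odd test functions on any symmetric \<open>\<Omega>\<close>; summed over an
  orthonormal basis, the numerator of the Rayleigh quotient decreases and the denominator increases
  with \<open>|x|\<close> in the sense of the bathtub principle, so that \<open>\<mu>\<^sub>1(\<Omega>) < \<mu>\<close> unless \<open>\<Omega>\<close> is the ball up to
  a null set.

  That \<open>\<mu>\<close> is a lower bound for \<open>\<mu>\<^sub>1\<close> of the ball is proved without spherical harmonics. If \<open>v\<close> is odd
  under the reflection in the hyperplane orthogonal to \<open>n\<close>, it vanishes where \<open>h\<^sub>n\<close> does, and Picone's
  identity gives \<open>Q(v) = \<integral> |Dv|\<^sup>2 - \<mu> \<integral> v\<^sup>2 \<ge> 0\<close>. Hence averaging \<open>v\<close> with its mirror image does not
  increase \<open>Q\<close>, and by compactness iterated averages approach a radial function. For radial \<open>f\<close> of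
  mean zero one solves \<open>div (\<gamma> F) = \<gamma> f\<close> with \<open>F\<close> radial and zero on the sphere; Picone's
  inequality for the components of \<open>F\<close> bounds \<open>F\<close> by \<open>f\<close>, and duality gives \<open>Q \<ge> 0\<close>.
\<close>

section \<open>Continuously differentiable functions and integration by parts\<close>

text \<open>Picone's inequality, reflections and Arzela-Ascoli are used for C^1 functions on the
  whole space, but the bound on the ball must reach every element of H^1. Mollification yields the
  right gradient only on smaller concentric balls. Hence every C^1 estimate is proved for all r with
  r^2/2 <= S and one fixed \<mu>: on such a ball x . D(\<open>eigf n\<close>) has the same sign as
  \<open>eigf n\<close>, so the terms produced near the sphere have the favourable sign. The limit
  of the reflection averages is merely continuous, so its energy is never formed. The averages are
  tested against a radial source f, where only integrals of the averages themselves enter, and f is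
  afterwards chosen to approximate the limit. The bound on the field F with div(gw F) = gw f rests
  on an identity of Bochner type, int f^2 = int |DF|^2 + int |F|^2, which holds because F vanishes
  on the sphere. In the comparison of domains only the denominator gives strictness, and it sees
  sets up to null sets; the Lipschitz boundary turns this into equality of sets.\<close>

lemma continuous_on_of_DERIV:
  fixes f :: "real \<Rightarrow> real"
  assumes "\<And>s. (f has_real_derivative f' s) (at s)"
  shows "continuous_on A f"
  using assms by (auto intro!: DERIV_continuous_on intro: has_field_derivative_at_within)

text \<open>The gradient is carried along as a second function, on the whole space rather than on a
  domain: both functions are then bounded on every ball, and mollified functions belong to the class
  directly.\<close>

definition C1_grad :: "('a::euclidean_space \<Rightarrow> real) \<Rightarrow> ('a \<Rightarrow> 'a) \<Rightarrow> bool" where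
  "C1_grad u Du \<longleftrightarrow>
     (\<forall>x. (u has_derivative (\<lambda>h. Du x \<bullet> h)) (at x)) \<and> continuous_on UNIV Du"

lemma C1_gradI:
  assumes "\<And>x. (u has_derivative (\<lambda>h. Du x \<bullet> h)) (at x)" "continuous_on UNIV Du"
  shows "C1_grad u Du"
  using assms by (simp add: C1_grad_def)

lemma C1_grad_continuous: "C1_grad u Du \<Longrightarrow> continuous_on S u"
  unfolding C1_grad_def
  by (meson continuous_at_imp_continuous_on has_derivative_continuous)

lemma C1_grad_continuous_grad: "C1_grad u Du \<Longrightarrow> continuous_on S Du"
  unfolding C1_grad_def by (meson continuous_on_subset subset_UNIV)

lemma C1_grad_has_derivative:
  "C1_grad u Du \<Longrightarrow> (u has_derivative (\<lambda>h. Du x \<bullet> h)) (at x within S)"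
  unfolding C1_grad_def by (meson has_derivative_at_withinI)

lemma C1_grad_const: "C1_grad (\<lambda>x. c) (\<lambda>x. 0)"
  by (intro C1_gradI) (auto intro!: derivative_eq_intros)

lemma C1_grad_inner: "C1_grad (\<lambda>x. x \<bullet> n) (\<lambda>x. n)"
  by (intro C1_gradI) (auto intro!: derivative_eq_intros simp: inner_commute)

lemma C1_grad_add:
  assumes "C1_grad u Du" "C1_grad v Dv"
  shows "C1_grad (\<lambda>x. u x + v x) (\<lambda>x. Du x + Dv x)"
  using assms unfolding C1_grad_def
  by (auto intro!: derivative_eq_intros continuous_intros simp: inner_add_left)

lemma C1_grad_diff:
  assumes "C1_grad u Du" "C1_grad v Dv"
  shows "C1_grad (\<lambda>x. u x - v x) (\<lambda>x. Du x - Dv x)"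
  using assms unfolding C1_grad_def
  by (auto intro!: derivative_eq_intros continuous_intros simp: inner_diff_left)

lemma C1_grad_mult:
  assumes "C1_grad u Du" "C1_grad v Dv"
  shows "C1_grad (\<lambda>x. u x * v x) (\<lambda>x. u x *\<^sub>R Dv x + v x *\<^sub>R Du x)"
proof (rule C1_gradI)
  show "((\<lambda>x. u x * v x) has_derivative (\<lambda>h. (u x *\<^sub>R Dv x + v x *\<^sub>R Du x) \<bullet> h)) (at x)" for x
    using C1_grad_has_derivative[OF assms(1), of x UNIV] C1_grad_has_derivative[OF assms(2), of x UNIV]
    by (auto intro!: derivative_eq_intros simp: inner_add_left algebra_simps)
  show "continuous_on UNIV (\<lambda>x. u x *\<^sub>R Dv x + v x *\<^sub>R Du x)"
    using assms by (intro continuous_intros C1_grad_continuous C1_grad_continuous_grad)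
qed

lemma C1_grad_compose:
  assumes u: "C1_grad u Du" and f: "\<And>t. (f has_real_derivative f' t) (at t)"
    and f': "continuous_on UNIV f'"
  shows "C1_grad (\<lambda>x. f (u x)) (\<lambda>x. f' (u x) *\<^sub>R Du x)"
proof (rule C1_gradI)
  show "((\<lambda>x. f (u x)) has_derivative (\<lambda>h. (f' (u x) *\<^sub>R Du x) \<bullet> h)) (at x)" for x
    using has_derivative_compose[OF C1_grad_has_derivative[OF u, of x UNIV]
        f[of "u x", THEN has_field_derivative_imp_has_derivative]]
    by simp
  have "continuous_on UNIV (\<lambda>x. f' (u x))"
    by (rule continuous_on_compose2[OF f' C1_grad_continuous[OF u]]) auto
  then show "continuous_on UNIV (\<lambda>x. f' (u x) *\<^sub>R Du x)"
    using u by (intro continuous_intros C1_grad_continuous_grad)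
qed

text \<open>Radial functions are written in s = |x|^2/2 throughout. Its gradient is x, so f(s) is
  C^1 at the origin too, where |x| is not differentiable.\<close>

lemma C1_grad_half_norm: "C1_grad (\<lambda>x. (norm x)\<^sup>2 / 2) (\<lambda>x. x)"
proof (rule C1_gradI)
  show "((\<lambda>x. (norm x)\<^sup>2 / 2) has_derivative (\<lambda>h. x \<bullet> h)) (at x)" for x :: 'a
    unfolding power2_norm_eq_inner
    by (auto intro!: derivative_eq_intros simp: inner_commute)
qed (auto intro!: continuous_intros)

lemmas C1_grad_radial = C1_grad_compose[OF C1_grad_half_norm]

lemma C1_grad_cmult:
  assumes "C1_grad u Du" shows "C1_grad (\<lambda>x. c * u x) (\<lambda>x. c *\<^sub>R Du x)"
  using C1_grad_mult[OF C1_grad_const[of c] assms] by simp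

lemma C1_grad_cong:
  assumes "C1_grad u Du" "\<And>x. u x = v x" "\<And>x. Du x = Dv x" shows "C1_grad v Dv"
proof -
  have "u = v" "Du = Dv" using assms by auto
  then show ?thesis using assms(1) by simp
qed

section \<open>Integration by parts for functions of bounded support\<close>

lemma integrable_continuous_bounded_support:
  fixes f :: "'a::euclidean_space \<Rightarrow> 'b::euclidean_space"
  assumes "continuous_on UNIV f" and "\<And>x. norm x > T \<Longrightarrow> f x = 0"
  shows "integrable lborel f"
proof -
  have "integrable lborel (\<lambda>x. indicator (cball 0 T) x *\<^sub>R f x)"
    by (rule borel_integrable_compact) (auto intro: continuous_on_subset[OF assms(1)])
  moreover have "indicat_real (cball 0 T) x *\<^sub>R f x = f x" for x
    using assms(2)[of x] by (cases "x \<in> cball 0 T") (auto simp: not_le)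
  ultimately show ?thesis by simp
qed

lemma integrable_continuous_on_cball:
  fixes f :: "'a::euclidean_space \<Rightarrow> 'b::euclidean_space"
  assumes "continuous_on (cball 0 T) f"
  shows "integrable lborel (\<lambda>x. indicator (cball 0 T) x *\<^sub>R f x)"
  by (rule borel_integrable_compact) (auto intro: assms)

lemma C1_grad_MVT:
  assumes "C1_grad u Du"
  obtains t where "0 \<le> t" "t \<le> 1" "u (x + h) - u x = Du (x + t *\<^sub>R h) \<bullet> h"
proof -
  have "((\<lambda>t. u (x + t *\<^sub>R h)) has_real_derivative (Du (x + t *\<^sub>R h) \<bullet> h)) (at t)" for t
  proof -
    have "((\<lambda>t. u (x + t *\<^sub>R h)) has_derivative (\<lambda>s. Du (x + t *\<^sub>R h) \<bullet> (s *\<^sub>R h))) (at t)"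
      by (rule has_derivative_compose[OF _ C1_grad_has_derivative[OF assms], where f="\<lambda>t. x + t *\<^sub>R h"])
        (auto intro!: derivative_eq_intros)
    then show ?thesis by (simp add: has_field_derivative_def mult.commute[of _ "_ \<bullet> _"])
  qed
  then obtain z where "0 < z" "z < 1"
      "u (x + 1 *\<^sub>R h) - u (x + 0 *\<^sub>R h) = (1 - 0) * (Du (x + z *\<^sub>R h) \<bullet> h)"
    using MVT2[of 0 1 "\<lambda>t. u (x + t *\<^sub>R h)" "\<lambda>t. Du (x + t *\<^sub>R h) \<bullet> h"] by auto
  then show thesis using that[of z] by simp
qed

lemma C1_grad_zero_on_open:
  assumes "C1_grad q Dq" "open U" "\<And>x. x \<in> U \<Longrightarrow> q x = 0" "x \<in> U"
  shows "Dq x = 0"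
proof -
  have "((\<lambda>x. 0) has_derivative (\<lambda>h. Dq x \<bullet> h)) (at x)"
    using assms by (intro has_derivative_transform_within_open[OF C1_grad_has_derivative[OF assms(1), of x UNIV]])
      auto
  then have "(\<lambda>h. Dq x \<bullet> h) = (\<lambda>h. 0)"
    using has_derivative_unique[OF _ has_derivative_const] by blast
  then have "Dq x \<bullet> Dq x = 0" by metis
  then show ?thesis by simp
qed

lemma C1_grad_zero_outside:
  assumes "C1_grad q Dq" "\<And>x. norm x > T \<Longrightarrow> q x = 0" "norm x > T"
  shows "Dq x = 0"
proof -
  have "open {x::'a. norm x > T}" by (intro open_Collect_less continuous_intros)
  then show ?thesis using C1_grad_zero_on_open[OF assms(1)] assms(2,3) by (metis mem_Collect_eq)
qed

text \<open>Difference quotients in direction n have integral zero by translation invariance of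
  Lebesgue measure, and dominated convergence passes to the derivative. Every integration by parts
  below goes back to this.\<close>

lemma C1_grad_integral_zero:
  fixes n :: "'a::euclidean_space"
  assumes q: "C1_grad q Dq" and supp: "\<And>x. norm x > T \<Longrightarrow> q x = 0"
  shows "integrable lborel (\<lambda>x. Dq x \<bullet> n)" "(\<integral>x. Dq x \<bullet> n \<partial>lborel) = 0"
proof -
  have zero: "Dq x = 0" if "norm x > T" for x
    using C1_grad_zero_outside[OF q supp that] .
  have contD: "continuous_on S Dq" for S by (rule C1_grad_continuous_grad[OF q])
  show "integrable lborel (\<lambda>x. Dq x \<bullet> n)"
    by (rule integrable_continuous_bounded_support[of _ T])
      (auto intro!: continuous_intros contD simp: zero)
  have q_int: "integrable lborel q"
    by (rule integrable_continuous_bounded_support[of _ T])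
      (auto intro!: C1_grad_continuous[OF q] simp: supp)
  have "bounded (Dq ` cball 0 (T + 1 + norm n))"
    by (intro compact_imp_bounded compact_continuous_image contD) auto
  then obtain B where B: "\<And>x. norm x \<le> T + 1 + norm n \<Longrightarrow> norm (Dq x) \<le> B"
    unfolding bounded_iff by (metis imageI mem_cball_0)
  have bound: "norm (Dq x) \<le> max B 0" for x
    using B[of x] zero[of x] norm_ge_zero[of n] by (cases "norm x \<le> T + 1 + norm n") auto
  define d where "d k x = real (Suc k) * (q (x + (1 / real (Suc k)) *\<^sub>R n) - q x)" for k x
  have d_zero: "(\<integral>x. d k x \<partial>lborel) = 0" for k
  proof -
    have shift: "distr lborel borel (\<lambda>x. x + c) = lborel" for c :: 'a
      using lborel_distr_plus[of c] by (metis (no_types, lifting) add.commute distr_cong)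
    have "integrable lborel (\<lambda>x. q (x + (1 / real (Suc k)) *\<^sub>R n))"
      using integrable_distr[of "\<lambda>x. x + (1 / real (Suc k)) *\<^sub>R n" lborel borel q] q_int
      by (simp only: shift) simp
    moreover have "(\<integral>x. q (x + (1 / real (Suc k)) *\<^sub>R n) \<partial>lborel) = (\<integral>x. q x \<partial>lborel)"
      by (subst integral_distr[where N=borel and f=q, symmetric])
        (auto simp only: shift intro: C1_grad_continuous[OF q, of UNIV, THEN borel_measurable_continuous_onI], simp)
    ultimately show ?thesis using q_int unfolding d_def by simp
  qed
  have lim: "(\<lambda>k. \<integral>x. d k x \<partial>lborel) \<longlonglongrightarrow> (\<integral>x. Dq x \<bullet> n \<partial>lborel)"
  proof (rule integral_dominated_convergence)
    \<comment> \<open>The steps are at most |n| long, so all quotients vanish beyond T + |n|; the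
      mean value theorem bounds them inside.\<close>
    let ?w = "\<lambda>x. indicator (cball 0 (T + norm n)) x *\<^sub>R (max B 0 * norm n)"
    show "integrable lborel ?w"
      by (rule integrable_continuous_on_cball[OF continuous_on_const])
    show "(\<lambda>x. Dq x \<bullet> n) \<in> borel_measurable lborel"
      by (auto intro!: borel_measurable_continuous_onI continuous_intros contD)
    show "d k \<in> borel_measurable lborel" for k
      unfolding d_def
      by (auto intro!: borel_measurable_continuous_onI continuous_intros
          continuous_on_compose2[OF C1_grad_continuous[OF q, of UNIV]])
    show "AE x in lborel. (\<lambda>k. d k x) \<longlonglongrightarrow> Dq x \<bullet> n"
    proof (rule AE_I2)
      fix x :: 'a
      have "((\<lambda>t. q (x + t *\<^sub>R n)) has_derivative (\<lambda>s. Dq (x + 0 *\<^sub>R n) \<bullet> (s *\<^sub>R n))) (at 0)"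
        by (rule has_derivative_compose[OF _ C1_grad_has_derivative[OF q], where f="\<lambda>t. x + t *\<^sub>R n"])
          (auto intro!: derivative_eq_intros)
      then have "((\<lambda>t. q (x + t *\<^sub>R n)) has_real_derivative (Dq x \<bullet> n)) (at 0)"
        by (simp add: has_field_derivative_def mult.commute[of _ "_ \<bullet> _"])
      then have "((\<lambda>h. (q (x + h *\<^sub>R n) - q x) / h) \<longlongrightarrow> Dq x \<bullet> n) (at 0)"
        by (simp add: DERIV_def)
      moreover have "filterlim (\<lambda>k. 1 / real (Suc k)) (at 0) sequentially"
        using LIMSEQ_Suc[OF lim_1_over_n] by (intro filterlim_atI always_eventually) (auto simp del: of_nat_Suc)
      ultimately have "(\<lambda>k. (q (x + (1 / real (Suc k)) *\<^sub>R n) - q x) / (1 / real (Suc k))) \<longlonglongrightarrow> Dq x \<bullet> n"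
        by (rule filterlim_compose)
      then show "(\<lambda>k. d k x) \<longlonglongrightarrow> Dq x \<bullet> n"
        by (simp add: d_def mult.commute)
    qed
    show "AE x in lborel. norm (d k x) \<le> ?w x" for k
    proof (rule AE_I2)
      fix x :: 'a
      let ?h = "(1 / real (Suc k)) *\<^sub>R n"
      obtain t where t: "0 \<le> t" "t \<le> 1" "q (x + ?h) - q x = Dq (x + t *\<^sub>R ?h) \<bullet> ?h"
        using C1_grad_MVT[OF q] by metis
      have "d k x = Dq (x + t *\<^sub>R ?h) \<bullet> n"
        unfolding d_def t(3) by simp
      then have le: "norm (d k x) \<le> norm (Dq (x + t *\<^sub>R ?h)) * norm n"
        using Cauchy_Schwarz_ineq2 by auto
      show "norm (d k x) \<le> ?w x"
      proof (cases "norm x \<le> T + norm n")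
        case True
        have "norm (Dq (x + t *\<^sub>R ?h)) * norm n \<le> max B 0 * norm n"
          by (intro mult_right_mono bound) auto
        with le True show ?thesis by simp
      next
        case False
        have "norm x \<le> norm (x + t *\<^sub>R ?h) + norm (t *\<^sub>R ?h)"
          by (metis add_diff_cancel_right' norm_triangle_ineq4)
        moreover have "norm (t *\<^sub>R ?h) \<le> norm n"
        proof -
          have "t * (1 / real (Suc k)) \<le> 1 * 1"
            using t by (intro mult_mono) auto
          then have "t * (1 / real (Suc k)) * norm n \<le> 1 * norm n"
            by (intro mult_right_mono) auto
          then show ?thesis using t by simp
        qed
        ultimately have "norm (x + t *\<^sub>R ?h) > T" using False by simp
        with le zero show ?thesis by simp
      qed
    qed
  qed
  then show "(\<integral>x. Dq x \<bullet> n \<partial>lborel) = 0"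
    using d_zero by (simp add: LIMSEQ_const_iff)
qed

text \<open>The integrand is the divergence of q(x) x: sum the previous lemma over the coordinates
  q(x) (x . b) in direction b.\<close>

lemma C1_grad_radial_integral_zero:
  fixes q :: "'a::euclidean_space \<Rightarrow> real"
  assumes q: "C1_grad q Dq" and supp: "\<And>x. norm x > T \<Longrightarrow> q x = 0"
  shows "integrable lborel (\<lambda>x. Dq x \<bullet> x + real DIM('a) * q x)"
    "(\<integral>x. Dq x \<bullet> x + real DIM('a) * q x \<partial>lborel) = 0"
proof -
  have b: "C1_grad (\<lambda>x. q x * (x \<bullet> b)) (\<lambda>x. q x *\<^sub>R b + (x \<bullet> b) *\<^sub>R Dq x)" for b
    by (rule C1_grad_mult[OF q C1_grad_inner])
  have supp': "norm x > T \<Longrightarrow> q x * (x \<bullet> b) = 0" for b x by (simp add: supp)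
  note * = C1_grad_integral_zero[OF b supp', where n=b for b]
  have eq: "(\<Sum>b\<in>Basis. (q x *\<^sub>R b + (x \<bullet> b) *\<^sub>R Dq x) \<bullet> b) = Dq x \<bullet> x + real DIM('a) * q x" for x
    by (simp add: inner_add_left sum.distrib euclidean_inner[of "Dq x" x] mult.commute inner_same_Basis)
  have "integrable lborel (\<lambda>x. \<Sum>b\<in>Basis. (q x *\<^sub>R b + (x \<bullet> b) *\<^sub>R Dq x) \<bullet> b)"
    by (intro Bochner_Integration.integrable_sum *)
  then show "integrable lborel (\<lambda>x. Dq x \<bullet> x + real DIM('a) * q x)"
    by (simp only: eq)
  have "(\<integral>x. (\<Sum>b\<in>Basis. (q x *\<^sub>R b + (x \<bullet> b) *\<^sub>R Dq x) \<bullet> b) \<partial>lborel) = 0"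
    by (subst Bochner_Integration.integral_sum) (auto simp only: * intro!: sum.neutral)
  then show "(\<integral>x. Dq x \<bullet> x + real DIM('a) * q x \<partial>lborel) = 0"
    by (simp only: eq)
qed

section \<open>The Gaussian weight on balls\<close>

text \<open>The Gaussian weight without its normalising constant, which cancels from every Rayleigh
  quotient; \<open>integral_gauss_wball\<close> restores it.\<close>

definition gw :: "'a::euclidean_space \<Rightarrow> real" where
  "gw x = exp (- ((norm x)\<^sup>2 / 2))"

lemma gw_pos: "gw x > 0" and gw_le_1: "gw x \<le> 1"
  by (auto simp: gw_def)

lemma C1_grad_gw: "C1_grad gw (\<lambda>x. - gw x *\<^sub>R x)"
proof -
  have "((\<lambda>s. exp (- s)) has_real_derivative - exp (- t)) (at t)" for t :: real
    by (auto intro!: derivative_eq_intros)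
  moreover have "continuous_on UNIV (\<lambda>t::real. - exp (- t))" by (intro continuous_intros)
  ultimately show ?thesis unfolding gw_def by (rule C1_grad_radial)
qed

lemma continuous_on_gw [continuous_intros]: "continuous_on S gw"
  by (rule C1_grad_continuous[OF C1_grad_gw])

lemma borel_measurable_gw [measurable]: "gw \<in> borel_measurable borel"
  by (intro borel_measurable_continuous_onI continuous_on_gw)

text \<open>The weighted ball as a measure on the whole type, so that integrands need not be
  multiplied by the indicator of the ball.\<close>

definition wball :: "real \<Rightarrow> 'a::euclidean_space measure" where
  "wball r = density lborel (\<lambda>x. ennreal (indicator (ball 0 r) x * gw x))"

lemma sets_wball [simp, measurable_cong]: "sets (wball r) = sets borel"
  and space_wball [simp]: "space (wball r) = UNIV"
  by (auto simp: wball_def)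

lemma borel_measurable_wball_weight [measurable]:
  "(\<lambda>x::'a::euclidean_space. indicator (ball 0 r) x * gw x) \<in> borel_measurable borel"
  by (intro borel_measurable_times borel_measurable_indicator borel_measurable_gw) auto

lemma integral_wball:
  fixes f :: "'a::euclidean_space \<Rightarrow> real"
  assumes "f \<in> borel_measurable borel"
  shows "(\<integral>x. f x \<partial>wball r) = (\<integral>x. indicator (ball 0 r) x * gw x * f x \<partial>lborel)"
  unfolding wball_def using assms
  by (subst integral_density) (auto intro: AE_I2 simp: gw_pos less_imp_le)

lemma AE_wball: "AE x in wball r. norm x < r"
proof -
  have "AE x in lborel. 0 < ennreal (indicator (ball 0 r) x * gw x) \<longrightarrow> norm x < r"
    by (intro AE_I2) (auto simp: indicator_def split: if_splits)
  then show ?thesis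
    unfolding wball_def by (subst AE_density) auto
qed

lemma finite_measure_wball: "finite_measure (wball r :: 'a::euclidean_space measure)"
proof
  have "emeasure (wball r :: 'a measure) (space (wball r)) =
      (\<integral>\<^sup>+x. ennreal (indicator (ball 0 r) x * gw x) * indicator UNIV x \<partial>(lborel::'a measure))"
    unfolding wball_def by (subst emeasure_density) auto
  also have "\<dots> \<le> (\<integral>\<^sup>+x. indicator (ball 0 r) x \<partial>(lborel::'a measure))"
    by (intro nn_integral_mono) (auto simp: gw_le_1 indicator_def)
  also have "\<dots> = emeasure lborel (ball (0::'a) r)" by simp
  also have "\<dots> < \<infinity>" by (rule emeasure_lborel_ball_finite)
  finally show "emeasure (wball r :: 'a measure) (space (wball r)) \<noteq> \<infinity>" by simp
qed

interpretation wball: finite_measure "wball r" for r by (rule finite_measure_wball)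

lemma integrable_wball_bounded:
  fixes f :: "'a::euclidean_space \<Rightarrow> 'b::euclidean_space"
  assumes "f \<in> borel_measurable borel" "\<And>x. norm x < r \<Longrightarrow> norm (f x) \<le> C"
  shows "integrable (wball r) f"
proof (rule wball.integrable_const_bound)
  show "AE x in wball r. norm (f x) \<le> C"
    using AE_wball[of r] by eventually_elim (rule assms(2))
qed (use assms(1) in simp)

lemma continuous_bounded_on_cball:
  fixes f :: "'a::euclidean_space \<Rightarrow> 'b::real_normed_vector"
  assumes "continuous_on UNIV f"
  obtains C where "C \<ge> 0" "\<And>x. norm x \<le> r \<Longrightarrow> norm (f x) \<le> C"
proof -
  have "bounded (f ` cball 0 r)"
    by (intro compact_imp_bounded compact_continuous_image continuous_on_subset[OF assms]) auto
  then obtain C where "\<And>x. norm x \<le> r \<Longrightarrow> norm (f x) \<le> C"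
    unfolding bounded_iff by (metis imageI mem_cball_0)
  then have "\<And>x. norm x \<le> r \<Longrightarrow> norm (f x) \<le> max C 0" by fastforce
  then show thesis using that[of "max C 0"] by simp
qed

lemma integrable_wball_continuous:
  fixes f :: "'a::euclidean_space \<Rightarrow> 'b::euclidean_space"
  assumes "continuous_on UNIV f"
  shows "integrable (wball r) f"
proof -
  obtain C where "C \<ge> 0" "\<And>x. norm x \<le> r \<Longrightarrow> norm (f x) \<le> C"
    using continuous_bounded_on_cball[OF assms] by metis
  then show ?thesis
    using assms by (intro integrable_wball_bounded[of _ _ C] borel_measurable_continuous_onI) auto
qed

lemma AE_wball_nonzero: "AE x in wball r. x \<noteq> 0"
proof -
  have "AE x in lborel. x \<noteq> (0::'a)" by (rule AE_lborel_singleton)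
  then have "AE x in lborel. 0 < ennreal (indicator (ball 0 r) x * gw x) \<longrightarrow> x \<noteq> (0::'a)"
    by eventually_elim auto
  then show ?thesis
    unfolding wball_def by (subst AE_density) auto
qed

text \<open>The origin is exempted from the pointwise limit because the radial truncations used
  later vanish near it for each k.\<close>

lemma wball_dominated_convergence:
  fixes f :: "nat \<Rightarrow> 'a::euclidean_space \<Rightarrow> real"
  assumes "\<And>k. f k \<in> borel_measurable borel" "g \<in> borel_measurable borel"
    and "\<And>k x. norm x < r \<Longrightarrow> \<bar>f k x\<bar> \<le> C"
    and "\<And>x. norm x < r \<Longrightarrow> x \<noteq> 0 \<Longrightarrow> (\<lambda>k. f k x) \<longlonglongrightarrow> g x"
  shows "(\<lambda>k. \<integral>x. f k x \<partial>wball r) \<longlonglongrightarrow> (\<integral>x. g x \<partial>wball r)"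
proof (rule integral_dominated_convergence[where w="\<lambda>_. C"])
  show "AE x in wball r. (\<lambda>k. f k x) \<longlonglongrightarrow> g x"
    using AE_wball[of r] AE_wball_nonzero[of r] by eventually_elim (rule assms(4))
  show "AE x in wball r. norm (f k x) \<le> C" for k
    using AE_wball[of r] by eventually_elim (simp add: assms(3))
qed (use assms(1,2) in auto)

section \<open>Cutoff functions for the ball\<close>

lemma half_norm_less_iff: "r > 0 \<Longrightarrow> (norm x)\<^sup>2 / 2 < r\<^sup>2 / 2 \<longleftrightarrow> norm x < r"
  using power_strict_mono[of "norm x" r 2] power_mono[of r "norm x" 2] by fastforce

lemma half_norm_le: "norm x \<le> r \<Longrightarrow> (norm x)\<^sup>2 / 2 \<le> r\<^sup>2 / 2"
  by (simp add: power_mono)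

text \<open>A C^1 step from 0 to 1. What matters is that t \<open>mcut'\<close> t is bounded and
  tends to 0: when t is a large multiple of the distance to the sphere, measured in s, the
  derivative of the cutoff is harmless against any function vanishing linearly there.\<close>

definition mcut :: "real \<Rightarrow> real" where "mcut t = (max 0 t)\<^sup>2 / (1 + (max 0 t)\<^sup>2)"

definition mcut' :: "real \<Rightarrow> real" where "mcut' t = 2 * max 0 t / (1 + (max 0 t)\<^sup>2)\<^sup>2"

lemma DERIV_max_square: "((\<lambda>t. (max 0 t)\<^sup>2) has_real_derivative 2 * max 0 t) (at (t::real))"
proof -
  consider "t < 0" | "t > 0" | "t = 0" by linarith
  then show ?thesis
  proof cases
    case 1
    then have "((\<lambda>t. 0) has_real_derivative 2 * max 0 t) (at t)" by simp
    then show ?thesis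
      by (rule DERIV_cong_ev[THEN iffD1, OF refl _ refl, rotated])
        (use 1 in \<open>auto intro!: eventually_mono[OF eventually_nhds_in_open[of "{..<0}" t]]\<close>)
  next
    case 2
    have "((\<lambda>t. t\<^sup>2) has_real_derivative 2 * max 0 t) (at t)"
      using 2 by (auto intro!: derivative_eq_intros)
    then show ?thesis
      by (rule DERIV_cong_ev[THEN iffD1, OF refl _ refl, rotated])
        (use 2 in \<open>auto intro!: eventually_mono[OF eventually_nhds_in_open[of "{0<..}" t]]\<close>)
  next
    case 3
    have "((\<lambda>h. (max 0 h)\<^sup>2 / h) \<longlongrightarrow> 0) (at (0::real))"
    proof (rule Lim_null_comparison)
      show "\<forall>\<^sub>F h in at (0::real). norm ((max 0 h)\<^sup>2 / h) \<le> \<bar>h\<bar>"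
        by (intro always_eventually allI) (auto simp: max_def power2_eq_square)
      show "((\<lambda>h::real. \<bar>h\<bar>) \<longlongrightarrow> 0) (at 0)" by (intro tendsto_eq_intros) auto
    qed
    then show ?thesis using 3 by (simp add: DERIV_def)
  qed
qed

lemma DERIV_mcut: "(mcut has_real_derivative mcut' t) (at t)"
proof -
  have pos: "1 + (max 0 t)\<^sup>2 \<noteq> 0" by (simp add: add_nonneg_eq_0_iff)
  show ?thesis unfolding mcut_def mcut'_def
    by (rule derivative_eq_intros DERIV_max_square pos refl)+
      (use pos in \<open>simp add: field_simps power2_eq_square\<close>)
qed

lemma continuous_on_mcut': "continuous_on S mcut'"
  unfolding mcut'_def by (intro continuous_intros) (auto simp: add_nonneg_eq_0_iff)

lemma mcut_nonneg: "0 \<le> mcut t" and mcut_le_1: "mcut t \<le> 1" and mcut'_nonneg: "0 \<le> mcut' t"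
  and mcut_0: "t \<le> 0 \<Longrightarrow> mcut t = 0" and mcut'_0: "t \<le> 0 \<Longrightarrow> mcut' t = 0"
  by (auto simp: mcut_def mcut'_def divide_simps add_pos_nonneg)

lemma mcut'_bound: "t * mcut' t \<le> 2"
proof (cases "t \<le> 0")
  case False
  have "0 \<le> 2 + 2 * t\<^sup>2 + 2 * (t\<^sup>2)\<^sup>2" by (intro add_nonneg_nonneg) auto
  then have "2 * t\<^sup>2 \<le> 2 * (1 + t\<^sup>2)\<^sup>2"
    by (simp add: power2_eq_square algebra_simps)
  moreover have "1 + t\<^sup>2 > 0" by (simp add: add_pos_nonneg)
  then have "(1 + t\<^sup>2)\<^sup>2 > 0" by simp
  ultimately show ?thesis using False
    by (simp add: mcut'_def divide_simps power2_eq_square)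
qed (simp add: mcut'_0)

lemma mcut_tendsto: "a > 0 \<Longrightarrow> (\<lambda>k. mcut (real (Suc k) * a)) \<longlonglongrightarrow> 1"
proof -
  assume a: "a > 0"
  have "((\<lambda>x. (x * a)\<^sup>2 / (1 + (x * a)\<^sup>2)) \<longlongrightarrow> 1) at_top"
    using a by real_asymp
  then have "(\<lambda>k. (real (Suc k) * a)\<^sup>2 / (1 + (real (Suc k) * a)\<^sup>2)) \<longlonglongrightarrow> 1"
    by (rule filterlim_compose[OF _ filterlim_compose[OF filterlim_real_sequentially filterlim_Suc]])
  then show ?thesis using a by (simp add: mcut_def max_def mult_le_0_iff)
qed

lemma mcut'_tendsto: "a > 0 \<Longrightarrow> (\<lambda>k. (real (Suc k) * a) * mcut' (real (Suc k) * a)) \<longlonglongrightarrow> 0"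
proof -
  assume a: "a > 0"
  have "((\<lambda>x. (x * a) * (2 * (x * a) / (1 + (x * a)\<^sup>2)\<^sup>2)) \<longlongrightarrow> 0) at_top"
    using a by real_asymp
  then have "(\<lambda>k. (real (Suc k) * a) * (2 * (real (Suc k) * a) / (1 + (real (Suc k) * a)\<^sup>2)\<^sup>2)) \<longlonglongrightarrow> 0"
    by (rule filterlim_compose[OF _ filterlim_compose[OF filterlim_real_sequentially filterlim_Suc]])
  then show ?thesis using a by (simp add: mcut'_def max_def mult_le_0_iff)
qed

definition cutoff :: "real \<Rightarrow> nat \<Rightarrow> 'a::euclidean_space \<Rightarrow> real" where
  "cutoff r k x = mcut (real (Suc k) * (r\<^sup>2 / 2 - (norm x)\<^sup>2 / 2))"

text \<open>The gradient of \<open>cutoff\<close> is this scalar times x.\<close>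

definition cutoff' :: "real \<Rightarrow> nat \<Rightarrow> 'a::euclidean_space \<Rightarrow> real" where
  "cutoff' r k x = - real (Suc k) * mcut' (real (Suc k) * (r\<^sup>2 / 2 - (norm x)\<^sup>2 / 2))"

lemma C1_grad_cutoff: "C1_grad (cutoff r k) (\<lambda>x. cutoff' r k x *\<^sub>R x)"
  unfolding cutoff_def cutoff'_def
proof (rule C1_grad_radial)
  show "((\<lambda>s. mcut (real (Suc k) * (r\<^sup>2 / 2 - s))) has_real_derivative
      - real (Suc k) * mcut' (real (Suc k) * (r\<^sup>2 / 2 - t))) (at t)" for t
    by (rule DERIV_chain2[OF DERIV_mcut, THEN DERIV_cong])
      (auto intro!: derivative_eq_intros)
  show "continuous_on UNIV (\<lambda>t. - real (Suc k) * mcut' (real (Suc k) * (r\<^sup>2 / 2 - t)))"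
    by (intro continuous_intros continuous_on_compose2[OF continuous_on_mcut'[of UNIV]]) auto
qed

lemma cutoff_outside: "r > 0 \<Longrightarrow> norm x \<ge> r \<Longrightarrow> cutoff r k x = 0"
  and cutoff'_outside: "r > 0 \<Longrightarrow> norm x \<ge> r \<Longrightarrow> cutoff' r k x = 0"
  using power_mono[of r "norm x" 2]
  by (auto simp: cutoff_def cutoff'_def mult_le_0_iff intro!: mcut_0 mcut'_0)

lemma cutoff_nonneg: "0 \<le> cutoff r k x" and cutoff_le_1: "cutoff r k x \<le> 1"
  and cutoff'_nonpos: "cutoff' r k x \<le> 0"
  using mult_nonneg_nonneg[OF _ mcut'_nonneg, of "real (Suc k)"]
  by (auto simp: cutoff_def cutoff'_def mcut_nonneg mcut_le_1 simp del: of_nat_Suc)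

lemma cutoff_tendsto: "r > 0 \<Longrightarrow> norm x < r \<Longrightarrow> (\<lambda>k. cutoff r k x) \<longlonglongrightarrow> 1"
  unfolding cutoff_def using half_norm_less_iff[of r x] by (intro mcut_tendsto) simp

text \<open>The left side is t \<open>mcut'\<close> t at t = (k + 1) (r^2/2 - |x|^2/2).\<close>

lemma cutoff'_bound:
  assumes "r > 0" "norm x < r"
  shows "\<bar>cutoff' r k x\<bar> * (r\<^sup>2 / 2 - (norm x)\<^sup>2 / 2) \<le> 2"
  using mcut'_bound[of "real (Suc k) * (r\<^sup>2 / 2 - (norm x)\<^sup>2 / 2)"] mcut'_nonneg
  by (simp add: cutoff'_def abs_mult mult_ac del: of_nat_Suc)

lemma cutoff'_tendsto:
  assumes "r > 0" "norm x < r"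
  shows "(\<lambda>k. \<bar>cutoff' r k x\<bar> * (r\<^sup>2 / 2 - (norm x)\<^sup>2 / 2)) \<longlonglongrightarrow> 0"
proof -
  have "r\<^sup>2 / 2 - (norm x)\<^sup>2 / 2 > 0" using half_norm_less_iff[of r x] assms by simp
  from mcut'_tendsto[OF this] show ?thesis
    using mcut'_nonneg by (simp add: cutoff'_def abs_mult mult_ac del: of_nat_Suc)
qed

lemma C1_grad_measurable:
  assumes "C1_grad u Du"
  shows "u \<in> borel_measurable borel" "Du \<in> borel_measurable borel"
  using assms by (auto intro!: borel_measurable_continuous_onI C1_grad_continuous C1_grad_continuous_grad)

lemma borel_measurable_cutoff [measurable]:
  "cutoff r k \<in> borel_measurable borel" "cutoff' r k \<in> borel_measurable borel"
proof -
  show "cutoff r k \<in> borel_measurable borel"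
    by (rule C1_grad_measurable[OF C1_grad_cutoff])
  have "continuous_on UNIV (cutoff' r k)" unfolding cutoff'_def
    by (intro continuous_intros continuous_on_compose2[OF continuous_on_mcut'[of UNIV]]) auto
  then show "cutoff' r k \<in> borel_measurable borel" by (rule borel_measurable_continuous_onI)
qed

lemma integral_lborel_eq_wball:
  fixes f :: "'a::euclidean_space \<Rightarrow> real"
  assumes "f \<in> borel_measurable borel" "\<And>x. norm x \<ge> r \<Longrightarrow> f x = 0"
  shows "(\<integral>x. gw x * f x \<partial>lborel) = (\<integral>x. f x \<partial>wball r)"
  using assms(1) by (subst integral_wball)
    (auto intro!: Bochner_Integration.integral_cong simp: indicator_def assms(2))

text \<open>The divergence theorem for the field \<open>q(x) x\<close>; there is no boundary term since \<open>q\<close>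
  vanishes on the sphere.\<close>

lemma wball_divergence_radial:
  fixes q :: "'a::euclidean_space \<Rightarrow> real"
  assumes q: "C1_grad q Dq" and r: "r > 0"
    and vanish: "\<And>x. norm x < r \<Longrightarrow> \<bar>q x\<bar> \<le> C * (r\<^sup>2 / 2 - (norm x)\<^sup>2 / 2)"
  shows "(\<integral>x. Dq x \<bullet> x + (real DIM('a) - (norm x)\<^sup>2) * q x \<partial>wball r) = 0"
proof -
  note [measurable] = C1_grad_measurable[OF q]
  \<comment> \<open>\<open>gw\<close> times F is the divergence of the field gw cutoff q x; the
    factor N - |x|^2 combines div x = N with D gw = -gw x.\<close>
  define F where "F k x = cutoff r k x * (Dq x \<bullet> x + (real DIM('a) - (norm x)\<^sup>2) * q x)
      + cutoff' r k x * (norm x)\<^sup>2 * q x" for k and x :: 'a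
  have F_meas [measurable]: "F k \<in> borel_measurable borel" for k
    unfolding F_def by measurable
  have F0: "(\<integral>x. F k x \<partial>wball r) = 0" for k
  proof -
    have c: "C1_grad (\<lambda>x. gw x * (cutoff r k x * q x))
      (\<lambda>x. gw x *\<^sub>R (cutoff r k x *\<^sub>R Dq x + q x *\<^sub>R (cutoff' r k x *\<^sub>R x))
         + (cutoff r k x * q x) *\<^sub>R (- gw x *\<^sub>R x))"
      by (intro C1_grad_mult C1_grad_gw C1_grad_cutoff q)
    have z: "gw x * (cutoff r k x * q x) = 0" if "norm x > r" for x
      using that cutoff_outside[OF r, of x] by simp
    have "(\<integral>x. gw x * F k x \<partial>lborel) = 0"
      using C1_grad_radial_integral_zero(2)[OF c z]
      by (simp add: F_def inner_add_left inner_diff_left algebra_simps power2_norm_eq_inner)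
    moreover have "F k x = 0" if "norm x \<ge> r" for x
      using that by (simp add: F_def cutoff_outside cutoff'_outside r)
    ultimately show ?thesis using integral_lborel_eq_wball[OF F_meas] by metis
  qed
  have cont: "continuous_on UNIV (\<lambda>x. Dq x \<bullet> x + (real DIM('a) - (norm x)\<^sup>2) * q x)"
    by (intro continuous_intros C1_grad_continuous[OF q] C1_grad_continuous_grad[OF q])
  obtain B where B: "B \<ge> 0"
    "\<And>x. norm x \<le> r \<Longrightarrow> norm (Dq x \<bullet> x + (real DIM('a) - (norm x)\<^sup>2) * q x) \<le> B"
    using continuous_bounded_on_cball[OF cont] by metis
  \<comment> \<open>The linear vanishing of q absorbs the growth of the derivative of the
    cutoff.\<close>
  have second: "\<bar>cutoff' r k x * (norm x)\<^sup>2 * q x\<bar>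
      \<le> (\<bar>cutoff' r k x\<bar> * (r\<^sup>2 / 2 - (norm x)\<^sup>2 / 2)) * (r\<^sup>2 * \<bar>C\<bar>)" if "norm x < r" for k and x :: 'a
  proof -
    have pos: "r\<^sup>2 / 2 - (norm x)\<^sup>2 / 2 > 0" using half_norm_less_iff[of r x] r that by simp
    have "\<bar>q x\<bar> \<le> \<bar>C\<bar> * (r\<^sup>2 / 2 - (norm x)\<^sup>2 / 2)"
      using vanish[OF that] pos by (smt (verit) mult_right_mono)
    moreover have "(norm x)\<^sup>2 \<le> r\<^sup>2" using that by (simp add: power_mono)
    ultimately have "(norm x)\<^sup>2 * \<bar>q x\<bar> \<le> r\<^sup>2 * (\<bar>C\<bar> * (r\<^sup>2 / 2 - (norm x)\<^sup>2 / 2))"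
      by (intro mult_mono) auto
    then have "\<bar>cutoff' r k x\<bar> * ((norm x)\<^sup>2 * \<bar>q x\<bar>)
        \<le> \<bar>cutoff' r k x\<bar> * (r\<^sup>2 * (\<bar>C\<bar> * (r\<^sup>2 / 2 - (norm x)\<^sup>2 / 2)))"
      by (intro mult_left_mono) auto
    then show ?thesis by (simp add: abs_mult algebra_simps)
  qed
  have "(\<lambda>k. \<integral>x. F k x \<partial>wball r) \<longlonglongrightarrow>
      (\<integral>x. Dq x \<bullet> x + (real DIM('a) - (norm x)\<^sup>2) * q x \<partial>wball r)"
  proof (rule wball_dominated_convergence[where C="B + 2 * (r\<^sup>2 * \<bar>C\<bar>)"])
    show "(\<lambda>x. Dq x \<bullet> x + (real DIM('a) - (norm x)\<^sup>2) * q x) \<in> borel_measurable borel" by measurable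
    fix x :: 'a assume x: "norm x < r"
    show "\<bar>F k x\<bar> \<le> B + 2 * (r\<^sup>2 * \<bar>C\<bar>)" for k
    proof -
      have "\<bar>cutoff r k x * (Dq x \<bullet> x + (real DIM('a) - (norm x)\<^sup>2) * q x)\<bar> \<le> 1 * B"
        unfolding abs_mult using B(2)[of x] x cutoff_nonneg[of r k x] cutoff_le_1[of r k x]
        by (intro mult_mono) auto
      moreover have "\<bar>cutoff' r k x * (norm x)\<^sup>2 * q x\<bar> \<le> 2 * (r\<^sup>2 * \<bar>C\<bar>)"
        by (rule order_trans[OF second[OF x] mult_right_mono[OF cutoff'_bound[OF r x]]]) simp
      ultimately show ?thesis unfolding F_def by linarith
    qed
    have "(\<lambda>k. cutoff' r k x * (norm x)\<^sup>2 * q x) \<longlonglongrightarrow> 0"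
      by (rule Lim_null_comparison[OF always_eventually[OF allI]])
        (use second[OF x] tendsto_mult_left_zero[OF cutoff'_tendsto[OF r x]] in
          \<open>simp_all del: abs_mult add: real_norm_def\<close>)
    from tendsto_add[OF tendsto_mult[OF cutoff_tendsto[OF r x] tendsto_const] this]
    show "(\<lambda>k. F k x) \<longlonglongrightarrow> Dq x \<bullet> x + (real DIM('a) - (norm x)\<^sup>2) * q x"
      unfolding F_def by simp
  qed measurable
  then show ?thesis using F0 by (simp add: LIMSEQ_const_iff)
qed

section \<open>Picone's inequality\<close>

text \<open>The profile \<open>\<kappa>\<close> is a function of \<open>s = |x|\<^sup>2 / 2\<close>; the functions \<open>(x \<bullet> n) \<kappa>(s)\<close> are the
  eigenfunctions of the ball for the eigenvalue \<open>\<mu>\<close>, and \<open>\<kappa> + 2 s \<kappa>'\<close> is the radial derivative of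
  \<open>|x| \<kappa>(s)\<close>.\<close>

locale neumann_profile =
  fixes N :: real and \<kappa> \<kappa>1 \<kappa>2 :: "real \<Rightarrow> real" and S \<mu> :: real
  assumes DERIV_\<kappa>: "(\<kappa> has_real_derivative \<kappa>1 s) (at s)"
    and DERIV_\<kappa>1: "(\<kappa>1 has_real_derivative \<kappa>2 s) (at s)"
    and continuous_\<kappa>2: "continuous_on UNIV \<kappa>2"
    and ode: "2 * s * \<kappa>2 s + (N + 2 - 2 * s) * \<kappa>1 s + (\<mu> - 1) * \<kappa> s = 0"
    and S_pos: "S > 0" and \<mu>_ge_1: "\<mu> \<ge> 1"
    and \<kappa>_pos: "0 \<le> s \<Longrightarrow> s \<le> S \<Longrightarrow> \<kappa> s > 0"
    and \<kappa>1_nonpos: "0 \<le> s \<Longrightarrow> s \<le> S \<Longrightarrow> \<kappa>1 s \<le> 0"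
    and flux_pos: "0 \<le> s \<Longrightarrow> s < S \<Longrightarrow> \<kappa> s + 2 * s * \<kappa>1 s > 0"
    and flux_zero: "\<kappa> S + 2 * S * \<kappa>1 S = 0"
begin

lemma continuous_\<kappa>: "continuous_on A \<kappa>" and continuous_\<kappa>1: "continuous_on A \<kappa>1"
  using DERIV_\<kappa> DERIV_\<kappa>1 by (auto intro: continuous_on_of_DERIV)

lemma flux_nonneg: "0 \<le> s \<Longrightarrow> s \<le> S \<Longrightarrow> \<kappa> s + 2 * s * \<kappa>1 s \<ge> 0"
  using flux_pos[of s] flux_zero by (cases "s = S") (auto simp: less_imp_le)

definition eigf :: "'a::euclidean_space \<Rightarrow> 'a \<Rightarrow> real" where
  "eigf n x = (x \<bullet> n) * \<kappa> ((norm x)\<^sup>2 / 2)"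

definition eigf' :: "'a::euclidean_space \<Rightarrow> 'a \<Rightarrow> 'a" where
  "eigf' n x = \<kappa> ((norm x)\<^sup>2 / 2) *\<^sub>R n + ((x \<bullet> n) * \<kappa>1 ((norm x)\<^sup>2 / 2)) *\<^sub>R x"

lemma C1_grad_\<kappa>: "C1_grad (\<lambda>x. \<kappa> ((norm x)\<^sup>2 / 2)) (\<lambda>x. \<kappa>1 ((norm x)\<^sup>2 / 2) *\<^sub>R x)"
  by (rule C1_grad_radial[OF DERIV_\<kappa> continuous_\<kappa>1])

lemma C1_grad_\<kappa>1: "C1_grad (\<lambda>x. \<kappa>1 ((norm x)\<^sup>2 / 2)) (\<lambda>x. \<kappa>2 ((norm x)\<^sup>2 / 2) *\<^sub>R x)"
  by (rule C1_grad_radial[OF DERIV_\<kappa>1 continuous_\<kappa>2])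

lemma C1_grad_eigf: "C1_grad (eigf n) (eigf' n)"
  by (rule C1_grad_cong[OF C1_grad_mult[OF C1_grad_inner[of n] C1_grad_\<kappa>]])
    (auto simp: eigf_def eigf'_def)

text \<open>This is the weak form of -div(gw Dh) = \<mu> gw h for h = \<open>eigf n\<close>. The two
  terms of Dh, along n and along x, are integrated by parts separately; what remains is gw q (x . n)
  times the left side of \<open>ode\<close>.\<close>

lemma eigf_weak:
  fixes q :: "'a::euclidean_space \<Rightarrow> real"
  assumes N: "N = real DIM('a)" and q: "C1_grad q Dq" and supp: "\<And>x. norm x > T \<Longrightarrow> q x = 0"
  shows "integrable lborel (\<lambda>x. gw x * (Dq x \<bullet> eigf' n x - \<mu> * q x * eigf n x))"
    and "(\<integral>x. gw x * (Dq x \<bullet> eigf' n x - \<mu> * q x * eigf n x) \<partial>lborel) = 0"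
proof -
  let ?s = "\<lambda>x::'a. (norm x)\<^sup>2 / 2"
  have q1: "C1_grad (\<lambda>x. q x * (gw x * \<kappa> (?s x)))
     (\<lambda>x. q x *\<^sub>R (gw x *\<^sub>R (\<kappa>1 (?s x) *\<^sub>R x) + \<kappa> (?s x) *\<^sub>R (- gw x *\<^sub>R x)) + (gw x * \<kappa> (?s x)) *\<^sub>R Dq x)"
    (is "C1_grad ?q1 ?Dq1")
    by (intro C1_grad_mult q C1_grad_gw C1_grad_\<kappa>)
  have q2: "C1_grad (\<lambda>x. q x * (gw x * (\<kappa>1 (?s x) * (x \<bullet> n))))
     (\<lambda>x. q x *\<^sub>R (gw x *\<^sub>R (\<kappa>1 (?s x) *\<^sub>R n + (x \<bullet> n) *\<^sub>R (\<kappa>2 (?s x) *\<^sub>R x))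
         + (\<kappa>1 (?s x) * (x \<bullet> n)) *\<^sub>R (- gw x *\<^sub>R x)) + (gw x * (\<kappa>1 (?s x) * (x \<bullet> n))) *\<^sub>R Dq x)"
    (is "C1_grad ?q2 ?Dq2")
    by (intro C1_grad_mult q C1_grad_gw C1_grad_\<kappa>1 C1_grad_inner)
  have s1: "norm x > T \<Longrightarrow> ?q1 x = 0" and s2: "norm x > T \<Longrightarrow> ?q2 x = 0" for x
    using supp by auto
  note I1 = C1_grad_integral_zero[OF q1 s1, where n=n]
  note I2 = C1_grad_radial_integral_zero[OF q2 s2]
  have eq: "?Dq1 x \<bullet> n + (?Dq2 x \<bullet> x + real DIM('a) * ?q2 x)
     = gw x * (Dq x \<bullet> eigf' n x - \<mu> * q x * eigf n x)" for x
  proof -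
    have xx: "x \<bullet> x = 2 * ?s x" by (simp add: power2_norm_eq_inner)
    have "?Dq1 x \<bullet> n + (?Dq2 x \<bullet> x + real DIM('a) * ?q2 x) -
        gw x * (Dq x \<bullet> eigf' n x - \<mu> * q x * eigf n x) =
      gw x * q x * (x \<bullet> n) *
        (2 * ?s x * \<kappa>2 (?s x) + (N + 2 - 2 * ?s x) * \<kappa>1 (?s x) + (\<mu> - 1) * \<kappa> (?s x))"
      unfolding eigf_def eigf'_def N
      by (simp add: inner_add_left inner_add_right inner_diff_left xx inner_commute[of n x] algebra_simps)
    then show ?thesis using ode[of "?s x"] by simp
  qed
  show "integrable lborel (\<lambda>x. gw x * (Dq x \<bullet> eigf' n x - \<mu> * q x * eigf n x))"
    using Bochner_Integration.integrable_add[OF I1(1) I2(1)] by (simp only: eq)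
  have "(\<integral>x. ?Dq1 x \<bullet> n + (?Dq2 x \<bullet> x + real DIM('a) * ?q2 x) \<partial>lborel) = 0"
    using I1 I2 by (subst Bochner_Integration.integral_add) auto
  then show "(\<integral>x. gw x * (Dq x \<bullet> eigf' n x - \<mu> * q x * eigf n x) \<partial>lborel) = 0"
    by (simp only: eq)
qed

lemma \<kappa>_lower_bound: obtains c where "c > 0" "\<And>s. 0 \<le> s \<Longrightarrow> s \<le> S \<Longrightarrow> \<kappa> s \<ge> c"
proof -
  have "\<exists>s\<in>{0..S}. \<forall>t\<in>{0..S}. \<kappa> s \<le> \<kappa> t"
    using S_pos by (intro continuous_attains_inf continuous_\<kappa>) auto
  then show thesis using that \<kappa>_pos by (metis atLeastAtMost_iff)
qed

text \<open>Picone's argument: \<open>v\<^sup>2 h / (h\<^sup>2 + \<epsilon>\<^sup>2)\<close> is a smooth substitute for the test function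
  \<open>v\<^sup>2 / h\<close> in the equation of \<open>h = eigf n\<close>.\<close>

lemma picone_pointwise:
  fixes Dv Dh :: "'a::euclidean_space"
  assumes "e > (0::real)"
  shows "(2 * v * (h / (h\<^sup>2 + e))) * (Dv \<bullet> Dh) + v\<^sup>2 * ((e - h\<^sup>2) / (h\<^sup>2 + e)\<^sup>2) * (norm Dh)\<^sup>2
    \<le> (norm Dv)\<^sup>2 + v\<^sup>2 * e / (h\<^sup>2 + e)\<^sup>2 * (norm Dh)\<^sup>2"
proof -
  have "0 \<le> (norm (Dv - (v * (h / (h\<^sup>2 + e))) *\<^sub>R Dh))\<^sup>2" by simp
  also have "\<dots> = (norm Dv)\<^sup>2 - (2 * v * (h / (h\<^sup>2 + e))) * (Dv \<bullet> Dh)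
      + (v * (h / (h\<^sup>2 + e)))\<^sup>2 * (norm Dh)\<^sup>2"
    unfolding power2_norm_eq_inner
    by (simp add: inner_diff_left inner_diff_right inner_commute algebra_simps power2_eq_square)
  also have "(v * (h / (h\<^sup>2 + e)))\<^sup>2 * (norm Dh)\<^sup>2 = v\<^sup>2 * e / (h\<^sup>2 + e)\<^sup>2 * (norm Dh)\<^sup>2
      - v\<^sup>2 * ((e - h\<^sup>2) / (h\<^sup>2 + e)\<^sup>2) * (norm Dh)\<^sup>2"
    by (simp add: power_divide power_mult_distrib algebra_simps diff_divide_distrib)
  finally show ?thesis by simp
qed

lemma picone:
  fixes v :: "'a::euclidean_space \<Rightarrow> real"
  assumes N: "N = real DIM('a)" and v: "C1_grad v Dv" and r: "r > 0" "r\<^sup>2 / 2 \<le> S"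
    and odd: "\<And>x. norm x < r \<Longrightarrow> \<bar>v x\<bar> \<le> L * \<bar>x \<bullet> n\<bar>"
  shows "\<mu> * (\<integral>x. (v x)\<^sup>2 \<partial>wball r) \<le> (\<integral>x. (norm (Dv x))\<^sup>2 \<partial>wball r)"
proof -
  let ?h = "eigf n" and ?Dh = "eigf' n"
  note [measurable] = C1_grad_measurable[OF v] C1_grad_measurable[OF C1_grad_eigf[of n]]
  \<comment> \<open>\<open>e k\<close> stands for \<epsilon>^2 in the regularised quotient v^2 h /
    (h^2 + \<epsilon>^2).\<close>
  define e where "e k = 1 / real (Suc k)" for k
  have e: "e k > 0" for k by (simp add: e_def)
  have den: "(?h x)\<^sup>2 + e k > 0" for x k using e by (simp add: add_nonneg_pos)
  define \<phi> where "\<phi> k t = t / (t\<^sup>2 + e k)" for k t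
  define \<phi>' where "\<phi>' k t = (e k - t\<^sup>2) / (t\<^sup>2 + e k)\<^sup>2" for k t
  have D\<phi>: "(\<phi> k has_real_derivative \<phi>' k t) (at t)" for k t
  proof -
    have "t\<^sup>2 + e k \<noteq> 0" using e[of k] by (smt (verit) zero_le_power2)
    then show ?thesis unfolding \<phi>_def \<phi>'_def
      by (auto intro!: derivative_eq_intros simp: power2_eq_square field_simps)
  qed
  have cont\<phi>': "continuous_on UNIV (\<phi>' k)" for k
  proof -
    have "t\<^sup>2 + e k \<noteq> 0" for t using e[of k] by (smt (verit) zero_le_power2)
    then show ?thesis unfolding \<phi>'_def by (intro continuous_intros) auto
  qed
  define w where "w k x = v x * v x * \<phi> k (?h x)" for k x
  define Dw where "Dw k x = (v x * v x) *\<^sub>R (\<phi>' k (?h x) *\<^sub>R ?Dh x)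
      + \<phi> k (?h x) *\<^sub>R (v x *\<^sub>R Dv x + v x *\<^sub>R Dv x)" for k x
  have w: "C1_grad (w k) (Dw k)" for k
    unfolding w_def Dw_def
    by (intro C1_grad_mult v C1_grad_compose[OF C1_grad_eigf D\<phi> cont\<phi>'])
  have q: "C1_grad (\<lambda>x. cutoff r k x * w k x)
     (\<lambda>x. cutoff r k x *\<^sub>R Dw k x + w k x *\<^sub>R (cutoff' r k x *\<^sub>R x))" for k
    by (intro C1_grad_mult C1_grad_cutoff w)
  \<comment> \<open>The pointwise majorant of the integrand of \<open>eigf_weak\<close>, after
    Picone's inequality and after dropping the term with the gradient of the cutoff. It tends to
    |Dv|^2 - \<mu> v^2.\<close>
  define F where "F k x = cutoff r k x * ((norm (Dv x))\<^sup>2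
      + (v x)\<^sup>2 * e k / ((?h x)\<^sup>2 + e k)\<^sup>2 * (norm (?Dh x))\<^sup>2
      - \<mu> * ((v x)\<^sup>2 * (?h x)\<^sup>2 / ((?h x)\<^sup>2 + e k)))" for k x
  have F_meas [measurable]: "F k \<in> borel_measurable borel" for k
    unfolding F_def by measurable
  obtain c where c: "c > 0" "\<And>s. 0 \<le> s \<Longrightarrow> s \<le> S \<Longrightarrow> \<kappa> s \<ge> c" using \<kappa>_lower_bound by metis
  \<comment> \<open>A positive lower bound for \<kappa> lets |x . n| be replaced by |h|. This bounds
    the error term v^2 e / (h^2 + e)^2 uniformly in k.\<close>
  have vh: "(v x)\<^sup>2 \<le> (L / c)\<^sup>2 * (?h x)\<^sup>2" if x: "norm x < r" for x
  proof -
    have "(norm x)\<^sup>2 / 2 \<le> S" using half_norm_le[of x r] r x by linarith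
    then have k: "\<kappa> ((norm x)\<^sup>2 / 2) \<ge> c" using c(2) by simp
    have "\<bar>v x\<bar> \<le> \<bar>L\<bar> * \<bar>x \<bullet> n\<bar>"
      using odd[OF x] by (smt (verit) mult_right_mono abs_ge_zero)
    also have "\<dots> \<le> \<bar>L\<bar> / c * (\<bar>x \<bullet> n\<bar> * \<kappa> ((norm x)\<^sup>2 / 2))"
    proof -
      have "\<bar>L\<bar> * \<bar>x \<bullet> n\<bar> * c \<le> \<bar>L\<bar> * \<bar>x \<bullet> n\<bar> * \<kappa> ((norm x)\<^sup>2 / 2)"
        by (intro mult_left_mono k) auto
      then show ?thesis using c(1) by (simp add: field_simps)
    qed
    also have "\<dots> = \<bar>L / c * ?h x\<bar>"
      using c(1) k by (simp add: eigf_def abs_mult)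
    finally show ?thesis by (metis abs_le_square_iff power_mult_distrib)
  qed
  have F_nonneg: "(\<integral>x. F k x \<partial>wball r) \<ge> 0" for k
  proof -
    let ?G = "\<lambda>x. (cutoff r k x *\<^sub>R Dw k x + w k x *\<^sub>R (cutoff' r k x *\<^sub>R x)) \<bullet> ?Dh x
          - \<mu> * (cutoff r k x * w k x) * ?h x"
    have supp: "norm x > r \<Longrightarrow> cutoff r k x * w k x = 0" for x
      using cutoff_outside[OF r(1), of x] by simp
    note W = eigf_weak[OF N q supp, where n=n]
    have "?G x \<le> F k x" for x
    proof (cases "norm x < r")
      case False
      then show ?thesis by (simp add: F_def cutoff_outside cutoff'_outside r)
    next
      case True
      let ?s = "(norm x)\<^sup>2 / 2"
      have s: "0 \<le> ?s" "?s \<le> S" using half_norm_le[of x r] r True by (simp, linarith)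
      have "Dw k x \<bullet> ?Dh x = (2 * v x * (?h x / ((?h x)\<^sup>2 + e k))) * (Dv x \<bullet> ?Dh x)
          + (v x)\<^sup>2 * ((e k - (?h x)\<^sup>2) / ((?h x)\<^sup>2 + e k)\<^sup>2) * (norm (?Dh x))\<^sup>2"
        unfolding Dw_def \<phi>_def \<phi>'_def power2_norm_eq_inner
        by (simp add: inner_add_left power2_eq_square algebra_simps)
      also have "\<dots> \<le> (norm (Dv x))\<^sup>2 + (v x)\<^sup>2 * e k / ((?h x)\<^sup>2 + e k)\<^sup>2 * (norm (?Dh x))\<^sup>2"
        by (rule picone_pointwise[OF e])
      finally have 1: "cutoff r k x * (Dw k x \<bullet> ?Dh x) \<le> cutoff r k x *
          ((norm (Dv x))\<^sup>2 + (v x)\<^sup>2 * e k / ((?h x)\<^sup>2 + e k)\<^sup>2 * (norm (?Dh x))\<^sup>2)"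
        by (rule mult_left_mono[OF _ cutoff_nonneg])
      \<comment> \<open>The radial derivative of h is x . n times the flux, hence of the sign of h
        up to the radius of the profile.\<close>
      have xDh: "x \<bullet> ?Dh x = (x \<bullet> n) * (\<kappa> ?s + 2 * ?s * \<kappa>1 ?s)"
        unfolding eigf'_def by (simp add: inner_add_right power2_norm_eq_inner algebra_simps)
      have "w k x * (x \<bullet> ?Dh x) = (v x)\<^sup>2 * (x \<bullet> n)\<^sup>2 * \<kappa> ?s / ((?h x)\<^sup>2 + e k) * (\<kappa> ?s + 2 * ?s * \<kappa>1 ?s)"
        unfolding w_def \<phi>_def xDh by (simp add: eigf_def power2_eq_square algebra_simps)
      also have "\<dots> \<ge> 0"
        using flux_nonneg[OF s] \<kappa>_pos[OF s] den[of x k]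
        by (intro mult_nonneg_nonneg divide_nonneg_nonneg) (auto simp: less_imp_le)
      finally have 2: "cutoff' r k x * (w k x * (x \<bullet> ?Dh x)) \<le> 0"
        using mult_nonpos_nonneg[OF cutoff'_nonpos] by blast
      have 3: "w k x * ?h x = (v x)\<^sup>2 * (?h x)\<^sup>2 / ((?h x)\<^sup>2 + e k)"
        unfolding w_def \<phi>_def by (simp add: power2_eq_square)
      have "?G x = cutoff r k x * (Dw k x \<bullet> ?Dh x) + cutoff' r k x * (w k x * (x \<bullet> ?Dh x))
          - \<mu> * cutoff r k x * (w k x * ?h x)"
        by (simp add: inner_add_left algebra_simps)
      also have "\<dots> \<le> cutoff r k x *
          ((norm (Dv x))\<^sup>2 + (v x)\<^sup>2 * e k / ((?h x)\<^sup>2 + e k)\<^sup>2 * (norm (?Dh x))\<^sup>2) + 0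
          - \<mu> * cutoff r k x * ((v x)\<^sup>2 * (?h x)\<^sup>2 / ((?h x)\<^sup>2 + e k))"
        unfolding 3 by (intro diff_right_mono add_mono 1 2)
      also have "\<dots> = F k x" unfolding F_def by (simp add: algebra_simps)
      finally show ?thesis .
    qed
    then have le: "gw x * ?G x \<le> gw x * F k x" for x
      using gw_pos[of x] by (intro mult_left_mono) (auto simp: less_imp_le)
    have F_out: "F k x = 0" if "norm x \<ge> r" for x using that by (simp add: F_def cutoff_outside r)
    have contF: "continuous_on UNIV (F k)"
      unfolding F_def using den[of _ k]
      by (intro continuous_intros C1_grad_continuous[OF C1_grad_cutoff] C1_grad_continuous[OF v]
        C1_grad_continuous_grad[OF v] C1_grad_continuous[OF C1_grad_eigf]
        C1_grad_continuous_grad[OF C1_grad_eigf]) (auto simp: less_le)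
    have "integrable lborel (\<lambda>x. gw x * F k x)"
      by (rule integrable_continuous_bounded_support[of _ r])
        (auto intro!: continuous_intros contF simp: F_out)
    then have "(\<integral>x. gw x * ?G x \<partial>lborel) \<le> (\<integral>x. gw x * F k x \<partial>lborel)"
      using W(1) le by (intro integral_mono) auto
    then show ?thesis
      using W(2) integral_lborel_eq_wball[OF F_meas F_out] by simp
  qed
  obtain B1 where B1: "B1 \<ge> 0" "\<And>x. norm x \<le> r \<Longrightarrow> norm ((norm (Dv x))\<^sup>2) \<le> B1"
    using continuous_bounded_on_cball[of "\<lambda>x. (norm (Dv x))\<^sup>2" r] C1_grad_continuous_grad[OF v, of UNIV]
    by (metis continuous_on_norm continuous_on_power)
  obtain B2 where B2: "B2 \<ge> 0" "\<And>x. norm x \<le> r \<Longrightarrow> norm ((v x)\<^sup>2) \<le> B2"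
    using continuous_bounded_on_cball[of "\<lambda>x. (v x)\<^sup>2" r] C1_grad_continuous[OF v, of UNIV]
    by (metis continuous_on_power)
  obtain B3 where B3: "B3 \<ge> 0" "\<And>x. norm x \<le> r \<Longrightarrow> norm ((norm (?Dh x))\<^sup>2) \<le> B3"
    using continuous_bounded_on_cball[of "\<lambda>x. (norm (?Dh x))\<^sup>2" r]
      C1_grad_continuous_grad[OF C1_grad_eigf[of n], of UNIV]
    by (metis continuous_on_norm continuous_on_power)
  have "(\<lambda>k. \<integral>x. F k x \<partial>wball r) \<longlonglongrightarrow> (\<integral>x. (norm (Dv x))\<^sup>2 - \<mu> * (v x)\<^sup>2 \<partial>wball r)"
  proof (rule wball_dominated_convergence[where C="B1 + (L / c)\<^sup>2 * B3 + \<mu> * B2"])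
    show "(\<lambda>x. (norm (Dv x))\<^sup>2 - \<mu> * (v x)\<^sup>2) \<in> borel_measurable borel" by measurable
    fix x :: 'a assume x: "norm x < r"
    show "\<bar>F k x\<bar> \<le> B1 + (L / c)\<^sup>2 * B3 + \<mu> * B2" for k
    proof -
      let ?A = "(v x)\<^sup>2 * e k / ((?h x)\<^sup>2 + e k)\<^sup>2 * (norm (?Dh x))\<^sup>2"
      let ?M = "(v x)\<^sup>2 * (?h x)\<^sup>2 / ((?h x)\<^sup>2 + e k)"
      have a1: "0 \<le> ?A" using e[of k] by simp
      have "(v x)\<^sup>2 * e k \<le> (L / c)\<^sup>2 * (?h x)\<^sup>2 * e k"
        using vh[OF x] e[of k] by (intro mult_right_mono) auto
      also have "\<dots> \<le> (L / c)\<^sup>2 * ((?h x)\<^sup>2 + e k)\<^sup>2"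
      proof -
        have "(?h x)\<^sup>2 * e k \<le> ((?h x)\<^sup>2 + e k)\<^sup>2"
          using e[of k] mult_nonneg_nonneg[of "e k" "(?h x)\<^sup>2"] by (simp add: power2_sum)
        then show ?thesis unfolding mult.assoc by (rule mult_left_mono) simp
      qed
      finally have "(v x)\<^sup>2 * e k / ((?h x)\<^sup>2 + e k)\<^sup>2 \<le> (L / c)\<^sup>2"
        using den[of x k] by (simp add: divide_le_eq)
      then have a2: "?A \<le> (L / c)\<^sup>2 * B3"
        using B3(2)[of x] x e[of k] by (intro mult_mono) auto
      have m1: "0 \<le> ?M" using den[of x k] by simp
      have "?M \<le> (v x)\<^sup>2 * 1"
        unfolding times_divide_eq_right[symmetric] using den[of x k] e[of k]
        by (intro mult_left_mono) (auto simp: divide_le_eq)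
      then have m2: "?M \<le> B2" using B2(2)[of x] x by simp
      have m3: "0 \<le> \<mu> * ?M" "\<mu> * ?M \<le> \<mu> * B2"
        using \<mu>_ge_1 m1 m2 by (intro mult_nonneg_nonneg mult_left_mono; simp)+
      have b1: "0 \<le> (norm (Dv x))\<^sup>2" "(norm (Dv x))\<^sup>2 \<le> B1" using B1(2)[of x] x by auto
      have "\<bar>(norm (Dv x))\<^sup>2 + ?A - \<mu> * ?M\<bar> \<le> B1 + (L / c)\<^sup>2 * B3 + \<mu> * B2"
        using a1 a2 m3 b1 B1(1) by linarith
      then have "cutoff r k x * \<bar>(norm (Dv x))\<^sup>2 + ?A - \<mu> * ?M\<bar> \<le> 1 * (B1 + (L / c)\<^sup>2 * B3 + \<mu> * B2)"
        using cutoff_nonneg[of r k x] cutoff_le_1[of r k x] by (intro mult_mono) auto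
      then show ?thesis unfolding F_def abs_mult using cutoff_nonneg[of r k x] by simp
    qed
    have e0: "e \<longlonglongrightarrow> 0" unfolding e_def using LIMSEQ_Suc[OF lim_1_over_n] by simp
    have "(\<lambda>k. (norm (Dv x))\<^sup>2 + (v x)\<^sup>2 * e k / ((?h x)\<^sup>2 + e k)\<^sup>2 * (norm (?Dh x))\<^sup>2
      - \<mu> * ((v x)\<^sup>2 * (?h x)\<^sup>2 / ((?h x)\<^sup>2 + e k))) \<longlonglongrightarrow> (norm (Dv x))\<^sup>2 - \<mu> * (v x)\<^sup>2"
    \<comment> \<open>On the zero set of h the quotients do not converge by continuity; there v
      vanishes as well and both are zero.\<close>
    proof (cases "?h x = 0")
      case True
      then have "v x = 0" using vh[OF x] by simp
      then show ?thesis by simp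
    next
      case False
      then have h: "(?h x)\<^sup>2 + 0 \<noteq> 0" by simp
      have "(\<lambda>k. (norm (Dv x))\<^sup>2 + (v x)\<^sup>2 * e k / ((?h x)\<^sup>2 + e k)\<^sup>2 * (norm (?Dh x))\<^sup>2
        - \<mu> * ((v x)\<^sup>2 * (?h x)\<^sup>2 / ((?h x)\<^sup>2 + e k))) \<longlonglongrightarrow>
         (norm (Dv x))\<^sup>2 + (v x)\<^sup>2 * 0 / ((?h x)\<^sup>2 + 0)\<^sup>2 * (norm (?Dh x))\<^sup>2
        - \<mu> * ((v x)\<^sup>2 * (?h x)\<^sup>2 / ((?h x)\<^sup>2 + 0))"
        by (intro tendsto_intros e0) (use h in auto)
      then show ?thesis using False by simp
    qed
    from tendsto_mult[OF cutoff_tendsto[OF r(1) x] this]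
    show "(\<lambda>k. F k x) \<longlonglongrightarrow> (norm (Dv x))\<^sup>2 - \<mu> * (v x)\<^sup>2" unfolding F_def by simp
  qed measurable
  then have "0 \<le> (\<integral>x. (norm (Dv x))\<^sup>2 - \<mu> * (v x)\<^sup>2 \<partial>wball r)"
    by (rule LIMSEQ_le_const) (use F_nonneg in auto)
  also have "\<dots> = (\<integral>x. (norm (Dv x))\<^sup>2 \<partial>wball r) - \<mu> * (\<integral>x. (v x)\<^sup>2 \<partial>wball r)"
    by (subst Bochner_Integration.integral_diff)
      (auto intro!: integrable_wball_continuous continuous_intros C1_grad_continuous[OF v]
        C1_grad_continuous_grad[OF v])
  finally show ?thesis by simp
qed

end

section \<open>Radial functions\<close>

text \<open>For a = c'(s) the summands are the squared gradients of (x . b) c(s), the components of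
  the field c(s) x. Used for the radial field of the duality argument and for the trial
  functions.\<close>

lemma sum_norm_radial_gradient:
  fixes x :: "'a::euclidean_space"
  shows "(\<Sum>b\<in>Basis. (norm ((x \<bullet> b) *\<^sub>R a *\<^sub>R x + c *\<^sub>R b))\<^sup>2) =
    (x \<bullet> x) * (a\<^sup>2 * (x \<bullet> x) + 2 * a * c) + real DIM('a) * c\<^sup>2"
proof -
  have "(\<Sum>b\<in>Basis. (norm ((x \<bullet> b) *\<^sub>R a *\<^sub>R x + c *\<^sub>R b))\<^sup>2) =
    (\<Sum>b\<in>Basis. (x \<bullet> b) * (x \<bullet> b) * (a\<^sup>2 * (x \<bullet> x) + 2 * a * c) + c\<^sup>2)"
  proof (intro sum.cong refl)
    fix b :: 'a assume b: "b \<in> Basis"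
    show "(norm ((x \<bullet> b) *\<^sub>R a *\<^sub>R x + c *\<^sub>R b))\<^sup>2 =
        (x \<bullet> b) * (x \<bullet> b) * (a\<^sup>2 * (x \<bullet> x) + 2 * a * c) + c\<^sup>2"
      unfolding power2_norm_eq_inner unfolding inner_add_left inner_add_right inner_scaleR_left inner_scaleR_right
        inner_same_Basis[OF b] inner_commute[of b x] power2_eq_square by algebra
  qed
  then show ?thesis
    unfolding sum.distrib sum_distrib_right[symmetric] euclidean_inner[of x x, symmetric] by simp
qed

lemma Cauchy_Schwarz_integral:
  fixes f g :: "'b \<Rightarrow> real"
  assumes "integrable M (\<lambda>x. (f x)\<^sup>2)" "integrable M (\<lambda>x. (g x)\<^sup>2)" "integrable M (\<lambda>x. f x * g x)"
  shows "(\<integral>x. f x * g x \<partial>M)\<^sup>2 \<le> (\<integral>x. (f x)\<^sup>2 \<partial>M) * (\<integral>x. (g x)\<^sup>2 \<partial>M)"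
proof -
  let ?A = "\<integral>x. (f x)\<^sup>2 \<partial>M" and ?B = "\<integral>x. (g x)\<^sup>2 \<partial>M" and ?C = "\<integral>x. f x * g x \<partial>M"
  have quad: "0 \<le> s\<^sup>2 * ?A - 2 * (s * t) * ?C + t\<^sup>2 * ?B" for s t
  proof -
    have "0 \<le> (\<integral>x. (s * f x - t * g x)\<^sup>2 \<partial>M)" by (intro integral_nonneg_AE) auto
    also have "(\<lambda>x. (s * f x - t * g x)\<^sup>2) = (\<lambda>x. s\<^sup>2 * (f x)\<^sup>2 - (2 * (s * t)) * (f x * g x) + t\<^sup>2 * (g x)\<^sup>2)"
      by (simp add: power2_eq_square algebra_simps)
    also have "(\<integral>x. \<dots> x \<partial>M) = s\<^sup>2 * ?A - 2 * (s * t) * ?C + t\<^sup>2 * ?B"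
      using assms by simp
    finally show ?thesis .
  qed
  have A: "?A \<ge> 0" and B: "?B \<ge> 0" by (auto intro!: integral_nonneg_AE)
  show ?thesis
  proof (cases "?B = 0")
    case False
    have "0 \<le> ?B * (?A * ?B - ?C\<^sup>2)"
      using quad[of ?B ?C] by (simp add: power2_eq_square algebra_simps)
    then show ?thesis using False B by (simp add: zero_le_mult_iff)
  next
    case True
    have "?C = 0"
    proof (rule ccontr)
      assume C: "?C \<noteq> 0"
      \<comment> \<open>With int g^2 = 0 the quadratic form is affine in t, and this t gives it the
        value -1.\<close>
      have "0 \<le> ?A - 2 * ((?A + 1) / (2 * ?C)) * ?C" using quad[of 1 "(?A + 1) / (2 * ?C)"] True by simp
      then show False using C by simp
    qed
    then show ?thesis using True by simp
  qed
qed

text \<open>Supplies the hypothesis \<open>vanish\<close> of \<open>wball_divergence_radial\<close>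
  for radial functions that are zero on the sphere.\<close>

lemma radial_vanish:
  fixes g :: "real \<Rightarrow> real"
  assumes g: "\<And>s. (g has_real_derivative g' s) (at s)" "continuous_on UNIV g'"
    and T: "g T = 0"
  obtains C where "C \<ge> 0" "\<And>s. 0 \<le> s \<Longrightarrow> s \<le> T \<Longrightarrow> \<bar>g s\<bar> \<le> C * (T - s)"
proof -
  have "bounded (g' ` {0..T})"
    by (intro compact_imp_bounded compact_continuous_image continuous_on_subset[OF g(2)]) auto
  then obtain C where C: "\<And>s. 0 \<le> s \<Longrightarrow> s \<le> T \<Longrightarrow> \<bar>g' s\<bar> \<le> C"
    unfolding bounded_iff by (metis atLeastAtMost_iff imageI real_norm_def)
  have "\<bar>g s\<bar> \<le> max C 0 * (T - s)" if s: "0 \<le> s" "s \<le> T" for s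
  proof (cases "s = T")
    case False
    then obtain z where "s < z" "z < T" "g T - g s = (T - s) * g' z"
      using MVT2[of s T g g'] g(1) s by auto
    then have "\<bar>g s\<bar> = \<bar>(T - s) * g' z\<bar>" using T by (metis abs_minus_cancel diff_0)
    then have "\<bar>g s\<bar> = (T - s) * \<bar>g' z\<bar>" using s by (simp add: abs_mult)
    also have "\<dots> \<le> (T - s) * max C 0"
      using C[of z] \<open>s < z\<close> \<open>z < T\<close> s by (intro mult_left_mono) auto
    finally show ?thesis by (simp add: mult.commute)
  qed (simp add: T)
  then show thesis using that[of "max C 0"] by simp
qed

text \<open>The exponential cancels \<open>gw\<close> and leaves the volume of the ball. It enters
  as the denominator of the normalising factor in \<open>radial_test\<close>.\<close>

lemma integral_exp_wball_pos:
  assumes "r > 0"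
  shows "(\<integral>x. exp ((norm x)\<^sup>2 / 2) \<partial>(wball r :: 'a::euclidean_space measure)) > 0"
proof -
  have "(\<lambda>x::'a. exp ((norm x)\<^sup>2 / 2)) \<in> borel_measurable borel" by measurable
  then have "(\<integral>x. exp ((norm x)\<^sup>2 / 2) \<partial>(wball r :: 'a measure)) =
      (\<integral>x. indicator (ball 0 r) x * gw x * exp ((norm x)\<^sup>2 / 2) \<partial>(lborel :: 'a measure))"
    by (rule integral_wball)
  also have "\<dots> = (\<integral>x. indicator (ball 0 r) x \<partial>(lborel :: 'a measure))"
    by (intro Bochner_Integration.integral_cong) (auto simp: gw_def mult_exp_exp)
  also have "\<dots> = measure lborel (ball (0::'a) r)" by simp
  also have "\<dots> > 0" using assms content_ball_pos[of r "0::'a"] by simp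
  finally show ?thesis .
qed

context neumann_profile
begin

text \<open>The field F = g(s) x has div(gw F) = gw f and vanishes on the sphere, so f has mean zero
  and int u f = -int Du . F. By Cauchy-Schwarz it remains to show \<mu> int |F|^2 <= int f^2.
  Picone's inequality for the components of F gives \<mu> int |F|^2 <= int |DF|^2, and int f^2 = int
  |DF|^2 + int |F|^2.\<close>

lemma radial_dual:
  fixes u :: "'a::euclidean_space \<Rightarrow> real"
  assumes N: "N = real DIM('a)" and u: "C1_grad u Du" and r: "r > 0" "r\<^sup>2 / 2 \<le> S"
    and g: "\<And>s. (g has_real_derivative g' s) (at s)" "continuous_on UNIV g'"
    and gT: "g (r\<^sup>2 / 2) = 0"
  defines "f \<equiv> (\<lambda>s. N * g s + 2 * s * g' s - 2 * s * g s)"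
  shows "(\<integral>x. f ((norm x)\<^sup>2 / 2) \<partial>(wball r :: 'a measure)) = 0"
    and "\<mu> * (\<integral>x. u x * f ((norm x)\<^sup>2 / 2) \<partial>wball r)\<^sup>2
      \<le> (\<integral>x. (norm (Du x))\<^sup>2 \<partial>wball r) * (\<integral>x. (f ((norm x)\<^sup>2 / 2))\<^sup>2 \<partial>(wball r :: 'a measure))"
proof -
  let ?s = "\<lambda>x::'a. (norm x)\<^sup>2 / 2"
  note cg = continuous_on_of_DERIV[OF g(1)]
  have cgs: "continuous_on UNIV (\<lambda>x. g (?s x))" "continuous_on UNIV (\<lambda>x. g' (?s x))"
    by (intro continuous_on_compose2[OF cg[of UNIV]] continuous_on_compose2[OF g(2)] continuous_intros; simp)+
  note cu = C1_grad_continuous[OF u, of UNIV] C1_grad_continuous_grad[OF u, of UNIV]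
  have cf: "continuous_on UNIV (\<lambda>x. f (?s x))"
    unfolding f_def by (intro continuous_intros cgs; simp)
  note int = integrable_wball_continuous[where r=r]
  obtain C where C: "C \<ge> 0" "\<And>s. 0 \<le> s \<Longrightarrow> s \<le> r\<^sup>2 / 2 \<Longrightarrow> \<bar>g s\<bar> \<le> C * (r\<^sup>2 / 2 - s)"
    using radial_vanish[OF g gT] by metis
  have Cx: "\<bar>g (?s x)\<bar> \<le> C * (r\<^sup>2 / 2 - ?s x)" if "norm x < r" for x
    using C(2)[of "?s x"] half_norm_le[of x r] that by simp
  have C1g: "C1_grad (\<lambda>x. g (?s x)) (\<lambda>x. g' (?s x) *\<^sub>R x)"
    by (rule C1_grad_radial[OF g])
  have xx: "x \<bullet> x = 2 * ?s x" "(norm x)\<^sup>2 = 2 * ?s x" for x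
    by (simp_all add: power2_norm_eq_inner)

  have dual: "(\<integral>x. w x * f (?s x) + g (?s x) * (Dw x \<bullet> x) \<partial>wball r) = 0"
    if w: "C1_grad w Dw" for w :: "'a \<Rightarrow> real" and Dw
  proof -
    obtain B where B: "B \<ge> 0" "\<And>x. norm x \<le> r \<Longrightarrow> norm (w x) \<le> B"
      using continuous_bounded_on_cball[OF C1_grad_continuous[OF w]] by metis
    have "\<bar>w x * g (?s x)\<bar> \<le> (B * C) * (r\<^sup>2 / 2 - ?s x)" if x: "norm x < r" for x
    proof -
      have "\<bar>w x\<bar> * \<bar>g (?s x)\<bar> \<le> B * (C * (r\<^sup>2 / 2 - ?s x))"
        using B(2)[of x] Cx[OF x] x B(1) by (intro mult_mono) auto
      then show ?thesis by (simp add: abs_mult mult.assoc)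
    qed
    from wball_divergence_radial[OF C1_grad_mult[OF w C1g] r(1) this]
    have "(\<integral>x. (w x *\<^sub>R g' (?s x) *\<^sub>R x + g (?s x) *\<^sub>R Dw x) \<bullet> x
        + (real DIM('a) - (norm x)\<^sup>2) * (w x * g (?s x)) \<partial>wball r) = 0" .
    moreover have "(w x *\<^sub>R g' (?s x) *\<^sub>R x + g (?s x) *\<^sub>R Dw x) \<bullet> x
        + (real DIM('a) - (norm x)\<^sup>2) * (w x * g (?s x)) =
        w x * f (?s x) + g (?s x) * (Dw x \<bullet> x)" for x
    proof -
      define s where "s = ?s x"
      have "(norm x)\<^sup>2 = 2 * s" "x \<bullet> x = 2 * s" by (simp_all add: s_def xx(1))
      then show ?thesis unfolding f_def s_def[symmetric] N by (simp add: inner_add_left algebra_simps)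
    qed
    ultimately show ?thesis by simp
  qed
  show "(\<integral>x. f (?s x) \<partial>wball r) = 0"
    using dual[OF C1_grad_const[of 1]] by simp

  \<comment> \<open>The components (x . b) g(s) vanish on the hyperplane orthogonal to b, as
    \<open>picone\<close> requires.\<close>
  have comp: "\<mu> * (\<integral>x. ((x \<bullet> b) * g (?s x))\<^sup>2 \<partial>wball r)
     \<le> (\<integral>x. (norm ((x \<bullet> b) *\<^sub>R g' (?s x) *\<^sub>R x + g (?s x) *\<^sub>R b))\<^sup>2 \<partial>wball r)" for b
  proof -
    obtain B where B: "B \<ge> 0" "\<And>x. norm x \<le> r \<Longrightarrow> norm (g (?s x)) \<le> B"
      using continuous_bounded_on_cball[OF cgs(1)] by metis
    have "\<bar>(x \<bullet> b) * g (?s x)\<bar> \<le> B * \<bar>x \<bullet> b\<bar>" if "norm x < r" for x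
      using mult_left_mono[OF B(2)[of x], of "\<bar>x \<bullet> b\<bar>"] that by (simp add: abs_mult mult.commute)
    from picone[OF N C1_grad_mult[OF C1_grad_inner[of b] C1g] r this] show ?thesis .
  qed
  have lhs: "(\<Sum>b\<in>Basis. ((x \<bullet> b) * g (?s x))\<^sup>2) = 2 * ?s x * (g (?s x))\<^sup>2" for x
    unfolding xx(1)[symmetric] by (subst euclidean_inner[of x x])
      (simp add: power_mult_distrib sum_distrib_right power2_eq_square mult_ac)
  have rhs: "(\<Sum>b\<in>Basis. (norm ((x \<bullet> b) *\<^sub>R g' (?s x) *\<^sub>R x + g (?s x) *\<^sub>R b))\<^sup>2) =
      N * (g (?s x))\<^sup>2 + 4 * ?s x * g (?s x) * g' (?s x) + 4 * (?s x)\<^sup>2 * (g' (?s x))\<^sup>2" for x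
    unfolding sum_norm_radial_gradient N xx(1) by (simp add: power2_eq_square algebra_simps)
  have P: "\<mu> * (\<integral>x. 2 * ?s x * (g (?s x))\<^sup>2 \<partial>wball r) \<le>
      (\<integral>x. N * (g (?s x))\<^sup>2 + 4 * ?s x * g (?s x) * g' (?s x) + 4 * (?s x)\<^sup>2 * (g' (?s x))\<^sup>2 \<partial>wball r)"
  proof -
    have "(\<Sum>b\<in>(Basis::'a set). \<mu> * (\<integral>x. ((x \<bullet> b) * g (?s x))\<^sup>2 \<partial>wball r)) \<le>
      (\<Sum>b\<in>Basis. (\<integral>x. (norm ((x \<bullet> b) *\<^sub>R g' (?s x) *\<^sub>R x + g (?s x) *\<^sub>R b))\<^sup>2 \<partial>wball r))"
      by (intro sum_mono comp)
    also have "\<dots> = (\<integral>x. (\<Sum>b\<in>Basis. (norm ((x \<bullet> b) *\<^sub>R g' (?s x) *\<^sub>R x + g (?s x) *\<^sub>R b))\<^sup>2) \<partial>wball r)"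
      by (intro Bochner_Integration.integral_sum[symmetric] int continuous_intros cgs)
    finally show ?thesis
      unfolding rhs sum_distrib_left[symmetric]
      by (subst (asm) Bochner_Integration.integral_sum[symmetric])
        (auto simp: lhs intro!: int continuous_intros cgs)
  qed
  have Q: "(\<integral>x. (f (?s x))\<^sup>2 - (N * (g (?s x))\<^sup>2 + 4 * ?s x * g (?s x) * g' (?s x)
        + 4 * (?s x)\<^sup>2 * (g' (?s x))\<^sup>2) - 2 * ?s x * (g (?s x))\<^sup>2 \<partial>wball r) = 0"
  proof -
    \<comment> \<open>With this \<alpha>, gw (f^2 - |DF|^2 - |F|^2) is the divergence of gw
      \<alpha>(s) x, and \<alpha> vanishes on the sphere together with g.\<close>
    define \<alpha> where "\<alpha> s = (N - 1 - 2 * s) * (g s)\<^sup>2" for s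
    define \<alpha>' where "\<alpha>' s = (N - 1 - 2 * s) * (2 * g s * g' s) - 2 * (g s)\<^sup>2" for s
    have \<alpha>: "(\<alpha> has_real_derivative \<alpha>' s) (at s)" for s
      unfolding \<alpha>_def \<alpha>'_def by (auto intro!: derivative_eq_intros g simp: power2_eq_square algebra_simps)
    have \<alpha>'c: "continuous_on UNIV \<alpha>'" unfolding \<alpha>'_def by (intro continuous_intros cg g)
    obtain C' where C': "C' \<ge> 0" "\<And>s. 0 \<le> s \<Longrightarrow> s \<le> r\<^sup>2 / 2 \<Longrightarrow> \<bar>\<alpha> s\<bar> \<le> C' * (r\<^sup>2 / 2 - s)"
      using radial_vanish[OF \<alpha> \<alpha>'c, of "r\<^sup>2 / 2"] gT unfolding \<alpha>_def by auto
    have C'x: "\<bar>\<alpha> (?s x)\<bar> \<le> C' * (r\<^sup>2 / 2 - ?s x)" if "norm x < r" for x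
      using C'(2)[of "?s x"] half_norm_le[of x r] that by simp
    from wball_divergence_radial[OF C1_grad_radial[OF \<alpha> \<alpha>'c] r(1) this]
    have "(\<integral>x. (\<alpha>' (?s x) *\<^sub>R x) \<bullet> x + (real DIM('a) - (norm x)\<^sup>2) * \<alpha> (?s x) \<partial>(wball r::'a measure)) = 0" .
    moreover have "(\<alpha>' (?s x) *\<^sub>R x) \<bullet> x + (real DIM('a) - (norm x)\<^sup>2) * \<alpha> (?s x) =
       (f (?s x))\<^sup>2 - (N * (g (?s x))\<^sup>2 + 4 * ?s x * g (?s x) * g' (?s x)
        + 4 * (?s x)\<^sup>2 * (g' (?s x))\<^sup>2) - 2 * ?s x * (g (?s x))\<^sup>2" for x :: 'a
    proof -
      define s where "s = ?s x"
      have "(norm x)\<^sup>2 = 2 * s" "x \<bullet> x = 2 * s" by (simp_all add: s_def xx(1))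
      then show ?thesis unfolding f_def \<alpha>_def \<alpha>'_def s_def[symmetric] N
        by (simp add: power2_eq_square algebra_simps)
    qed
    ultimately show ?thesis by simp
  qed
  have sq_nonneg: "0 \<le> (\<integral>x. 2 * ?s x * (g (?s x))\<^sup>2 \<partial>wball r)"
    by (intro integral_nonneg_AE) auto
  have key: "\<mu> * (\<integral>x. 2 * ?s x * (g (?s x))\<^sup>2 \<partial>wball r) \<le> (\<integral>x. (f (?s x))\<^sup>2 \<partial>wball r)"
  proof -
    have "(\<integral>x. (f (?s x))\<^sup>2 \<partial>wball r) - (\<integral>x. N * (g (?s x))\<^sup>2 + 4 * ?s x * g (?s x) * g' (?s x)
        + 4 * (?s x)\<^sup>2 * (g' (?s x))\<^sup>2 \<partial>wball r) - (\<integral>x. 2 * ?s x * (g (?s x))\<^sup>2 \<partial>wball r) = 0"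
    proof -
      have i: "integrable (wball r) (\<lambda>x. (f (?s x))\<^sup>2)"
        "integrable (wball r) (\<lambda>x. N * (g (?s x))\<^sup>2 + 4 * ?s x * g (?s x) * g' (?s x)
          + 4 * (?s x)\<^sup>2 * (g' (?s x))\<^sup>2)"
        "integrable (wball r) (\<lambda>x. 2 * ?s x * (g (?s x))\<^sup>2)"
        by (intro int continuous_intros cgs cf; simp)+
      show ?thesis
        unfolding Q[symmetric] Bochner_Integration.integral_diff[OF Bochner_Integration.integrable_diff[OF i(1,2)] i(3)]
          Bochner_Integration.integral_diff[OF i(1,2)] ..
    qed
    then show ?thesis using P sq_nonneg by linarith
  qed

  \<comment> \<open>Factoring Du into its norm and direction reduces the vector-valued
    Cauchy-Schwarz inequality to the scalar one; the direction is then estimated by |sgn(Du) . x| <=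
    |x|.\<close>
  have eq: "norm (Du x) * (g (?s x) * (sgn (Du x) \<bullet> x)) = g (?s x) * (Du x \<bullet> x)" for x
    by (cases "Du x = 0") (simp_all add: sgn_div_norm)
  define I where "I = (\<integral>x. u x * f (?s x) \<partial>wball r)"
  have I1: "(\<integral>x. u x * f (?s x) \<partial>wball r) + (\<integral>x. g (?s x) * (Du x \<bullet> x) \<partial>wball r) = 0"
    using dual[OF u] by (subst (asm) Bochner_Integration.integral_add)
      (auto intro!: int continuous_intros cgs cu cf)
  have "I\<^sup>2 = (\<integral>x. g (?s x) * (Du x \<bullet> x) \<partial>wball r)\<^sup>2"
    using I1 unfolding I_def by (simp add: eq_neg_iff_add_eq_0[symmetric])
  also have "\<dots> = (\<integral>x. norm (Du x) * (g (?s x) * (sgn (Du x) \<bullet> x)) \<partial>wball r)\<^sup>2"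
    by (simp only: eq)
  also have "\<dots> \<le> (\<integral>x. (norm (Du x))\<^sup>2 \<partial>wball r) * (\<integral>x. (g (?s x) * (sgn (Du x) \<bullet> x))\<^sup>2 \<partial>wball r)"
  proof (rule Cauchy_Schwarz_integral)
    show "integrable (wball r) (\<lambda>x. (norm (Du x))\<^sup>2)" by (intro int continuous_intros cu)
    show "integrable (wball r) (\<lambda>x. norm (Du x) * (g (?s x) * (sgn (Du x) \<bullet> x)))"
      unfolding eq by (intro int continuous_intros cu cgs)
    obtain B where B: "B \<ge> 0" "\<And>x. norm x \<le> r \<Longrightarrow> norm (g (?s x)) \<le> B"
      using continuous_bounded_on_cball[OF cgs(1)] by metis
    have [measurable]: "Du \<in> borel_measurable borel" "(\<lambda>x. g (?s x)) \<in> borel_measurable borel"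
      using cu cgs by (auto intro!: borel_measurable_continuous_onI)
    show "integrable (wball r) (\<lambda>x. (g (?s x) * (sgn (Du x) \<bullet> x))\<^sup>2)"
    proof (rule integrable_wball_bounded)
      show "(\<lambda>x. (g (?s x) * (sgn (Du x) \<bullet> x))\<^sup>2) \<in> borel_measurable borel"
        unfolding sgn_div_norm by measurable
      fix x :: 'a assume x: "norm x < r"
      have "\<bar>sgn (Du x) \<bullet> x\<bar> \<le> norm (sgn (Du x)) * norm x" by (rule Cauchy_Schwarz_ineq2)
      also have "\<dots> \<le> 1 * r" using x r(1) by (intro mult_mono) (auto simp: norm_sgn)
      finally have "\<bar>g (?s x)\<bar> * \<bar>sgn (Du x) \<bullet> x\<bar> \<le> B * r"
        using B(2)[of x] B(1) x by (intro mult_mono) auto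
      then have "\<bar>g (?s x) * (sgn (Du x) \<bullet> x)\<bar>\<^sup>2 \<le> (B * r)\<^sup>2"
        by (intro power_mono) (auto simp: abs_mult)
      then show "norm ((g (?s x) * (sgn (Du x) \<bullet> x))\<^sup>2) \<le> (B * r)\<^sup>2" by simp
    qed
  qed
  also have "(\<integral>x. (g (?s x) * (sgn (Du x) \<bullet> x))\<^sup>2 \<partial>wball r) \<le> (\<integral>x. 2 * ?s x * (g (?s x))\<^sup>2 \<partial>wball r)"
  proof (rule integral_mono_AE')
    show "integrable (wball r) (\<lambda>x. 2 * ?s x * (g (?s x))\<^sup>2)" by (intro int continuous_intros cgs; simp)
    show "AE x in wball r. (g (?s x) * (sgn (Du x) \<bullet> x))\<^sup>2 \<le> 2 * ?s x * (g (?s x))\<^sup>2"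
    proof (rule AE_I2)
      fix x
      have "\<bar>sgn (Du x) \<bullet> x\<bar> \<le> norm (sgn (Du x)) * norm x" by (rule Cauchy_Schwarz_ineq2)
      also have "\<dots> \<le> 1 * norm x" by (intro mult_right_mono) (auto simp: norm_sgn)
      finally have "(sgn (Du x) \<bullet> x)\<^sup>2 \<le> (norm x)\<^sup>2" by (simp add: abs_le_square_iff[symmetric])
      then have "(g (?s x))\<^sup>2 * (sgn (Du x) \<bullet> x)\<^sup>2 \<le> (g (?s x))\<^sup>2 * (norm x)\<^sup>2"
        by (intro mult_left_mono) auto
      then show "(g (?s x) * (sgn (Du x) \<bullet> x))\<^sup>2 \<le> 2 * ?s x * (g (?s x))\<^sup>2"
        by (simp add: power_mult_distrib mult.commute)
    qed
  qed auto
  finally have "I\<^sup>2 \<le> (\<integral>x. (norm (Du x))\<^sup>2 \<partial>wball r) * (\<integral>x. 2 * ?s x * (g (?s x))\<^sup>2 \<partial>wball r)"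
    by (simp add: mult_left_mono)
  then have "\<mu> * I\<^sup>2 \<le> \<mu> * ((\<integral>x. (norm (Du x))\<^sup>2 \<partial>wball r) * (\<integral>x. 2 * ?s x * (g (?s x))\<^sup>2 \<partial>wball r))"
    using \<mu>_ge_1 by (intro mult_left_mono) auto
  also have "\<dots> = (\<integral>x. (norm (Du x))\<^sup>2 \<partial>wball r) * (\<mu> * (\<integral>x. 2 * ?s x * (g (?s x))\<^sup>2 \<partial>wball r))"
    by simp
  also have "\<dots> \<le> (\<integral>x. (norm (Du x))\<^sup>2 \<partial>wball r) * (\<integral>x. (f (?s x))\<^sup>2 \<partial>wball r)"
    by (intro mult_left_mono key integral_nonneg_AE) auto
  finally show "\<mu> * (\<integral>x. u x * f (?s x) \<partial>wball r)\<^sup>2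
      \<le> (\<integral>x. (norm (Du x))\<^sup>2 \<partial>wball r) * (\<integral>x. (f (?s x))\<^sup>2 \<partial>wball r)"
    unfolding I_def .
qed

text \<open>Variation of constants; \<open>p\<close> vanishes near \<open>0\<close>, so the singularity of the equation
  at \<open>0\<close> is not seen.\<close>

lemma radial_primitive:
  fixes p :: "real \<Rightarrow> real"
  assumes p: "continuous_on UNIV p" and \<delta>: "\<delta> > 0" "\<And>s. s \<le> \<delta> \<Longrightarrow> p s = 0"
  obtains g g' where "\<And>s. (g has_real_derivative g' s) (at s)" "continuous_on UNIV g'"
    "\<And>s. N * g s + 2 * s * g' s - 2 * s * g s = p s"
proof -
  \<comment> \<open>Integrating factor: the equation for g says that the derivative of s^(N/2)
    e^(-s) g is s^(N/2-1) e^(-s) p / 2.\<close>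
  define P where "P t = (max \<delta> t) powr (N / 2 - 1) * exp (- t) * p t / 2" for t
  have cP: "continuous_on A P" for A
    unfolding P_def using \<delta>(1)
    by (intro continuous_intros continuous_on_subset[OF p]) auto
  have P0: "P t = 0" if "t \<le> \<delta>" for t using \<delta>(2)[OF that] by (simp add: P_def)
  define A where "A s = integral {0..s} P" for s
  have A0: "A s = 0" if "s \<le> \<delta>" for s
  proof -
    have "integral {0..s} P = integral {0..s} (\<lambda>_. 0)"
      using that by (intro integral_cong P0) auto
    then show ?thesis by (simp add: A_def)
  qed
  have DA: "(A has_real_derivative P s) (at s)" if "s > 0" for s
  proof -
    have "(A has_real_derivative P s) (at s within {0..s+1})"
      unfolding A_def using that by (intro integral_has_real_derivative cP) auto
    moreover have "at s within {0..s+1} = at s"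
      using that by (intro at_within_interior) auto
    ultimately show ?thesis by simp
  qed
  \<comment> \<open>Freezing the power below \<delta>/2 removes the singularity at 0 without
    changing g, since A is zero up to \<delta>. The smaller threshold keeps an open neighbourhood of
    \<delta> on which g is given by the plain formula.\<close>
  define g where "g s = (max (\<delta>/2) s) powr (- N / 2) * exp s * A s" for s
  have g0: "g s = 0" if "s \<le> \<delta>" for s using A0[OF that] by (simp add: g_def)
  define g' where "g' s = (p s - N * g s) / (2 * max \<delta> s) + g s" for s
  have Dg: "(g has_real_derivative g' s) (at s)" for s
  proof (cases "s < \<delta>")
    case True
    have "((\<lambda>_. 0) has_real_derivative 0) (at s)" by simp
    then have "(g has_real_derivative 0) (at s)"
      by (rule has_field_derivative_transform_within_open[where S="{..<\<delta>}"]) (use True g0 in auto)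
    moreover have "g' s = 0" using True by (simp add: g'_def \<delta>(2) g0)
    ultimately show ?thesis by simp
  next
    case False
    then have s: "s > 0" "s \<ge> \<delta>" using \<delta>(1) by auto
    have "((\<lambda>s. s powr (- N / 2) * exp s * A s) has_real_derivative g' s) (at s)"
    proof (rule DERIV_cong)
      show "((\<lambda>s. s powr (- N / 2) * exp s * A s) has_real_derivative
        (((- N / 2) * s powr (- N / 2 - 1)) * exp s + exp s * s powr (- N / 2)) * A s
          + P s * (s powr (- N / 2) * exp s)) (at s)"
        using s by (intro DERIV_mult DERIV_exp DA has_real_derivative_powr)
      have gs: "g s = s powr (- N / 2) * exp s * A s" using s \<delta>(1) by (simp add: g_def max_def)
      have "P s * (s powr (- N / 2) * exp s) = (s powr (N / 2 - 1) * s powr (- N / 2)) * (exp (- s) * exp s) * p s / 2"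
        using s by (simp add: P_def max_def)
      also have "\<dots> = p s / (2 * s)"
      proof -
        have "s powr (N / 2 - 1) * s powr (- N / 2) = s powr (- 1)"
          unfolding powr_add[symmetric] by (simp add: field_simps)
        then show ?thesis using s by (simp add: powr_minus_divide mult_exp_exp)
      qed
      finally have 1: "P s * (s powr (- N / 2) * exp s) = p s / (2 * s)" .
      have 2: "s powr (- N / 2 - 1) = s powr (- N / 2) / s"
        using s by (simp add: powr_diff)
      show "(((- N / 2) * s powr (- N / 2 - 1)) * exp s + exp s * s powr (- N / 2)) * A s
          + P s * (s powr (- N / 2) * exp s) = g' s"
        unfolding 1 2 g'_def gs using s by (simp add: max_def field_simps)
    qed
    then show ?thesis
      by (rule has_field_derivative_transform_within_open[where S="{\<delta>/2<..}"])
        (use s \<delta>(1) in \<open>auto simp: g_def max_def\<close>)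
  qed
  show thesis
  proof (rule that[OF Dg])
    have "continuous_on UNIV g" using Dg by (rule continuous_on_of_DERIV)
    then show "continuous_on UNIV g'"
      unfolding g'_def using \<delta>(1) by (intro continuous_intros p) auto
    show "N * g s + 2 * s * g' s - 2 * s * g s = p s" for s
    proof (cases "s \<le> \<delta>")
      case True
      then show ?thesis by (simp add: g'_def g0 \<delta>(2))
    next
      case False
      then show ?thesis using \<delta>(1) by (simp add: g'_def max_def field_simps)
    qed
  qed
qed

text \<open>The solution g for the source p need not vanish on the sphere. Subtracting c e^s from g
  makes it vanish and changes the source by c N e^s; since the new source has mean zero, c N must be
  l.\<close>

lemma radial_test:
  fixes u :: "'a::euclidean_space \<Rightarrow> real"
  assumes N: "N = real DIM('a)" and u: "C1_grad u Du" and r: "r > 0" "r\<^sup>2 / 2 \<le> S"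
    and p: "continuous_on UNIV p" and \<delta>: "\<delta> > 0" "\<And>s. s \<le> \<delta> \<Longrightarrow> p s = 0"
  defines "l \<equiv> (\<integral>x. p ((norm x)\<^sup>2 / 2) \<partial>(wball r :: 'a measure)) /
      (\<integral>x. exp ((norm x)\<^sup>2 / 2) \<partial>(wball r :: 'a measure))"
  shows "\<mu> * (\<integral>x. u x * (p ((norm x)\<^sup>2 / 2) - l * exp ((norm x)\<^sup>2 / 2)) \<partial>wball r)\<^sup>2
      \<le> (\<integral>x. (norm (Du x))\<^sup>2 \<partial>wball r) *
        (\<integral>x. (p ((norm x)\<^sup>2 / 2) - l * exp ((norm x)\<^sup>2 / 2))\<^sup>2 \<partial>(wball r :: 'a measure))"
proof -
  obtain g g' where g: "\<And>s. (g has_real_derivative g' s) (at s)" "continuous_on UNIV g'"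
    "\<And>s. N * g s + 2 * s * g' s - 2 * s * g s = p s"
    using radial_primitive[OF p \<delta>] by metis
  define c where "c = g (r\<^sup>2 / 2) / exp (r\<^sup>2 / 2)"
  define h where "h s = g s - c * exp s" for s
  define h' where "h' s = g' s - c * exp s" for s
  have h: "(h has_real_derivative h' s) (at s)" for s
    unfolding h_def h'_def by (auto intro!: derivative_eq_intros g(1))
  have h'c: "continuous_on UNIV h'" unfolding h'_def by (intro continuous_intros g)
  have hT: "h (r\<^sup>2 / 2) = 0" by (simp add: h_def c_def)
  have eq: "N * h s + 2 * s * h' s - 2 * s * h s = p s - (c * N) * exp s" for s
    unfolding g(3)[symmetric] h_def h'_def by (simp add: algebra_simps)
  note D = radial_dual[OF N u r h h'c hT, unfolded eq]
  have cont: "continuous_on UNIV (\<lambda>x::'a. p ((norm x)\<^sup>2 / 2))"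
    by (rule continuous_on_compose2[OF p]) (auto intro!: continuous_intros)
  have "(\<integral>x. p ((norm x)\<^sup>2 / 2) \<partial>(wball r :: 'a measure)) -
      c * N * (\<integral>x. exp ((norm x)\<^sup>2 / 2) \<partial>(wball r :: 'a measure)) = 0"
    using D(1) by (subst (asm) Bochner_Integration.integral_diff)
      (auto intro!: integrable_wball_continuous continuous_intros cont)
  then have "c * N = l"
    using integral_exp_wball_pos[OF r(1), where 'a='a] by (simp add: l_def field_simps)
  then show ?thesis using D(2) by simp
qed

end

section \<open>Symmetrisation by reflections\<close>

text \<open>This is the identity for \<open>n = 0\<close>, since \<open>t / 0 = 0\<close>.\<close>

definition mirror :: "'a::euclidean_space \<Rightarrow> 'a \<Rightarrow> 'a" where
  "mirror n x = x - (2 * (x \<bullet> n) / (n \<bullet> n)) *\<^sub>R n"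

lemma mirror_mirror: "mirror n (mirror n x) = x"
  by (cases "n = 0") (simp_all add: mirror_def inner_diff_left)

lemma mirror_add: "mirror n (x + y) = mirror n x + mirror n y"
  by (simp add: mirror_def inner_add_left add_divide_distrib algebra_simps)

lemma mirror_scaleR: "mirror n (c *\<^sub>R x) = c *\<^sub>R mirror n x"
  by (simp add: mirror_def algebra_simps)

lemma linear_mirror: "linear (mirror n)"
  by (rule linearI) (auto simp: mirror_add mirror_scaleR)

lemma inner_mirror: "mirror n x \<bullet> y = x \<bullet> mirror n y"
  by (simp add: mirror_def inner_diff_left inner_diff_right inner_commute)

lemma norm_mirror [simp]: "norm (mirror n x) = norm x"
proof -
  have "mirror n x \<bullet> mirror n x = x \<bullet> x" by (simp add: inner_mirror mirror_mirror)
  then show ?thesis by (simp add: norm_eq_sqrt_inner)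
qed

text \<open>Reflections act transitively on spheres, so invariance under all of them amounts to
  being radial.\<close>

lemma mirror_swap:
  assumes "norm x = norm y"
  shows "mirror (x - y) x = y"
proof (cases "x = y")
  case False
  have "(x - y) \<bullet> (x - y) = 2 * (x \<bullet> (x - y))"
    using assms by (simp add: inner_diff_left inner_diff_right inner_commute norm_eq_sqrt_inner)
  moreover have "(x - y) \<bullet> (x - y) \<noteq> 0" using False by simp
  ultimately have "2 * (x \<bullet> (x - y)) / ((x - y) \<bullet> (x - y)) = 1" by (metis divide_self)
  then show ?thesis unfolding mirror_def by (simp only: scaleR_one) simp
qed (simp add: mirror_def)

section \<open>Invariance of the measures under reflections\<close>

lemma continuous_on_mirror: "continuous_on A (mirror n)"
  using linear_mirror by (rule linear_continuous_on[OF linear_conv_bounded_linear[THEN iffD1]])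

lemma borel_measurable_mirror [measurable]: "mirror n \<in> borel_measurable borel"
  by (intro borel_measurable_continuous_onI continuous_on_mirror)

text \<open>The uniqueness argument for Haar measure: the double integral of the indicators of y in
  the unit ball and of y + x in A is computed in both orders, shifting one variable at a time.
  Comparison on the ball fixes the constant.\<close>

lemma translation_invariant_unique:
  fixes M :: "'a::euclidean_space measure"
  assumes sets: "sets M = sets borel" and sf: "sigma_finite_measure M"
    and inv: "\<And>c. distr M borel ((+) c) = M"
    and ball: "emeasure M (ball 0 1) = emeasure lborel (ball (0::'a) 1)"
  shows "M = lborel"
proof (rule measure_eqI)
  interpret M: sigma_finite_measure M by fact
  interpret pair_sigma_finite lborel M ..
  note [measurable_cong] = sets
  have invM: "(\<integral>\<^sup>+y. f (c + y) \<partial>M) = (\<integral>\<^sup>+y. f y \<partial>M)"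
    if [measurable]: "f \<in> borel_measurable borel" for f c
    by (subst (2) inv[of c, symmetric], subst nn_integral_distr) auto
  have invL: "(\<integral>\<^sup>+y. f (c + y) \<partial>lborel) = (\<integral>\<^sup>+y. f y \<partial>lborel)"
    if [measurable]: "f \<in> borel_measurable borel" for f and c :: 'a
    by (subst (2) lborel_distr_plus[of c, symmetric], subst nn_integral_distr) auto
  fix A assume "A \<in> sets M"
  then have [measurable]: "A \<in> sets borel" by (simp add: sets)
  let ?b = "ball (0::'a) 1"
  have [measurable]: "?b \<in> sets borel" by simp
  have "emeasure lborel A * emeasure M ?b = (\<integral>\<^sup>+y. indicator ?b y * emeasure lborel A \<partial>M)"
    by (subst nn_integral_multc) (auto simp: sets mult.commute)
  also have "\<dots> = (\<integral>\<^sup>+y. \<integral>\<^sup>+x. indicator ?b y * indicator A (y + x) \<partial>lborel \<partial>M)"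
  proof (rule nn_integral_cong)
    fix y :: 'a
    have "emeasure lborel A = (\<integral>\<^sup>+x. indicator A x \<partial>lborel)" by simp
    also have "\<dots> = (\<integral>\<^sup>+x. indicator A (y + x) \<partial>lborel)" by (subst invL) auto
    finally show "indicator ?b y * emeasure lborel A = (\<integral>\<^sup>+x. indicator ?b y * indicator A (y + x) \<partial>lborel)"
      by (subst nn_integral_cmult) auto
  qed
  also have "\<dots> = (\<integral>\<^sup>+x. \<integral>\<^sup>+y. indicator ?b y * indicator A (y + x) \<partial>M \<partial>lborel)"
    by (rule Fubini') measurable
  also have "\<dots> = (\<integral>\<^sup>+x. \<integral>\<^sup>+y. indicator ?b (y - x) * indicator A y \<partial>M \<partial>lborel)"
  proof (rule nn_integral_cong)
    fix x :: 'a
    have "(\<integral>\<^sup>+y. indicator ?b (y - x) * indicator A y \<partial>M) =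
        (\<integral>\<^sup>+y. indicator ?b ((x + y) - x) * indicator A (x + y) \<partial>M)"
      by (rule invM[symmetric]) measurable
    then show "(\<integral>\<^sup>+y. indicator ?b y * indicator A (y + x) \<partial>M) =
        (\<integral>\<^sup>+y. indicator ?b (y - x) * indicator A y \<partial>M)" by (simp add: add.commute)
  qed
  also have "\<dots> = (\<integral>\<^sup>+y. \<integral>\<^sup>+x. indicator ?b (y - x) * indicator A y \<partial>lborel \<partial>M)"
    by (rule Fubini'[symmetric]) measurable
  also have "\<dots> = (\<integral>\<^sup>+y. emeasure lborel ?b * indicator A y \<partial>M)"
  proof (rule nn_integral_cong)
    fix y :: 'a
    have "(\<integral>\<^sup>+x. indicator ?b (y - x) * indicator A y \<partial>lborel) =
        (\<integral>\<^sup>+x. indicator ?b (y - (y + x)) * indicator A y \<partial>lborel)"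
      by (rule invL[symmetric]) measurable
    also have "\<dots> = (\<integral>\<^sup>+x. indicator ?b x * indicator A y \<partial>lborel)"
      by (intro nn_integral_cong) (simp add: indicator_def)
    also have "\<dots> = emeasure lborel ?b * indicator A y"
      by (subst nn_integral_multc) auto
    finally show "(\<integral>\<^sup>+x. indicator ?b (y - x) * indicator A y \<partial>lborel) = emeasure lborel ?b * indicator A y" .
  qed
  also have "\<dots> = emeasure lborel ?b * emeasure M A"
    by (subst nn_integral_cmult) (auto simp: sets)
  finally have eq: "emeasure lborel ?b * emeasure lborel A = emeasure lborel ?b * emeasure M A"
    by (simp add: ball mult.commute)
  have "emeasure lborel ?b \<noteq> 0" "emeasure lborel ?b \<noteq> \<infinity>"
    using emeasure_lborel_ball_finite[of "0::'a" 1] content_ball_pos[of 1 "0::'a"]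
    by (auto simp: measure_def)
  then show "emeasure M A = emeasure lborel A"
    using eq by (metis ennreal_mult_cancel_left infinity_ennreal_def)
qed (simp add: sets)

text \<open>A reflection preserves balls about 0 and turns translation by c into translation by its
  mirror image, so the image measure satisfies the criterion just proved.\<close>

lemma distr_lborel_mirror: "distr lborel borel (mirror n) = lborel"
proof (rule translation_invariant_unique)
  let ?M = "distr lborel borel (mirror n)"
  have ball: "emeasure ?M (ball 0 r) = emeasure lborel (ball (0::'a) r)" for r
  proof -
    have "mirror n -` ball 0 r = ball (0::'a) r" by auto
    then show ?thesis by (subst emeasure_distr) auto
  qed
  show "emeasure ?M (ball 0 1) = emeasure lborel (ball (0::'a) 1)" by (rule ball)
  show "sigma_finite_measure ?M"
  proof
    have "(\<Union>k. ball (0::'a) (real k)) = UNIV"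
      by (auto simp: reals_Archimedean2)
    then show "\<exists>A. countable A \<and> A \<subseteq> sets ?M \<and> \<Union> A = space ?M \<and> (\<forall>a\<in>A. emeasure ?M a \<noteq> \<infinity>)"
      using emeasure_lborel_ball_finite[of "0::'a"]
      by (intro exI[of _ "range (\<lambda>k. ball (0::'a) (real k))"]) (auto simp: ball less_top)
  qed
  show "distr ?M borel ((+) c) = ?M" for c
  proof -
    have "distr ?M borel ((+) c) = distr lborel borel ((+) c \<circ> mirror n)"
      by (subst distr_distr) auto
    also have "(+) c \<circ> mirror n = mirror n \<circ> (+) (mirror n c)"
      by (auto simp: mirror_add mirror_mirror)
    also have "distr lborel borel (mirror n \<circ> (+) (mirror n c)) = distr (distr lborel borel ((+) (mirror n c))) borel (mirror n)"
      by (subst distr_distr) auto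
    finally show ?thesis by (simp add: lborel_distr_plus)
  qed
qed simp

lemma integral_wball_mirror:
  fixes f :: "'a::euclidean_space \<Rightarrow> real"
  assumes [measurable]: "f \<in> borel_measurable borel"
  shows "(\<integral>x. f (mirror n x) \<partial>wball r) = (\<integral>x. f x \<partial>wball r)"
proof -
  have "(\<integral>x. f x \<partial>wball r) = (\<integral>x. indicator (ball 0 r) x * gw x * f x \<partial>distr lborel borel (mirror n))"
    by (simp add: integral_wball distr_lborel_mirror)
  also have "\<dots> = (\<integral>x. indicator (ball 0 r) (mirror n x) * gw (mirror n x) * f (mirror n x) \<partial>lborel)"
    by (rule integral_distr) measurable
  also have "\<dots> = (\<integral>x. indicator (ball 0 r) x * gw x * f (mirror n x) \<partial>lborel)"
    by (intro Bochner_Integration.integral_cong) (auto simp: gw_def indicator_def)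
  also have "\<dots> = (\<integral>x. f (mirror n x) \<partial>wball r)"
    by (subst integral_wball) auto
  finally show ?thesis ..
qed

lemma C1_grad_mirror:
  assumes u: "C1_grad u Du"
  shows "C1_grad (\<lambda>x. u (mirror n x)) (\<lambda>x. mirror n (Du (mirror n x)))"
proof (rule C1_gradI)
  show "((\<lambda>x. u (mirror n x)) has_derivative (\<lambda>h. mirror n (Du (mirror n x)) \<bullet> h)) (at x)" for x
    using has_derivative_compose[OF linear_imp_has_derivative[OF linear_mirror]
        C1_grad_has_derivative[OF u, of "mirror n x" UNIV]]
    by (simp add: inner_mirror)
  show "continuous_on UNIV (\<lambda>x. mirror n (Du (mirror n x)))"
    by (intro continuous_on_compose2[OF continuous_on_mirror[of UNIV]]
        continuous_on_compose2[OF C1_grad_continuous_grad[OF u, of UNIV]] continuous_on_mirror) auto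
qed

lemma wball_nonneg_integral_zero:
  fixes f :: "'a::euclidean_space \<Rightarrow> real"
  assumes f: "continuous_on UNIV f" "\<And>x. f x \<ge> 0" and int: "(\<integral>x. f x \<partial>wball r) \<le> 0"
    and x: "norm x < r"
  shows "f x = 0"
proof (rule ccontr)
  assume fx: "f x \<noteq> 0"
  have "integrable (wball r) f" by (rule integrable_wball_continuous[OF f(1)])
  moreover have "(\<integral>x. f x \<partial>wball r) = 0"
    using int f(2) by (intro antisym integral_nonneg_AE) auto
  ultimately have "AE x in wball r. f x = 0"
    using f(2) by (subst (asm) integral_nonneg_eq_0_iff_AE) auto
  then have "AE x in lborel. 0 < ennreal (indicator (ball 0 r) x * gw x) \<longrightarrow> f x = 0"
    unfolding wball_def by (subst (asm) AE_density) auto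
  then have ae: "AE x in lborel. x \<notin> {x \<in> ball 0 r. f x \<noteq> 0}"
    by eventually_elim (auto simp: gw_pos)
  have op: "open {x \<in> ball 0 r. f x \<noteq> 0}"
  proof -
    have "open (f -` (- {0}))" by (rule open_vimage[OF _ f(1)]) auto
    then have "open (ball 0 r \<inter> f -` (- {0}))" by auto
    moreover have "ball 0 r \<inter> f -` (- {0}) = {x \<in> ball 0 r. f x \<noteq> 0}" by auto
    ultimately show ?thesis by simp
  qed
  then have "{x \<in> ball 0 r. f x \<noteq> 0} \<in> null_sets lborel"
    using ae by (subst AE_iff_null_sets) auto
  then have "negligible {x \<in> ball 0 r. f x \<noteq> 0}"
    using null_sets_completionI negligible_iff_null_sets by blast
  then have "{x \<in> ball 0 r. f x \<noteq> 0} = {}" using open_not_negligible[OF op] by blast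
  then show False using x fx by auto
qed

text \<open>Finite iterates of averaging with a mirror image, together with their gradients. Bounds
  for the function and the gradient on a ball are inherited, which provides the equicontinuity for
  Arzela-Ascoli; the mean is inherited too.\<close>

inductive mirror_avg :: "('a::euclidean_space \<Rightarrow> real) \<Rightarrow> ('a \<Rightarrow> 'a) \<Rightarrow> ('a \<Rightarrow> real) \<Rightarrow> ('a \<Rightarrow> 'a) \<Rightarrow> bool"
  for v Dv where
  mirror_avg_base: "mirror_avg v Dv v Dv"
| mirror_avg_step: "mirror_avg v Dv u Du \<Longrightarrow>
    mirror_avg v Dv (\<lambda>x. (u x + u (mirror n x)) / 2) (\<lambda>x. (1/2) *\<^sub>R (Du x + mirror n (Du (mirror n x))))"

lemma C1_grad_mirror_avg:
  assumes "C1_grad u Du"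
  shows "C1_grad (\<lambda>x. (u x + u (mirror n x)) / 2) (\<lambda>x. (1/2) *\<^sub>R (Du x + mirror n (Du (mirror n x))))"
  using C1_grad_cmult[OF C1_grad_add[OF assms C1_grad_mirror[OF assms]], of "1/2"] by simp

lemma mirror_avg_C1: "mirror_avg v Dv u Du \<Longrightarrow> C1_grad v Dv \<Longrightarrow> C1_grad u Du"
  by (induction rule: mirror_avg.induct) (auto intro: C1_grad_mirror_avg)

lemma mirror_avg_bounded: "mirror_avg v Dv u Du \<Longrightarrow> (\<And>x. norm x \<le> r \<Longrightarrow> \<bar>v x\<bar> \<le> B) \<Longrightarrow> norm x \<le> r \<Longrightarrow> \<bar>u x\<bar> \<le> B"
proof (induction arbitrary: x rule: mirror_avg.induct)
  case (mirror_avg_step u Du n)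
  have "\<bar>u x\<bar> \<le> B" "\<bar>u (mirror n x)\<bar> \<le> B" using mirror_avg_step by auto
  then show ?case by simp
qed auto

lemma mirror_avg_grad_bounded:
  "mirror_avg v Dv u Du \<Longrightarrow> (\<And>x. norm x \<le> r \<Longrightarrow> norm (Dv x) \<le> B) \<Longrightarrow> norm x \<le> r \<Longrightarrow> norm (Du x) \<le> B"
proof (induction arbitrary: x rule: mirror_avg.induct)
  case (mirror_avg_step u Du n)
  have "norm (Du x) \<le> B" "norm (mirror n (Du (mirror n x))) \<le> B" using mirror_avg_step by auto
  then show ?case using norm_triangle_ineq[of "Du x" "mirror n (Du (mirror n x))"] by simp
qed auto

lemma mirror_avg_mean:
  assumes "mirror_avg v Dv u Du" "C1_grad v Dv"
  shows "(\<integral>x. u x \<partial>wball r) = (\<integral>x. v x \<partial>wball r)"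
  using assms
proof (induction rule: mirror_avg.induct)
  case (mirror_avg_step u Du n)
  have u: "C1_grad u Du" using mirror_avg_step by (auto intro: mirror_avg_C1)
  have "(\<integral>x. (u x + u (mirror n x)) / 2 \<partial>wball r) = ((\<integral>x. u x \<partial>wball r) + (\<integral>x. u (mirror n x) \<partial>wball r)) / 2"
    by (simp add: integrable_wball_continuous C1_grad_continuous[OF u] C1_grad_continuous[OF C1_grad_mirror[OF u]])
  then show ?case using mirror_avg_step integral_wball_mirror[where f=u and n=n] C1_grad_measurable[OF u] by simp
qed auto

lemma C1_grad_Lipschitz_ball:
  assumes u: "C1_grad u Du" and L: "\<And>x. norm x \<le> r \<Longrightarrow> norm (Du x) \<le> L"
    and xy: "norm x \<le> r" "norm y \<le> r"
  shows "\<bar>u x - u y\<bar> \<le> L * norm (x - y)"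
proof -
  obtain t where t: "0 \<le> t" "t \<le> 1" "u (y + (x - y)) - u y = Du (y + t *\<^sub>R (x - y)) \<bullet> (x - y)"
    using C1_grad_MVT[OF u] by metis
  have "y + t *\<^sub>R (x - y) = (1 - t) *\<^sub>R y + t *\<^sub>R x" by (simp add: algebra_simps)
  then have "norm (y + t *\<^sub>R (x - y)) \<le> (1 - t) * norm y + t * norm x"
    using t norm_triangle_ineq[of "(1 - t) *\<^sub>R y" "t *\<^sub>R x"] by simp
  also have "\<dots> \<le> (1 - t) * r + t * r" using t xy by (intro add_mono mult_left_mono) auto
  finally have "norm (y + t *\<^sub>R (x - y)) \<le> r" by (simp add: algebra_simps)
  then have "norm (Du (y + t *\<^sub>R (x - y))) \<le> L" by (rule L)
  then have "norm (Du (y + t *\<^sub>R (x - y))) * norm (x - y) \<le> L * norm (x - y)"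
    by (rule mult_right_mono) simp
  then show ?thesis using t(3) Cauchy_Schwarz_ineq2[of "Du (y + t *\<^sub>R (x - y))" "x - y"] by simp
qed

context neumann_profile
begin

text \<open>The form Q of the overview, with the unnormalised weight and on a ball that may be
  smaller than that of the profile.\<close>

definition deficit :: "real \<Rightarrow> ('a::euclidean_space \<Rightarrow> real) \<Rightarrow> ('a \<Rightarrow> 'a) \<Rightarrow> real" where
  "deficit r u Du = (\<integral>x. (norm (Du x))\<^sup>2 \<partial>wball r) - \<mu> * (\<integral>x. (u x)\<^sup>2 \<partial>wball r)"

text \<open>The odd part of \<open>u\<close> under a reflection vanishes on the mirror, so Picone's inequality
  applies to it; even and odd part are orthogonal.\<close>

lemma deficit_mirror_avg:
  fixes u :: "'a::euclidean_space \<Rightarrow> real"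
  assumes N: "N = real DIM('a)" and u: "C1_grad u Du" and r: "r > 0" "r\<^sup>2 / 2 \<le> S"
  shows "deficit r (\<lambda>x. (u x + u (mirror n x)) / 2) (\<lambda>x. (1/2) *\<^sub>R (Du x + mirror n (Du (mirror n x))))
     \<le> deficit r u Du"
proof -
  let ?e = "\<lambda>x. (u x + u (mirror n x)) / 2" and ?De = "\<lambda>x. (1/2) *\<^sub>R (Du x + mirror n (Du (mirror n x)))"
  let ?o = "\<lambda>x. (u x - u (mirror n x)) / 2" and ?Do = "\<lambda>x. (1/2) *\<^sub>R (Du x - mirror n (Du (mirror n x)))"
  have o: "C1_grad ?o ?Do"
    using C1_grad_cmult[OF C1_grad_diff[OF u C1_grad_mirror[OF u, of n]], of "1/2"] by simp
  note e = C1_grad_mirror_avg[OF u, of n]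
  note ru = C1_grad_mirror[OF u, of n]
  note cont = C1_grad_continuous[OF u] C1_grad_continuous_grad[OF u] C1_grad_continuous[OF ru]
     C1_grad_continuous_grad[OF ru]
  obtain L where L: "L \<ge> 0" "\<And>x. norm x \<le> r \<Longrightarrow> norm (Du x) \<le> L"
    using continuous_bounded_on_cball[OF C1_grad_continuous_grad[OF u]] by metis
  have "\<mu> * (\<integral>x. (?o x)\<^sup>2 \<partial>wball r) \<le> (\<integral>x. (norm (?Do x))\<^sup>2 \<partial>wball r)"
  proof (rule picone[OF N o r])
    fix x :: 'a assume "norm x < r"
    then have "\<bar>u x - u (mirror n x)\<bar> \<le> L * norm (x - mirror n x)"
      by (intro C1_grad_Lipschitz_ball[OF u L(2)]) auto
    also have "norm (x - mirror n x) = 2 * \<bar>x \<bullet> n\<bar> / (n \<bullet> n) * norm n"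
      by (simp add: mirror_def abs_mult)
    \<comment> \<open>For n = 0 the constant is 0 by the convention for division, and the odd part
      is 0 as well since the reflection is the identity.\<close>
    finally show "\<bar>?o x\<bar> \<le> (L / (n \<bullet> n) * norm n) * \<bar>x \<bullet> n\<bar>" by (simp add: field_simps)
  qed
  moreover have "(\<integral>x. (?e x)\<^sup>2 \<partial>wball r) + (\<integral>x. (?o x)\<^sup>2 \<partial>wball r) = (\<integral>x. (u x)\<^sup>2 \<partial>wball r)"
  proof -
    have "(\<integral>x. (?e x)\<^sup>2 \<partial>wball r) + (\<integral>x. (?o x)\<^sup>2 \<partial>wball r) = (\<integral>x. (?e x)\<^sup>2 + (?o x)\<^sup>2 \<partial>wball r)"
      by (rule Bochner_Integration.integral_add[symmetric];
          intro integrable_wball_continuous continuous_intros cont; simp)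
    also have "\<dots> = (\<integral>x. (u x)\<^sup>2 / 2 + (u (mirror n x))\<^sup>2 / 2 \<partial>wball r)"
      by (intro Bochner_Integration.integral_cong) (auto simp: power2_eq_square field_simps)
    also have "\<dots> = (\<integral>x. (u x)\<^sup>2 / 2 \<partial>wball r) + (\<integral>x. (u (mirror n x))\<^sup>2 / 2 \<partial>wball r)"
      by (rule Bochner_Integration.integral_add;
          intro integrable_wball_continuous continuous_intros cont; simp)
    also have "(\<integral>x. (u (mirror n x))\<^sup>2 / 2 \<partial>wball r) = (\<integral>x. (u x)\<^sup>2 / 2 \<partial>wball r)"
      by (rule integral_wball_mirror[of "\<lambda>x. (u x)\<^sup>2 / 2"]) (use C1_grad_measurable[OF u] in measurable)
    finally show ?thesis by simp
  qed
  moreover have "(\<integral>x. (norm (?De x))\<^sup>2 \<partial>wball r) + (\<integral>x. (norm (?Do x))\<^sup>2 \<partial>wball r) =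
      (\<integral>x. (norm (Du x))\<^sup>2 \<partial>wball r)"
  proof -
    \<comment> \<open>The parallelogram identity, with the reflection acting isometrically on
      gradients.\<close>
    have par: "(norm (?De x))\<^sup>2 + (norm (?Do x))\<^sup>2 = (norm (Du x))\<^sup>2 / 2 + (norm (Du (mirror n x)))\<^sup>2 / 2" for x
    proof -
      have "(norm (?De x))\<^sup>2 + (norm (?Do x))\<^sup>2 =
          (norm (Du x))\<^sup>2 / 2 + (norm (mirror n (Du (mirror n x))))\<^sup>2 / 2"
        unfolding power2_norm_eq_inner
        by (simp add: inner_add_left inner_add_right inner_diff_left inner_diff_right algebra_simps)
      then show ?thesis by simp
    qed
    have "(\<integral>x. (norm (?De x))\<^sup>2 \<partial>wball r) + (\<integral>x. (norm (?Do x))\<^sup>2 \<partial>wball r) =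
        (\<integral>x. (norm (?De x))\<^sup>2 + (norm (?Do x))\<^sup>2 \<partial>wball r)"
      by (rule Bochner_Integration.integral_add[symmetric];
          intro integrable_wball_continuous continuous_intros cont)
    also have "\<dots> = (\<integral>x. (norm (Du x))\<^sup>2 / 2 + (norm (Du (mirror n x)))\<^sup>2 / 2 \<partial>wball r)"
      by (simp only: par)
    also have "\<dots> = (\<integral>x. (norm (Du x))\<^sup>2 / 2 \<partial>wball r) + (\<integral>x. (norm (Du (mirror n x)))\<^sup>2 / 2 \<partial>wball r)"
      by (rule Bochner_Integration.integral_add;
          intro integrable_wball_continuous continuous_intros cont
            continuous_on_compose2[OF C1_grad_continuous_grad[OF u, of UNIV] continuous_on_mirror]; simp)
    also have "(\<integral>x. (norm (Du (mirror n x)))\<^sup>2 / 2 \<partial>wball r) = (\<integral>x. (norm (Du x))\<^sup>2 / 2 \<partial>wball r)"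
      by (rule integral_wball_mirror[of "\<lambda>x. (norm (Du x))\<^sup>2 / 2"])
        (use C1_grad_measurable[OF u] in measurable)
    finally show ?thesis by simp
  qed
  ultimately show ?thesis unfolding deficit_def by (smt (verit) distrib_left)
qed

lemma deficit_mono_mirror_avg:
  fixes v :: "'a::euclidean_space \<Rightarrow> real"
  assumes "mirror_avg v Dv u Du" "C1_grad v Dv" and N: "N = real DIM('a)" and r: "r > 0" "r\<^sup>2 / 2 \<le> S"
  shows "deficit r u Du \<le> deficit r v Dv"
  using assms(1,2)
proof (induction rule: mirror_avg.induct)
  case (mirror_avg_step u Du n)
  then show ?case using deficit_mirror_avg[OF N mirror_avg_C1 r] order_trans by blast
qed simp

end

text \<open>A minimiser of \<open>\<integral> u\<^sup>2\<close> over (limits of) iterated reflection averages is invariant under every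
  reflection, hence radial.\<close>

lemma mirror_avg_radial_limit:
  fixes v :: "'a::euclidean_space \<Rightarrow> real"
  assumes v: "C1_grad v Dv" and r: "r > 0"
  obtains U DU W B where "\<And>k. mirror_avg v Dv (U k) (DU k)" "continuous_on UNIV (W :: 'a \<Rightarrow> real)"
    "\<And>k x. norm x \<le> r \<Longrightarrow> \<bar>U k x\<bar> \<le> B"
    "\<And>x. norm x \<le> r \<Longrightarrow> (\<lambda>k. U k x) \<longlonglongrightarrow> W x"
    "\<And>x y. norm x < r \<Longrightarrow> norm x = norm y \<Longrightarrow> W x = W y"
proof -
  obtain B where B: "B \<ge> 0" "\<And>x. norm x \<le> r \<Longrightarrow> norm (v x) \<le> B"
    using continuous_bounded_on_cball[OF C1_grad_continuous[OF v]] by metis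
  obtain L where L: "L \<ge> 0" "\<And>x. norm x \<le> r \<Longrightarrow> norm (Dv x) \<le> L"
    using continuous_bounded_on_cball[OF C1_grad_continuous_grad[OF v]] by metis
  define \<Phi> where "\<Phi> u = (\<integral>x. (u x)\<^sup>2 \<partial>(wball r :: 'a measure))" for u :: "'a \<Rightarrow> real"
  define V where "V = {u. \<exists>Du. mirror_avg v Dv u Du}"
  define m where "m = Inf (\<Phi> ` V)"
  have \<Phi>_nonneg: "\<Phi> u \<ge> 0" for u unfolding \<Phi>_def by (intro integral_nonneg_AE) auto
  have vV: "v \<in> V" unfolding V_def by (auto intro: mirror_avg_base)
  have bdd: "bdd_below (\<Phi> ` V)" using \<Phi>_nonneg by (intro bdd_belowI[of _ 0]) auto
  have m_le: "m \<le> \<Phi> u" if "u \<in> V" for u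
    unfolding m_def using that bdd by (intro cInf_lower) auto
  have "\<exists>u\<in>V. \<Phi> u < m + 1 / real (Suc k)" for k
  proof -
    have ne: "\<Phi> ` V \<noteq> {}" using vV by blast
    have "Inf (\<Phi> ` V) < m + 1 / real (Suc k)" unfolding m_def by simp
    from cInf_lessD[OF ne this] obtain y where "y \<in> \<Phi> ` V" "y < m + 1 / real (Suc k)"
      by (elim bexE)
    then show ?thesis by blast
  qed
  then obtain u0 where u0: "\<And>k. u0 k \<in> V" "\<And>k. \<Phi> (u0 k) < m + 1 / real (Suc k)" by metis
  have "\<forall>k. \<exists>Du. mirror_avg v Dv (u0 k) Du" using u0(1) by (simp add: V_def)
  from choice[OF this] obtain Du0 where Du0: "\<And>k. mirror_avg v Dv (u0 k) (Du0 k)" by blast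
  have C1: "C1_grad (u0 k) (Du0 k)" for k using mirror_avg_C1[OF Du0 v] .
  have bnd: "\<bar>u0 k x\<bar> \<le> B" if "norm x \<le> r" for k x
    by (rule mirror_avg_bounded[OF Du0 _ that]) (use B(2) in auto)
  have bndD: "norm (Du0 k x) \<le> L" if "norm x \<le> r" for k x
    by (rule mirror_avg_grad_bounded[OF Du0 L(2) that])
  have lip: "\<bar>u0 k x - u0 k y\<bar> \<le> L * norm (x - y)" if "norm x \<le> r" "norm y \<le> r" for k x y
    by (rule C1_grad_Lipschitz_ball[OF C1 bndD that])
  \<comment> \<open>All averages share the bound B and the Lipschitz constant L on the closed ball,
    so a minimising sequence has a uniformly convergent subsequence.\<close>
  obtain w and \<sigma> :: "nat \<Rightarrow> nat" where w: "continuous_on (cball 0 r) w" "strict_mono \<sigma>"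
    and conv: "\<And>e. 0 < e \<Longrightarrow> \<exists>K. \<forall>n x. n \<ge> K \<and> x \<in> cball 0 r \<longrightarrow> norm (u0 (\<sigma> n) x - w x) < e"
  proof (rule Arzela_Ascoli[of "cball (0::'a) r" u0 B])
    fix x :: 'a and e :: real assume x: "x \<in> cball 0 r" and e: "0 < e"
    show "\<exists>d. 0 < d \<and> (\<forall>n y. y \<in> cball 0 r \<and> norm (x - y) < d \<longrightarrow> norm (u0 n x - u0 n y) < e)"
    proof (intro exI[of _ "e / (L + 1)"] conjI allI impI)
      show "0 < e / (L + 1)" using e L(1) by simp
      fix n y assume y: "y \<in> cball 0 r \<and> norm (x - y) < e / (L + 1)"
      have "\<bar>u0 n x - u0 n y\<bar> \<le> L * norm (x - y)" using x y by (intro lip) auto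
      also have "\<dots> \<le> (L + 1) * norm (x - y)" by (intro mult_right_mono) auto
      also have "\<dots> < e" using y L(1) by (simp add: field_simps)
      finally show "norm (u0 n x - u0 n y) < e" by simp
    qed
  qed (use bnd in auto)
  define U where "U k = u0 (\<sigma> k)" for k
  define DU where "DU k = Du0 (\<sigma> k)" for k
  \<comment> \<open>Composing with the projection onto the ball extends the limit continuously to
    the whole space.\<close>
  define W where "W x = w (closest_point (cball 0 r) x)" for x
  have Ww: "W x = w x" if "norm x \<le> r" for x
    unfolding W_def using that by (subst closest_point_self) auto
  have contW: "continuous_on UNIV W"
    unfolding W_def
  proof (rule continuous_on_compose2[OF w(1)])
    show "continuous_on UNIV (closest_point (cball 0 r))"
      using r by (intro continuous_on_closest_point) auto
    show "closest_point (cball 0 r) ` UNIV \<subseteq> cball 0 r"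
    proof -
      have "cball (0::'a) r \<noteq> {}" using r by simp
      then show ?thesis using closest_point_in_set[OF closed_cball] by (metis cball_eq_empty image_subset_iff)
    qed
  qed
  have tendsto: "(\<lambda>k. U k x) \<longlonglongrightarrow> W x" if x: "norm x \<le> r" for x
  proof (rule LIMSEQ_I)
    fix e :: real assume "0 < e"
    then show "\<exists>no. \<forall>n\<ge>no. norm (U n x - W x) < e"
      using conv[of e] x unfolding U_def Ww[OF x] by (metis mem_cball_0)
  qed
  have U_avg: "mirror_avg v Dv (U k) (DU k)" for k unfolding U_def DU_def by (rule Du0)
  have U_bnd: "\<bar>U k x\<bar> \<le> B" if "norm x \<le> r" for k x unfolding U_def by (rule bnd[OF that])
  have C1U: "C1_grad (U k) (DU k)" for k unfolding U_def DU_def by (rule C1)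
  note [measurable] = C1_grad_measurable(1)[OF C1U] borel_measurable_continuous_onI[OF contW]
  have sq_bound: "t\<^sup>2 \<le> B\<^sup>2" if "\<bar>t\<bar> \<le> B" for t :: real
    using power_mono[OF that, of 2] by simp
  have \<Phi>W: "\<Phi> W = m"
  proof (rule LIMSEQ_unique)
    show "(\<lambda>k. \<Phi> (U k)) \<longlonglongrightarrow> \<Phi> W"
      unfolding \<Phi>_def
      by (rule wball_dominated_convergence[where C="B\<^sup>2"])
        (auto intro!: sq_bound tendsto_power tendsto U_bnd)
    show "(\<lambda>k. \<Phi> (U k)) \<longlonglongrightarrow> m"
    proof (rule tendsto_sandwich)
      show "\<forall>\<^sub>F k in sequentially. m \<le> \<Phi> (U k)"
        using m_le u0(1) by (auto simp: U_def)
      show "\<forall>\<^sub>F k in sequentially. \<Phi> (U k) \<le> m + 1 / real (Suc (\<sigma> k))"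
        using u0(2) by (auto simp: U_def less_imp_le)
      have "(\<lambda>k. 1 / real (Suc (\<sigma> k))) \<longlonglongrightarrow> 0"
        using LIMSEQ_subseq_LIMSEQ[OF LIMSEQ_Suc[OF lim_1_over_n] w(2)] by (simp add: o_def)
      from tendsto_add[OF tendsto_const this] show "(\<lambda>k. m + 1 / real (Suc (\<sigma> k))) \<longlonglongrightarrow> m" by simp
    qed simp
  qed
  have inv: "W x = W (mirror n x)" if x: "norm x < r" for n x
  proof -
    let ?e = "\<lambda>x. (W x + W (mirror n x)) / 2" and ?o = "\<lambda>x. (W x - W (mirror n x)) / 2"
    have contWr: "continuous_on A (\<lambda>x. W (mirror n x))" for A
      by (rule continuous_on_compose2[OF contW continuous_on_mirror]) auto
    have contW': "continuous_on A W" for A using contW by (rule continuous_on_subset) auto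
    have "(\<lambda>k. \<Phi> (\<lambda>x. (U k x + U k (mirror n x)) / 2)) \<longlonglongrightarrow> \<Phi> ?e"
      unfolding \<Phi>_def
    proof (rule wball_dominated_convergence[where C="B\<^sup>2"])
      fix x :: 'a and k assume x: "norm x < r"
      have "\<bar>U k x\<bar> \<le> B" "\<bar>U k (mirror n x)\<bar> \<le> B" using x by (auto intro!: U_bnd)
      then show "\<bar>((U k x + U k (mirror n x)) / 2)\<^sup>2\<bar> \<le> B\<^sup>2" unfolding abs_power2 by (intro sq_bound) simp
    qed (auto intro!: tendsto_intros tendsto)
    moreover have "m \<le> \<Phi> (\<lambda>x. (U k x + U k (mirror n x)) / 2)" for k
      using mirror_avg_step[OF U_avg[of k], of n] by (intro m_le) (auto simp: V_def)
    \<comment> \<open>Averaging the minimising sequence once more stays in the class. So the even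
      part of W has at least the square integral of W, and the odd part is left with none.\<close>
    ultimately have "m \<le> \<Phi> ?e" using LIMSEQ_le_const by blast
    moreover have "\<Phi> ?e + \<Phi> ?o = \<Phi> W"
    proof -
      have "\<Phi> ?e + \<Phi> ?o = (\<integral>x. (?e x)\<^sup>2 + (?o x)\<^sup>2 \<partial>wball r)" unfolding \<Phi>_def
        by (rule Bochner_Integration.integral_add[symmetric];
            intro integrable_wball_continuous continuous_intros contW' contWr; simp)
      also have "\<dots> = (\<integral>x. (W x)\<^sup>2 / 2 + (W (mirror n x))\<^sup>2 / 2 \<partial>wball r)"
        by (intro Bochner_Integration.integral_cong) (auto simp: power2_eq_square field_simps)
      also have "\<dots> = (\<integral>x. (W x)\<^sup>2 / 2 \<partial>wball r) + (\<integral>x. (W (mirror n x))\<^sup>2 / 2 \<partial>wball r)"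
        by (rule Bochner_Integration.integral_add;
            intro integrable_wball_continuous continuous_intros contW' contWr; simp)
      also have "(\<integral>x. (W (mirror n x))\<^sup>2 / 2 \<partial>wball r) = (\<integral>x. (W x)\<^sup>2 / 2 \<partial>wball r)"
        by (rule integral_wball_mirror[of "\<lambda>x. (W x)\<^sup>2 / 2"]) measurable
      finally show ?thesis by (simp add: \<Phi>_def)
    qed
    ultimately have "(\<integral>x. (?o x)\<^sup>2 \<partial>wball r) \<le> 0" using \<Phi>W by (simp add: \<Phi>_def)
    then have "(?o x)\<^sup>2 = 0"
      by (intro wball_nonneg_integral_zero[of "\<lambda>x. (?o x)\<^sup>2", OF _ _ _ x])
        (auto intro!: continuous_intros contW' contWr)
    then show ?thesis by simp
  qed
  have "W x = W y" if "norm x < r" "norm x = norm y" for x y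
    using inv[OF that(1), of "x - y"] mirror_swap[OF that(2)] by simp
  then show thesis using that[OF U_avg contW U_bnd tendsto] by blast
qed

context neumann_profile
begin

text \<open>Write Q for the deficit of v, W for the radial limit of the averages and I for int W^2.
  The averages have energy at most Q + \<mu> int U_k^2. Testing them against a radial f of mean zero
  and letting k tend to infinity gives \<mu> (int W f)^2 <= (Q + \<mu> I) int f^2; with f tending to
  W this becomes \<mu> I^2 <= (Q + \<mu> I) I, that is Q I >= 0.\<close>

lemma poincare_C1_mean_zero:
  fixes v :: "'a::euclidean_space \<Rightarrow> real"
  assumes N: "N = real DIM('a)" and v: "C1_grad v Dv" and r: "r > 0" "r\<^sup>2 / 2 \<le> S"
    and mean: "(\<integral>x. v x \<partial>wball r) = 0"
  shows "deficit r v Dv \<ge> 0"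
proof -
  obtain U DU W B where U: "\<And>k. mirror_avg v Dv (U k) (DU k)" and contW: "continuous_on UNIV (W :: 'a \<Rightarrow> real)"
    and B: "\<And>k x. norm x \<le> r \<Longrightarrow> \<bar>U k x\<bar> \<le> B"
    and lim: "\<And>x. norm x \<le> r \<Longrightarrow> (\<lambda>k. U k x) \<longlonglongrightarrow> W x"
    and rad: "\<And>x y. norm x < r \<Longrightarrow> norm x = norm y \<Longrightarrow> W x = W y"
    using mirror_avg_radial_limit[OF v r(1)] by blast
  let ?s = "\<lambda>x::'a. (norm x)\<^sup>2 / 2"
  have C1U: "C1_grad (U k) (DU k)" for k using mirror_avg_C1[OF U v] .
  note [measurable] = C1_grad_measurable(1)[OF C1U] borel_measurable_continuous_onI[OF contW]
  have B0: "B \<ge> 0" using B[of 0 0] r by simp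
  have BW: "\<bar>W x\<bar> \<le> B" if "norm x \<le> r" for x
    using LIMSEQ_le_const2[OF tendsto_rabs[OF lim[OF that]]] B[OF that] by auto
  have sq_bound: "t\<^sup>2 \<le> B\<^sup>2" if "\<bar>t\<bar> \<le> B" for t :: real
    using power_mono[OF that, of 2] by simp
  have lim_sq: "(\<lambda>k. \<integral>x. (U k x)\<^sup>2 \<partial>wball r) \<longlonglongrightarrow> (\<integral>x. (W x)\<^sup>2 \<partial>wball r)"
    by (rule wball_dominated_convergence[where C="B\<^sup>2"])
      (auto intro!: sq_bound tendsto_power lim B)
  have lim_mul: "(\<lambda>k. \<integral>x. U k x * f x \<partial>wball r) \<longlonglongrightarrow> (\<integral>x. W x * f x \<partial>wball r)"
    if cf: "continuous_on UNIV f" for f :: "'a \<Rightarrow> real"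
  proof -
    obtain C where C: "C \<ge> 0" "\<And>x. norm x \<le> r \<Longrightarrow> norm (f x) \<le> C"
      using continuous_bounded_on_cball[OF cf] by metis
    note [measurable] = borel_measurable_continuous_onI[OF cf]
    show ?thesis
      by (rule wball_dominated_convergence[where C="B * C"])
        (use B C B0 in \<open>auto intro!: tendsto_intros lim mult_mono simp: abs_mult\<close>)
  qed
  have meanW: "(\<integral>x. W x \<partial>wball r) = 0"
    using lim_mul[of "\<lambda>_. 1"] mirror_avg_mean[OF U v] mean by (simp add: LIMSEQ_const_iff)
  define Q where "Q = deficit r v Dv"
  define I where "I = (\<integral>x. (W x)\<^sup>2 \<partial>wball r)"
  have energy: "(\<integral>x. (norm (DU k x))\<^sup>2 \<partial>wball r) \<le> Q + \<mu> * (\<integral>x. (U k x)\<^sup>2 \<partial>wball r)" for k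
    using deficit_mono_mirror_avg[OF U[of k] v N r] unfolding Q_def deficit_def by linarith
  \<comment> \<open>This settles the case I = 0, where the final inequality carries no
    information.\<close>
  have QI: "0 \<le> Q + \<mu> * I"
  proof (rule LIMSEQ_le_const)
    show "(\<lambda>k. Q + \<mu> * (\<integral>x. (U k x)\<^sup>2 \<partial>wball r)) \<longlonglongrightarrow> Q + \<mu> * I"
      unfolding I_def by (intro tendsto_intros lim_sq)
    have "0 \<le> Q + \<mu> * (\<integral>x. (U k x)\<^sup>2 \<partial>wball r)" for k
      by (rule order_trans[OF _ energy]) (auto intro!: integral_nonneg_AE)
    then show "\<exists>N. \<forall>n\<ge>N. 0 \<le> Q + \<mu> * (\<integral>x. (U n x)\<^sup>2 \<partial>wball r)" by auto
  qed
  obtain e0 :: 'a where e0: "e0 \<in> Basis" using nonempty_Basis by blast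
  \<comment> \<open>The profile of W, read off along one ray; the maximum makes it constant for
    negative s, hence continuous on the line.\<close>
  define p where "p s = W (sqrt (2 * max 0 s) *\<^sub>R e0)" for s
  have contp: "continuous_on A p" for A
    unfolding p_def by (rule continuous_on_compose2[OF contW]) (auto intro!: continuous_intros)
  have pW: "p (?s x) = W x" if "norm x < r" for x
    unfolding p_def by (rule rad[symmetric, OF that]) (use e0 in simp)
  \<comment> \<open>Rises from 0 at s = 1/(j+1) to 1 at s = 2/(j+1). The sources p th_j vanish near
    0, as \<open>radial_primitive\<close> demands.\<close>
  define th where "th j s = max 0 (min 1 (real (Suc j) * s - 1))" for j s
  define pj where "pj j s = p s * th j s" for j s
  have contpj: "continuous_on A (pj j)" for A j
    unfolding pj_def th_def by (intro continuous_intros contp)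
  have pj0: "pj j s = 0" if "s \<le> 1 / real (Suc j)" for j s
    using that by (simp add: pj_def th_def field_simps)
  have th01: "0 \<le> th j s" "th j s \<le> 1" for j s by (auto simp: th_def)
  have th1: "(\<lambda>j. th j s) \<longlonglongrightarrow> 1" if "s > 0" for s
  proof (rule tendsto_eventually)
    obtain j0 where j0: "2 / s \<le> real j0" using real_arch_simple by blast
    have "th j s = 1" if "j \<ge> j0" for j
    proof -
      have "2 / s \<le> real (Suc j)" using j0 that by linarith
      then have "2 \<le> real (Suc j) * s" using \<open>s > 0\<close> by (simp add: field_simps)
      then show ?thesis by (simp add: th_def)
    qed
    then show "\<forall>\<^sub>F j in sequentially. th j s = 1" by (auto simp: eventually_sequentially)
  qed
  define E where "E = (\<integral>x. exp (?s x) \<partial>(wball r :: 'a measure))"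
  \<comment> \<open>The correction that gives the truncated source mean zero. It tends to 0 because
    W itself has mean zero.\<close>
  define l where "l j = (\<integral>x. pj j (?s x) \<partial>(wball r :: 'a measure)) / E" for j
  define f where "f j x = pj j (?s x) - l j * exp (?s x)" for j x
  have cs: "continuous_on UNIV ?s" by (intro continuous_intros) auto
  have contpjs: "continuous_on A (\<lambda>x. pj j (?s x))" for A j
    by (rule continuous_on_compose2[OF contpj[of UNIV]]) (auto intro!: continuous_intros)
  have contf: "continuous_on A (f j)" for A j
    unfolding f_def by (intro continuous_intros contpjs) auto
  note [measurable] = borel_measurable_continuous_onI[OF contf] borel_measurable_continuous_onI[OF contpjs]
  have E: "E > 0" unfolding E_def by (rule integral_exp_wball_pos[OF r(1)])
  have pjB: "\<bar>pj j (?s x)\<bar> \<le> B" if "norm x < r" for j x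
    using mult_mono[of "\<bar>W x\<bar>" B "th j (?s x)" 1] BW[of x] that th01 B0 by (simp add: pj_def pW abs_mult)
  have pj_lim: "(\<lambda>j. pj j (?s x)) \<longlonglongrightarrow> W x" if "norm x < r" "x \<noteq> 0" for x
    unfolding pj_def using tendsto_mult[OF tendsto_const th1[of "?s x"], of "p (?s x)"] that pW by simp
  have l_lim: "l \<longlonglongrightarrow> 0"
  proof -
    have "(\<lambda>j. \<integral>x. pj j (?s x) \<partial>(wball r :: 'a measure)) \<longlonglongrightarrow> (\<integral>x. W x \<partial>wball r)"
      by (rule wball_dominated_convergence[where C=B]) (auto intro: pjB pj_lim)
    from tendsto_divide[OF this tendsto_const, of E] show ?thesis using E meanW by (simp add: l_def[abs_def])
  qed
  obtain Lb where Lb: "\<And>j. \<bar>l j\<bar> \<le> Lb"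
    using convergent_imp_Bseq[OF convergentI[OF l_lim]] by (auto simp: Bseq_def)
  have fB: "\<bar>f j x\<bar> \<le> B + Lb * exp (r\<^sup>2 / 2)" if "norm x < r" for j x
  proof -
    have "\<bar>l j * exp (?s x)\<bar> \<le> Lb * exp (r\<^sup>2 / 2)"
      unfolding abs_mult using half_norm_le[of x r] that Lb[of j] by (intro mult_mono) auto
    then show ?thesis using pjB[OF that, of j] unfolding f_def by linarith
  qed
  have f_lim: "(\<lambda>j. f j x) \<longlonglongrightarrow> W x" if "norm x < r" "x \<noteq> 0" for x
    unfolding f_def using tendsto_diff[OF pj_lim[OF that] tendsto_mult[OF l_lim tendsto_const]] by simp
  \<comment> \<open>Only U_k, not its gradient, survives on the left side, so the limit in k is
    legitimate although W has no gradient.\<close>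
  have step1: "\<mu> * (\<integral>x. W x * f j x \<partial>wball r)\<^sup>2 \<le> (Q + \<mu> * I) * (\<integral>x. (f j x)\<^sup>2 \<partial>wball r)" for j
  proof (rule LIMSEQ_le)
    show "(\<lambda>k. \<mu> * (\<integral>x. U k x * f j x \<partial>wball r)\<^sup>2) \<longlonglongrightarrow> \<mu> * (\<integral>x. W x * f j x \<partial>wball r)\<^sup>2"
      by (intro tendsto_intros lim_mul contf)
    show "(\<lambda>k. (Q + \<mu> * (\<integral>x. (U k x)\<^sup>2 \<partial>wball r)) * (\<integral>x. (f j x)\<^sup>2 \<partial>wball r)) \<longlonglongrightarrow>
        (Q + \<mu> * I) * (\<integral>x. (f j x)\<^sup>2 \<partial>wball r)"
      unfolding I_def by (intro tendsto_intros lim_sq)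
    have "\<mu> * (\<integral>x. U k x * f j x \<partial>wball r)\<^sup>2 \<le>
      (Q + \<mu> * (\<integral>x. (U k x)\<^sup>2 \<partial>wball r)) * (\<integral>x. (f j x)\<^sup>2 \<partial>wball r)" for k
    proof -
      have "\<mu> * (\<integral>x. U k x * f j x \<partial>wball r)\<^sup>2 \<le>
          (\<integral>x. (norm (DU k x))\<^sup>2 \<partial>wball r) * (\<integral>x. (f j x)\<^sup>2 \<partial>wball r)"
        unfolding f_def l_def E_def
        by (rule radial_test[OF N C1U r contpj, of "1 / real (Suc j)"]) (auto intro: pj0)
      also have "\<dots> \<le> (Q + \<mu> * (\<integral>x. (U k x)\<^sup>2 \<partial>wball r)) * (\<integral>x. (f j x)\<^sup>2 \<partial>wball r)"
        by (intro mult_right_mono energy integral_nonneg_AE) auto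
      finally show ?thesis .
    qed
    then show "\<exists>N. \<forall>n\<ge>N. \<mu> * (\<integral>x. U n x * f j x \<partial>wball r)\<^sup>2 \<le>
      (Q + \<mu> * (\<integral>x. (U n x)\<^sup>2 \<partial>wball r)) * (\<integral>x. (f j x)\<^sup>2 \<partial>wball r)" by blast
  qed
  have step2: "\<mu> * I\<^sup>2 \<le> (Q + \<mu> * I) * I"
  proof (rule LIMSEQ_le)
    have "(\<lambda>j. \<integral>x. W x * f j x \<partial>wball r) \<longlonglongrightarrow> I"
      unfolding I_def power2_eq_square
    proof (rule wball_dominated_convergence[where C="B * (B + Lb * exp (r\<^sup>2 / 2))"])
      fix j and x :: 'a assume x: "norm x < r"
      show "\<bar>W x * f j x\<bar> \<le> B * (B + Lb * exp (r\<^sup>2 / 2))"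
        unfolding abs_mult using BW[of x] fB[OF x, of j] x B0 by (intro mult_mono) auto
    qed (auto intro!: tendsto_intros f_lim)
    then show "(\<lambda>j. \<mu> * (\<integral>x. W x * f j x \<partial>wball r)\<^sup>2) \<longlonglongrightarrow> \<mu> * I\<^sup>2"
      by (intro tendsto_intros)
    have "(\<lambda>j. \<integral>x. (f j x)\<^sup>2 \<partial>wball r) \<longlonglongrightarrow> I"
      unfolding I_def
    proof (rule wball_dominated_convergence[where C="(B + Lb * exp (r\<^sup>2 / 2))\<^sup>2"])
      fix j and x :: 'a assume x: "norm x < r"
      show "\<bar>(f j x)\<^sup>2\<bar> \<le> (B + Lb * exp (r\<^sup>2 / 2))\<^sup>2"
        using fB[OF x, of j] by (metis abs_ge_zero abs_power2 power2_abs power_mono)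
    qed (auto intro!: tendsto_intros f_lim)
    then show "(\<lambda>j. (Q + \<mu> * I) * (\<integral>x. (f j x)\<^sup>2 \<partial>wball r)) \<longlonglongrightarrow> (Q + \<mu> * I) * I"
      by (intro tendsto_intros)
    show "\<exists>N. \<forall>n\<ge>N. \<mu> * (\<integral>x. W x * f n x \<partial>wball r)\<^sup>2 \<le> (Q + \<mu> * I) * (\<integral>x. (f n x)\<^sup>2 \<partial>wball r)"
      using step1 by blast
  qed
  have I0: "I \<ge> 0" unfolding I_def by (intro integral_nonneg_AE) auto
  show ?thesis
  proof (cases "I = 0")
    case True
    then show ?thesis using QI by (simp add: Q_def)
  next
    case False
    have "0 \<le> Q * I" using step2 by (simp add: power2_eq_square algebra_simps)
    then show ?thesis using False I0 by (simp add: zero_le_mult_iff Q_def)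
  qed
qed

end

section \<open>The radial eigenvalue equation\<close>

text \<open>The power series of Kummer's function \<open>M((1 - m) / 2, (N + 2) / 2, s)\<close>.\<close>

primrec kummer_coeff :: "real \<Rightarrow> real \<Rightarrow> nat \<Rightarrow> real" where
  "kummer_coeff N m 0 = 1"
| "kummer_coeff N m (Suc j) =
     (2 * real j + 1 - m) / (real (Suc j) * (2 * real j + N + 2)) * kummer_coeff N m j"

text \<open>Each factor of the recursion is at most (1 + M)/(j + 1) in absolute value. The bound is
  uniform for |m| <= M, as joint continuity in m and s requires.\<close>

lemma kummer_coeff_bound:
  assumes "N \<ge> 0" "\<bar>m\<bar> \<le> M"
  shows "\<bar>kummer_coeff N m j\<bar> \<le> (1 + M) ^ j / fact j"
proof (induction j)
  case (Suc j)
  have M: "M \<ge> 0" using assms by linarith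
  have "\<bar>2 * real j + 1 - m\<bar> \<le> 2 * real j + 1 + M" using assms by linarith
  also have "\<dots> \<le> (1 + M) * (2 * real j + N + 2)"
    using M assms(1) by (simp add: algebra_simps add_increasing)
  finally have "\<bar>2 * real j + 1 - m\<bar> / (2 * real j + N + 2) \<le> 1 + M"
    using assms(1) by (simp add: divide_le_eq)
  then have "\<bar>2 * real j + 1 - m\<bar> / (2 * real j + N + 2) * \<bar>kummer_coeff N m j\<bar> \<le>
      (1 + M) * ((1 + M) ^ j / fact j)"
    using M assms(1) by (intro mult_mono Suc) auto
  then have "\<bar>2 * real j + 1 - m\<bar> / (2 * real j + N + 2) * \<bar>kummer_coeff N m j\<bar> / real (Suc j) \<le>
      (1 + M) * ((1 + M) ^ j / fact j) / real (Suc j)"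
    by (rule divide_right_mono) simp
  also have "\<dots> = (1 + M) ^ Suc j / fact (Suc j)" by (simp add: field_simps)
  also have "\<bar>2 * real j + 1 - m\<bar> / (2 * real j + N + 2) * \<bar>kummer_coeff N m j\<bar> / real (Suc j) =
      \<bar>kummer_coeff N m (Suc j)\<bar>"
    using assms(1) by (simp add: abs_mult abs_divide divide_divide_eq_left mult.commute del: of_nat_Suc)
  finally show ?case .
qed simp

text \<open>A majorant for the flux, whose series carries the factors 1 + 2j.\<close>

lemma summable_exp_linear: "summable (\<lambda>j. (1 + 2 * real j) * (x ^ j / fact j))" for x :: real
proof -
  have s: "summable (\<lambda>j. x ^ j / fact j)" for x :: real
    using summable_exp[of x] by (simp add: field_simps)
  have "summable (\<lambda>n. diffs (\<lambda>j. 1 / fact j) n * x ^ n)"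
    by (rule termdiff_converges_all) (use s in simp)
  from sums_summable[OF diffs_equiv[OF this]]
  have "summable (\<lambda>n. real n * (1 / fact n) * x ^ (n - Suc 0))" .
  then have "summable (\<lambda>n. 2 * x * (real n * (1 / fact n) * x ^ (n - Suc 0)))"
    by (rule summable_mult)
  moreover have "2 * x * (real n * (1 / fact n) * x ^ (n - Suc 0)) = 2 * real n * (x ^ n / fact n)" for n
    by (cases n) (simp_all del: fact_Suc of_nat_Suc)
  ultimately have "summable (\<lambda>n. 2 * real n * (x ^ n / fact n))" by (simp only:)
  then have "summable (\<lambda>n. x ^ n / fact n + 2 * real n * (x ^ n / fact n))"
    by (intro summable_add s)
  then show ?thesis by (simp add: algebra_simps)
qed

lemma summable_kummer:
  assumes "N \<ge> 0"
  shows "summable (\<lambda>j. kummer_coeff N m j * x ^ j)"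
proof (rule summable_comparison_test')
  show "summable (\<lambda>j. ((1 + \<bar>m\<bar>) * \<bar>x\<bar>) ^ j / fact j)"
    using summable_exp[of "(1 + \<bar>m\<bar>) * \<bar>x\<bar>"] by (simp add: field_simps)
  show "norm (kummer_coeff N m j * x ^ j) \<le> ((1 + \<bar>m\<bar>) * \<bar>x\<bar>) ^ j / fact j" for j
  proof -
    have "\<bar>kummer_coeff N m j\<bar> * \<bar>x\<bar> ^ j \<le> (1 + \<bar>m\<bar>) ^ j / fact j * \<bar>x\<bar> ^ j"
      using kummer_coeff_bound[OF assms order_refl] by (intro mult_right_mono) auto
    then show ?thesis by (simp add: abs_mult power_abs power_mult_distrib)
  qed
qed

definition kummer :: "real \<Rightarrow> real \<Rightarrow> real \<Rightarrow> real" where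
  "kummer N m s = (\<Sum>j. kummer_coeff N m j * s ^ j)"

definition kummer1 :: "real \<Rightarrow> real \<Rightarrow> real \<Rightarrow> real" where
  "kummer1 N m s = (\<Sum>j. diffs (kummer_coeff N m) j * s ^ j)"

definition kummer2 :: "real \<Rightarrow> real \<Rightarrow> real \<Rightarrow> real" where
  "kummer2 N m s = (\<Sum>j. diffs (diffs (kummer_coeff N m)) j * s ^ j)"

text \<open>With s = |x|^2/2 this is the radial derivative of |x| times the Kummer function; its
  vanishing is the Neumann condition.\<close>

definition kummer_flux :: "real \<Rightarrow> real \<Rightarrow> real \<Rightarrow> real" where
  "kummer_flux N m s = kummer N m s + 2 * s * kummer1 N m s"

lemma times_diffs_sums:
  fixes c :: "nat \<Rightarrow> real"
  assumes "summable (\<lambda>n. diffs c n * s ^ n)"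
  shows "(\<lambda>n. real n * c n * s ^ n) sums (s * (\<Sum>n. diffs c n * s ^ n))"
proof -
  have "s * (real n * c n * s ^ (n - Suc 0)) = real n * c n * s ^ n" for n
    by (cases n) auto
  then show ?thesis using sums_mult[OF diffs_equiv[OF assms], of s] by (simp only:)
qed

lemma kummer_flux_sums:
  assumes "N \<ge> 0"
  shows "(\<lambda>j. (1 + 2 * real j) * (kummer_coeff N m j * s ^ j)) sums kummer_flux N m s"
proof -
  have "(\<lambda>j. kummer_coeff N m j * s ^ j + 2 * (real j * kummer_coeff N m j * s ^ j)) sums
      (kummer N m s + 2 * (s * kummer1 N m s))"
    unfolding kummer_def kummer1_def
    by (intro sums_add sums_mult times_diffs_sums summable_sums termdiff_converges_all
        summable_kummer assms)
  then show ?thesis by (simp add: kummer_flux_def algebra_simps)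
qed

lemma DERIV_kummer: "N \<ge> 0 \<Longrightarrow> (kummer N m has_real_derivative kummer1 N m s) (at s)"
  and DERIV_kummer1: "N \<ge> 0 \<Longrightarrow> (kummer1 N m has_real_derivative kummer2 N m s) (at s)"
  and continuous_kummer2: "N \<ge> 0 \<Longrightarrow> continuous_on UNIV (kummer2 N m)"
proof -
  assume N: "N \<ge> 0"
  note s0 = summable_kummer[OF N]
  note s1 = termdiff_converges_all[OF s0]
  note s2 = termdiff_converges_all[OF s1]
  show "(kummer N m has_real_derivative kummer1 N m s) (at s)"
    unfolding kummer_def[abs_def] kummer1_def
    by (rule termdiffs_strong_converges_everywhere[OF s0])
  show "(kummer1 N m has_real_derivative kummer2 N m s) (at s)"
    unfolding kummer1_def[abs_def] kummer2_def
    by (rule termdiffs_strong_converges_everywhere[OF s1])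
  have "(kummer2 N m has_real_derivative (\<Sum>n. diffs (diffs (diffs (kummer_coeff N m))) n * t ^ n)) (at t)" for t
    unfolding kummer2_def[abs_def] by (rule termdiffs_strong_converges_everywhere[OF s2])
  then show "continuous_on UNIV (kummer2 N m)"
    by (rule continuous_on_of_DERIV)
qed

lemma kummer_ode:
  assumes N: "N \<ge> 0"
  shows "2 * s * kummer2 N m s + (N + 2 - 2 * s) * kummer1 N m s + (m - 1) * kummer N m s = 0"
proof -
  let ?c = "kummer_coeff N m"
  note s0 = summable_kummer[OF N, of m]
  note s1 = termdiff_converges_all[OF s0]
  note s2 = termdiff_converges_all[OF s1]
  have "(\<lambda>j. 2 * (real j * diffs ?c j * s ^ j) + (N + 2) * (diffs ?c j * s ^ j)
      - 2 * (real j * ?c j * s ^ j) + (m - 1) * (?c j * s ^ j)) sums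
      (2 * (s * kummer2 N m s) + (N + 2) * kummer1 N m s - 2 * (s * kummer1 N m s) + (m - 1) * kummer N m s)"
    unfolding kummer_def kummer1_def kummer2_def
    by (intro sums_add sums_diff sums_mult times_diffs_sums summable_sums s0 s1 s2)
  moreover have "2 * (real j * diffs ?c j * s ^ j) + (N + 2) * (diffs ?c j * s ^ j)
      - 2 * (real j * ?c j * s ^ j) + (m - 1) * (?c j * s ^ j) = 0" for j
  proof -
    \<comment> \<open>The recursion for the coefficients, which is the equation compared at the
      power s^j.\<close>
    have "(2 * real j + N + 2) * diffs ?c j = (2 * real j + 1 - m) * ?c j"
    proof -
      have "2 * real j + N + 2 \<noteq> 0" using N by (metis add_nonneg_pos add_nonneg_nonneg of_nat_0_le_iff mult_nonneg_nonneg zero_le_numeral zero_less_numeral less_irrefl)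
      then show ?thesis by (simp add: diffs_def del: of_nat_Suc)
    qed
    then have "((2 * real j + N + 2) * diffs ?c j - (2 * real j + 1 - m) * ?c j) * s ^ j = 0" by simp
    then show ?thesis by (simp add: algebra_simps)
  qed
  ultimately have "2 * (s * kummer2 N m s) + (N + 2) * kummer1 N m s - 2 * (s * kummer1 N m s)
      + (m - 1) * kummer N m s = 0"
    using sums_unique2[OF _ sums_zero] by simp
  then show ?thesis by (simp add: algebra_simps)
qed

lemma kummer_0: "kummer N m 0 = 1" "kummer_flux N m 0 = 1"
  using powser_sums_zero[of "kummer_coeff N m"] by (simp_all add: kummer_def kummer_flux_def sums_iff)

lemma DERIV_kummer_flux:
  assumes N: "N \<ge> 0"
  shows "(kummer_flux N m has_real_derivative (1 - N + 2 * s) * kummer1 N m s - (m - 1) * kummer N m s) (at s)"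
proof -
  have "(kummer_flux N m has_real_derivative kummer1 N m s + (2 * kummer1 N m s + 2 * s * kummer2 N m s)) (at s)"
    unfolding kummer_flux_def[abs_def]
    by (rule derivative_eq_intros DERIV_kummer[OF N] DERIV_kummer1[OF N] refl)+ (simp add: algebra_simps)
  moreover have "kummer1 N m s + (2 * kummer1 N m s + 2 * s * kummer2 N m s) =
      (1 - N + 2 * s) * kummer1 N m s - (m - 1) * kummer N m s"
    using kummer_ode[OF N, of s m] by (simp add: algebra_simps)
  ultimately show ?thesis by simp
qed

text \<open>Makes the set of pairs (m, s) with nonpositive flux compact, so that a least such m
  exists. Weierstrass test with the majorant above.\<close>

lemma continuous_on_kummer_flux_joint:
  assumes N: "N \<ge> 0"
  shows "continuous_on ({1..M} \<times> {0..S}) (\<lambda>(m, s). kummer_flux N m s)"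
proof -
  let ?f = "\<lambda>j (m, s). (1 + 2 * real j) * (kummer_coeff N m j * s ^ j)"
  have cc: "continuous_on UNIV (\<lambda>m. kummer_coeff N m j)" for j
  proof (induction j)
    case (Suc j)
    have "2 * real j + N + 2 > 0" using N by (intro add_nonneg_pos) auto
    then show ?case using Suc by (auto intro!: continuous_intros)
  qed simp
  have "uniform_limit ({1..M} \<times> {0..S}) (\<lambda>n x. \<Sum>j<n. ?f j x) (\<lambda>x. \<Sum>j. ?f j x) sequentially"
  proof (rule Weierstrass_m_test)
    show "summable (\<lambda>j. (1 + 2 * real j) * (((1 + \<bar>M\<bar>) * \<bar>S\<bar>) ^ j / fact j))"
      by (rule summable_exp_linear)
    fix j x assume x: "x \<in> {1..M} \<times> {0..S}"
    obtain m s where ms: "x = (m, s)" "1 \<le> m" "m \<le> M" "0 \<le> s" "s \<le> S" using x by auto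
    have "\<bar>kummer_coeff N m j\<bar> * \<bar>s\<bar> ^ j \<le> (1 + \<bar>M\<bar>) ^ j / fact j * \<bar>S\<bar> ^ j"
      using ms by (intro mult_mono kummer_coeff_bound[OF N] power_mono) auto
    then have "(1 + 2 * real j) * (\<bar>kummer_coeff N m j\<bar> * \<bar>s\<bar> ^ j) \<le>
       (1 + 2 * real j) * ((1 + \<bar>M\<bar>) ^ j / fact j * \<bar>S\<bar> ^ j)"
      by (intro mult_left_mono) auto
    then show "norm (?f j x) \<le> (1 + 2 * real j) * (((1 + \<bar>M\<bar>) * \<bar>S\<bar>) ^ j / fact j)"
      by (simp add: ms abs_mult power_abs power_mult_distrib)
  qed
  then have "continuous_on ({1..M} \<times> {0..S}) (\<lambda>x. \<Sum>j. ?f j x)"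
    by (rule uniform_limit_theorem[rotated])
      (auto intro!: always_eventually continuous_intros continuous_on_compose2[OF cc] simp: split_beta)
  moreover have "(\<Sum>j. ?f j x) = (\<lambda>(m, s). kummer_flux N m s) x" for x
    using kummer_flux_sums[OF N] by (auto simp: split_beta sums_iff)
  ultimately show ?thesis by simp
qed

text \<open>The derivative of s \<kappa>(s)^2 is \<kappa> times the flux. Up to a first zero z of
  \<kappa> this function is therefore nondecreasing, and being positive at z/2 it cannot vanish at
  z.\<close>

lemma kummer_pos:
  assumes N: "N \<ge> 0" and flux: "\<And>s. 0 \<le> s \<Longrightarrow> s \<le> T \<Longrightarrow> kummer_flux N m s \<ge> 0"
    and t: "0 \<le> t" "t \<le> T"
  shows "kummer N m t > 0"
proof (rule ccontr)
  assume neg: "\<not> kummer N m t > 0"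
  have cont: "continuous_on A (kummer N m)" for A
    using DERIV_kummer[OF N] by (rule continuous_on_of_DERIV)
  let ?Z = "{s \<in> {0..t}. kummer N m s \<le> 0}"
  have "closed ?Z" by (intro continuous_on_closed_Collect_le cont continuous_on_const closed_atLeastAtMost)
  moreover have "bounded ?Z" by (rule bounded_subset[OF bounded_closed_interval[of 0 t]]) auto
  ultimately have "compact ?Z" by (simp add: compact_eq_bounded_closed)
  moreover have "t \<in> ?Z" using neg t by auto
  ultimately obtain z where z: "z \<in> ?Z" "\<And>s. s \<in> ?Z \<Longrightarrow> z \<le> s"
    using compact_attains_inf[of ?Z] by blast
  have z0: "z > 0" using z(1) kummer_0(1)[of N m] by (cases "z = 0") auto
  have pos: "kummer N m s > 0" if "0 \<le> s" "s < z" for s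
    using z that by fastforce
  define y where "y s = s * (kummer N m s)\<^sup>2" for s
  have Dy: "(y has_real_derivative kummer N m s * kummer_flux N m s) (at s)" for s
    unfolding y_def[abs_def] kummer_flux_def
    by (rule derivative_eq_intros DERIV_kummer[OF N] refl)+ (simp add: power2_eq_square algebra_simps)
  have "y (z / 2) \<le> y z"
  proof (rule DERIV_nonneg_imp_nondecreasing[where f=y])
    fix s assume s: "z / 2 \<le> s" "s \<le> z"
    have "kummer N m s \<ge> 0"
    proof (cases "s = z")
      case True
      show ?thesis
      proof (rule tendsto_lowerbound)
        show "(kummer N m \<longlongrightarrow> kummer N m s) (at_left z)"
          using DERIV_isCont[OF DERIV_kummer[OF N, of m s]] True
          by (simp add: isCont_def filterlim_at_split)
        show "\<forall>\<^sub>F x in at_left z. 0 \<le> kummer N m x"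
          using eventually_at_left_real[OF z0] by eventually_elim (auto intro: less_imp_le pos)
      qed simp
    next
      case False
      then show ?thesis using pos[of s] s z0 by simp
    qed
    moreover have "kummer_flux N m s \<ge> 0" using flux[of s] s z0 z(1) t by auto
    ultimately show "\<exists>y'. (y has_real_derivative y') (at s) \<and> 0 \<le> y'" using Dy by (metis mult_nonneg_nonneg)
  qed (use z0 in simp)
  moreover have "y (z / 2) > 0" using pos[of "z / 2"] z0 by (simp add: y_def)
  ultimately have "kummer N m z \<noteq> 0" by (auto simp: y_def)
  moreover have "kummer N m z \<ge> 0"
  proof (rule tendsto_lowerbound)
    show "(kummer N m \<longlongrightarrow> kummer N m z) (at_left z)"
      using DERIV_isCont[OF DERIV_kummer[OF N, of m z]] by (simp add: isCont_def filterlim_at_split)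
    show "\<forall>\<^sub>F x in at_left z. 0 \<le> kummer N m x"
      using eventually_at_left_real[OF z0] by eventually_elim (auto intro: less_imp_le pos)
  qed simp
  ultimately show False using z(1) by auto
qed

text \<open>Kummer's equation in Sturm-Liouville form.\<close>

lemma DERIV_kummer_weighted:
  assumes N: "N \<ge> 0" and s: "s > 0"
  shows "((\<lambda>s. 2 * s powr (N / 2 + 1) * exp (- s) * kummer1 N m s) has_real_derivative
    - (m - 1) * s powr (N / 2) * exp (- s) * kummer N m s) (at s)"
proof -
  have "((\<lambda>s. 2 * s powr (N / 2 + 1) * exp (- s) * kummer1 N m s) has_real_derivative
     (2 * ((N / 2 + 1) * s powr (N / 2)) * exp (- s) - exp (- s) * (2 * s powr (N / 2 + 1))) * kummer1 N m s
     + kummer2 N m s * (2 * s powr (N / 2 + 1) * exp (- s))) (at s)"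
    using s by (auto intro!: derivative_eq_intros DERIV_kummer1[OF N] simp: algebra_simps)
  moreover have "(2 * ((N / 2 + 1) * s powr (N / 2)) * exp (- s) - exp (- s) * (2 * s powr (N / 2 + 1))) * kummer1 N m s
     + kummer2 N m s * (2 * s powr (N / 2 + 1) * exp (- s)) =
     s powr (N / 2) * exp (- s) * (2 * s * kummer2 N m s + (N + 2 - 2 * s) * kummer1 N m s)"
    using s by (simp add: powr_add algebra_simps)
  moreover have "2 * s * kummer2 N m s + (N + 2 - 2 * s) * kummer1 N m s = - (m - 1) * kummer N m s"
    using kummer_ode[OF N, of s m] by (simp add: algebra_simps)
  ultimately show ?thesis by (simp add: mult_ac)
qed

text \<open>The weighted derivative is 0 at s = 0 and, by the Sturm-Liouville form, nonincreasing
  while \<kappa> > 0. At s = 0 the weight hides the sign, which is read off the first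
  coefficient.\<close>

lemma kummer1_nonpos:
  assumes N: "N \<ge> 0" and m: "m \<ge> 1" and flux: "\<And>s. 0 \<le> s \<Longrightarrow> s \<le> T \<Longrightarrow> kummer_flux N m s \<ge> 0"
    and t: "0 \<le> t" "t \<le> T"
  shows "kummer1 N m t \<le> 0"
proof (cases "t = 0")
  case True
  have "kummer1 N m 0 = diffs (kummer_coeff N m) 0"
    using powser_sums_zero[of "diffs (kummer_coeff N m)"] by (simp add: kummer1_def sums_iff)
  also have "\<dots> = (1 - m) / (N + 2)" by (simp add: diffs_def)
  also have "\<dots> \<le> 0" using N m by (simp add: divide_nonpos_pos)
  finally show ?thesis using True by simp
next
  case False
  then have t0: "t > 0" using t by simp
  let ?G = "\<lambda>s. 2 * s powr (N / 2 + 1) * exp (- s) * kummer1 N m s"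
  have "continuous_on {0..t} (kummer1 N m)"
    using DERIV_kummer1[OF N] by (rule continuous_on_of_DERIV)
  then have cont: "continuous_on {0..t} ?G" using N
    by (intro continuous_intros continuous_on_powr') auto
  have "\<exists>l z. 0 < z \<and> z < t \<and> (?G has_real_derivative l) (at z) \<and> ?G t - ?G 0 = (t - 0) * l"
    using t0 DERIV_kummer_weighted[OF N] cont
    by (intro MVT) (auto simp: real_differentiable_def)
  then obtain l z where z: "0 < z" "z < t" "(?G has_real_derivative l) (at z)" "?G t - ?G 0 = t * l"
    by auto
  have "l = - (m - 1) * z powr (N / 2) * exp (- z) * kummer N m z"
    by (rule DERIV_unique[OF z(3) DERIV_kummer_weighted[OF N z(1)]])
  also have "\<dots> \<le> 0"
  proof -
    have "kummer N m z > 0" by (rule kummer_pos[OF N flux]) (use z t in auto)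
    then have "(m - 1) * z powr (N / 2) * exp (- z) * kummer N m z \<ge> 0" using m by simp
    then show ?thesis by argo
  qed
  finally have "?G t \<le> 0" using z(4) N t0 by (simp add: mult_nonneg_nonpos)
  then have "2 * t powr (N / 2 + 1) * exp (- t) * kummer1 N m t \<le> 0" .
  moreover have "2 * t powr (N / 2 + 1) * exp (- t) > 0" using t0 by simp
  ultimately show ?thesis by (smt (verit) mult_pos_pos)
qed

text \<open>If the flux stayed positive on [0, S], then \<kappa> would be positive and
  nonincreasing. For large m the Sturm-Liouville form on [S/2, S] would then push \<kappa>'(S) so
  low that the flux at S is not positive.\<close>

lemma kummer_flux_large_m:
  assumes N: "N \<ge> 0" and S: "S > 0"
  obtains m s where "m \<ge> 1" "0 \<le> s" "s \<le> S" "kummer_flux N m s \<le> 0"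
proof -
  \<comment> \<open>A lower bound for the weight z^(N/2) e^(-z) on [S/2, S].\<close>
  define w where "w = (S / 2) powr (N / 2) * exp (- S)"
  have w: "w > 0" using S by (simp add: w_def)
  \<comment> \<open>Chosen so that (m - 1) w S/2 equals S^(N/2) e^(-S), the factor of \<kappa>(S) in
    the weighted flux at S.\<close>
  define m where "m = 1 + 2 * S powr (N / 2) * exp (- S) / (S * w)"
  have m: "m \<ge> 1" using S w by (simp add: m_def)
  have "\<exists>s. 0 \<le> s \<and> s \<le> S \<and> kummer_flux N m s \<le> 0"
  proof (rule ccontr)
    assume "\<not> ?thesis"
    then have flux: "\<And>s. 0 \<le> s \<Longrightarrow> s \<le> S \<Longrightarrow> kummer_flux N m s > 0" by (meson not_le)
    then have flux': "\<And>s. 0 \<le> s \<Longrightarrow> s \<le> S \<Longrightarrow> kummer_flux N m s \<ge> 0" by (simp add: less_imp_le)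
    note pos = kummer_pos[OF N flux'] and neg = kummer1_nonpos[OF N m flux']
    let ?G = "\<lambda>s. 2 * s powr (N / 2 + 1) * exp (- s) * kummer1 N m s"
    obtain z where z: "S / 2 < z" "z < S"
      "?G S - ?G (S / 2) = (S - S / 2) * (- (m - 1) * z powr (N / 2) * exp (- z) * kummer N m z)"
      using MVT2[of "S / 2" S ?G "\<lambda>z. - (m - 1) * z powr (N / 2) * exp (- z) * kummer N m z"]
        DERIV_kummer_weighted[OF N] S by auto
    have dec: "kummer N m S \<le> kummer N m z"
      using z S by (intro DERIV_nonpos_imp_nonincreasing[of z S "kummer N m"])
        (auto intro!: exI[of _ "kummer1 N m _"] DERIV_kummer[OF N] neg)
    have "w \<le> z powr (N / 2) * exp (- z)"
      unfolding w_def using z S N by (intro mult_mono powr_mono2) auto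
    then have "w * kummer N m S \<le> z powr (N / 2) * exp (- z) * kummer N m z"
      using dec w pos[of S] S by (intro mult_mono) (auto simp: less_imp_le)
    then have "(m - 1) * (w * kummer N m S) \<le> (m - 1) * (z powr (N / 2) * exp (- z) * kummer N m z)"
      using m by (intro mult_left_mono) auto
    moreover have "(m - 1) * (w * kummer N m S) = 2 * S powr (N / 2) * exp (- S) / S * kummer N m S"
      using w by (simp add: m_def)
    ultimately have "2 * S powr (N / 2) * exp (- S) / S * kummer N m S \<le>
        (m - 1) * z powr (N / 2) * exp (- z) * kummer N m z" by (simp add: mult_ac)
    then have "(S / 2) * (2 * S powr (N / 2) * exp (- S) / S * kummer N m S) \<le>
        (S / 2) * ((m - 1) * z powr (N / 2) * exp (- z) * kummer N m z)"
      using S by (intro mult_left_mono) auto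
    then have "S powr (N / 2) * exp (- S) * kummer N m S \<le> ?G (S / 2) - ?G S"
      using z(3) S by (simp add: field_simps)
    moreover have "?G (S / 2) \<le> 0" using neg[of "S / 2"] S by (simp add: mult_nonneg_nonpos)
    ultimately have "S powr (N / 2) * exp (- S) * kummer N m S + ?G S \<le> 0" by linarith
    moreover have "S powr (N / 2) * exp (- S) * kummer N m S + ?G S =
        S powr (N / 2) * exp (- S) * kummer_flux N m S"
      using S by (simp add: kummer_flux_def powr_add algebra_simps)
    ultimately have "S powr (N / 2) * exp (- S) * kummer_flux N m S \<le> 0" by simp
    moreover have "S powr (N / 2) * exp (- S) > 0" using S by simp
    ultimately show False using flux[of S] S by (simp add: mult_le_0_iff)
  qed
  then show thesis using that m by blast
qed

text \<open>The eigenvalue is the smallest \<open>m \<ge> 1\<close> for which the flux vanishes somewhere in \<open>[0, S]\<close>;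
  by the equation for the flux, a first zero can only appear at the right end point.\<close>

lemma neumann_profile_exists:
  assumes N: "N \<ge> 0" and S: "S > 0"
  obtains \<kappa> \<kappa>1 \<kappa>2 \<mu> where "neumann_profile N \<kappa> \<kappa>1 \<kappa>2 S \<mu>"
proof -
  obtain M s0 where M: "M \<ge> 1" "0 \<le> s0" "s0 \<le> S" "kummer_flux N M s0 \<le> 0"
    using kummer_flux_large_m[OF N S] by metis
  let ?K = "{p \<in> {1..M} \<times> {0..S}. (\<lambda>(m, s). kummer_flux N m s) p \<le> 0}"
  have "closed ?K"
    by (intro continuous_on_closed_Collect_le continuous_on_kummer_flux_joint[OF N] continuous_on_const
        closed_Times) auto
  moreover have "?K \<subseteq> {1..M} \<times> {0..S}" by auto
  moreover have "compact ({1..M} \<times> {0..S})" by (intro compact_Times) auto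
  ultimately have "compact ?K" by (metis (no_types, lifting) closed_Int_compact inf.absorb_iff1)
  then have "compact (fst ` ?K)" by (intro compact_continuous_image continuous_intros)
  moreover have "fst ` ?K \<noteq> {}" using M by force
  ultimately obtain \<mu> where \<mu>: "\<mu> \<in> fst ` ?K" "\<And>m. m \<in> fst ` ?K \<Longrightarrow> \<mu> \<le> m"
    using compact_attains_inf[of "fst ` ?K"] by blast
  then obtain t where t: "1 \<le> \<mu>" "\<mu> \<le> M" "0 \<le> t" "t \<le> S" "kummer_flux N \<mu> t \<le> 0" by auto
  have below: "kummer_flux N m s > 0" if "1 \<le> m" "m < \<mu>" "0 \<le> s" "s \<le> S" for m s
  proof (rule ccontr)
    assume "\<not> ?thesis"
    then have "(m, s) \<in> ?K" using that t(2) by auto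
    then have "\<mu> \<le> m" using \<mu>(2)[of m] by (metis (no_types, lifting) fst_conv imageI)
    then show False using that by simp
  qed
  \<comment> \<open>For m = 1 the series stops after its constant term, so the flux is identically 1
    and the least m is larger. There is then room to approach it from below.\<close>
  have m1: "\<mu> > 1"
  proof (rule ccontr)
    assume "\<not> ?thesis"
    then have "\<mu> = 1" using t by simp
    have "kummer_coeff N 1 (Suc j) = 0" for j by (induction j) auto
    then have "(1 + 2 * real j) * (kummer_coeff N 1 j * t ^ j) = (if j = 0 then 1 else 0)" for j
      by (cases j) (auto simp del: kummer_coeff.simps(2))
    then have "kummer_flux N 1 t = 1"
      using sums_unique2[OF kummer_flux_sums[OF N, of 1 t]] sums_single[of 0 "\<lambda>_. 1::real"] by simp
    then show False using t \<open>\<mu> = 1\<close> by simp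
  qed
  have flux: "kummer_flux N \<mu> s \<ge> 0" if s: "0 \<le> s" "s \<le> S" for s
  proof (rule tendsto_lowerbound)
    have "continuous_on {1..M} (\<lambda>m. (\<lambda>(m, s). kummer_flux N m s) (m, s))"
      by (rule continuous_on_compose2[OF continuous_on_kummer_flux_joint[OF N, of M S]])
        (use s in \<open>auto intro!: continuous_intros\<close>)
    then have "continuous_on {1..M} (\<lambda>m. kummer_flux N m s)" by simp
    then have "continuous_on {1..\<mu>} (\<lambda>m. kummer_flux N m s)"
      by (rule continuous_on_subset) (use t in auto)
    then show "((\<lambda>m. kummer_flux N m s) \<longlongrightarrow> kummer_flux N \<mu> s) (at_left \<mu>)"
      using continuous_on_Icc_at_leftD m1 by blast
    show "\<forall>\<^sub>F m in at_left \<mu>. 0 \<le> kummer_flux N m s"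
      using eventually_at_left_real[OF m1] by eventually_elim (auto intro: less_imp_le below s)
  qed simp
  note pos = kummer_pos[OF N flux] and neg = kummer1_nonpos[OF N t(1) flux]
  \<comment> \<open>An interior zero of the nonnegative flux is a minimum, so the flux and its
    derivative D vanish there. Then s^a e^(-s) times the flux is strictly decreasing to the right of
    s, which makes the flux negative at S.\<close>
  have zero_end: "s = S" if s: "0 \<le> s" "s \<le> S" "kummer_flux N \<mu> s = 0" for s
  proof (rule ccontr)
    assume "s \<noteq> S"
    then have sS: "s < S" using s by simp
    have s0: "s > 0" using s kummer_0(2)[of N \<mu>] by (cases "s = 0") auto
    define D where "D t = (1 - N + 2 * t) * kummer1 N \<mu> t - (\<mu> - 1) * kummer N \<mu> t" for t
    have DF: "(kummer_flux N \<mu> has_real_derivative D t) (at t)" for t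
      unfolding D_def by (rule DERIV_kummer_flux[OF N])
    have "D s = 0"
    proof (rule DERIV_local_min[OF DF])
      show "0 < min s (S - s)" using s0 sS by simp
      show "\<forall>y. \<bar>s - y\<bar> < min s (S - s) \<longrightarrow> kummer_flux N \<mu> s \<le> kummer_flux N \<mu> y"
        using flux s(3) by auto
    qed
    \<comment> \<open>This exponent eliminates \<kappa>' from the derivative of t^a e^(-t) times the
      flux, leaving (a - \<mu> t) \<kappa>(t) with a positive factor. Its sign changes only at t =
      a/\<mu>, and that is the point s.\<close>
    define a where "a = (N - 1) / 2"
    have eq: "D t * t + (a - t) * kummer_flux N \<mu> t = (a - \<mu> * t) * kummer N \<mu> t" for t
      unfolding D_def a_def kummer_flux_def by (simp add: field_simps)
    have "(a - \<mu> * s) * kummer N \<mu> s = 0" using eq[of s] \<open>D s = 0\<close> s(3) by simp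
    then have as: "a = \<mu> * s" using pos[of s] s by force
    let ?P = "\<lambda>t. t powr a * exp (- t) * kummer_flux N \<mu> t"
    have DP: "(?P has_real_derivative t powr (a - 1) * exp (- t) * ((a - \<mu> * t) * kummer N \<mu> t)) (at t)"
      if t: "t > 0" for t
    proof -
      have "(?P has_real_derivative (a * t powr (a - 1) * exp (- t) - exp (- t) * t powr a) * kummer_flux N \<mu> t
          + D t * (t powr a * exp (- t))) (at t)"
        using t by (auto intro!: derivative_eq_intros DF simp: algebra_simps)
      moreover have "t powr a = t powr (a - 1) * t" using t by (simp add: powr_diff)
      then have "(a * t powr (a - 1) * exp (- t) - exp (- t) * t powr a) * kummer_flux N \<mu> t
          + D t * (t powr a * exp (- t)) = t powr (a - 1) * exp (- t) * (D t * t + (a - t) * kummer_flux N \<mu> t)"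
        by (simp add: algebra_simps)
      ultimately show ?thesis unfolding eq by simp
    qed
    have "?P s > ?P S"
    proof (rule DERIV_neg_imp_decreasing_open[OF sS])
      fix x assume x: "s < x" "x < S"
      have "\<mu> * s < \<mu> * x" using x m1 by simp
      then have "(a - \<mu> * x) * kummer N \<mu> x < 0" using pos[of x] x s0 as by (simp add: mult_neg_pos)
      moreover have "x powr (a - 1) * exp (- x) > 0" using x s0 by simp
      ultimately have "x powr (a - 1) * exp (- x) * ((a - \<mu> * x) * kummer N \<mu> x) < 0" by (rule mult_pos_neg[rotated])
      then show "\<exists>y. (?P has_real_derivative y) (at x) \<and> y < 0" using DP[of x] x s0 by (meson less_trans)
    next
      show "continuous_on {s..S} ?P"
      proof (rule DERIV_continuous_on)
        fix t assume "t \<in> {s..S}"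
        then have "t > 0" using s0 by simp
        from has_field_derivative_at_within[OF DP[OF this]]
        show "(?P has_real_derivative t powr (a - 1) * exp (- t) * ((a - \<mu> * t) * kummer N \<mu> t))
          (at t within {s..S})" .
      qed
    qed
    moreover have "?P S \<ge> 0" using flux[of S] S by simp
    ultimately show False using s(3) by simp
  qed
  have "kummer_flux N \<mu> t = 0" using t flux[of t] by simp
  then have flux_S: "kummer_flux N \<mu> S = 0" using zero_end[of t] t by simp
  have "neumann_profile N (kummer N \<mu>) (kummer1 N \<mu>) (kummer2 N \<mu>) S \<mu>"
  proof
    show "kummer N \<mu> s + 2 * s * kummer1 N \<mu> s > 0" if "0 \<le> s" "s < S" for s
      using flux[of s] zero_end[of s] that by (force simp: kummer_flux_def less_le)
    show "kummer N \<mu> S + 2 * S * kummer1 N \<mu> S = 0" using flux_S by (simp add: kummer_flux_def)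
  qed (use DERIV_kummer[OF N] DERIV_kummer1[OF N] continuous_kummer2[OF N] kummer_ode[OF N] S t pos neg in auto)
  then show thesis by (rule that)
qed

section \<open>Mollification\<close>

text \<open>The powers in the denominator make the derivative of each member a combination of two
  others, so that differentiability of every order at 0 follows from a single limit.\<close>

definition flat_exp :: "nat \<Rightarrow> real \<Rightarrow> real" where
  "flat_exp m t = (if t > 0 then exp (- 1 / t) / t ^ m else 0)"

lemma flat_exp_tendsto_0: "(flat_exp m \<longlongrightarrow> 0) (at_right 0)"
proof -
  have "((\<lambda>t::real. exp (- 1 / t) / t ^ m) \<longlongrightarrow> 0) (at_right 0)"
  proof -
    have "((\<lambda>x::real. x ^ m / exp x) \<longlongrightarrow> 0) at_top" by (rule tendsto_power_div_exp_0)
    then have "((\<lambda>t::real. (inverse t) ^ m / exp (inverse t)) \<longlongrightarrow> 0) (at_right 0)"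
      by (rule filterlim_compose[OF _ filterlim_inverse_at_top_right])
    moreover have "(inverse t) ^ m / exp (inverse t) = exp (- 1 / t) / t ^ m" for t :: real
      by (simp add: exp_minus divide_inverse power_inverse mult.commute)
    ultimately show ?thesis by simp
  qed
  moreover have "\<forall>\<^sub>F t in at_right 0. exp (- 1 / t) / t ^ m = flat_exp m t"
    using eventually_at_right_less[of "0::real"] by eventually_elim (simp add: flat_exp_def)
  ultimately show ?thesis by (rule Lim_transform_eventually)
qed

lemma DERIV_flat_exp: "(flat_exp m has_real_derivative flat_exp (Suc (Suc m)) t - real m * flat_exp (Suc m) t) (at t)"
proof -
  consider "t < 0" | "t > 0" | "t = 0" by linarith
  then show ?thesis
  proof cases
    case 1
    have "((\<lambda>t. 0) has_real_derivative 0) (at t)" by simp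
    then have "(flat_exp m has_real_derivative 0) (at t)"
      by (rule has_field_derivative_transform_within_open[where S="{..<0}"])
        (use 1 in \<open>auto simp: flat_exp_def\<close>)
    then show ?thesis using 1 by (simp add: flat_exp_def)
  next
    case 2
    have "((\<lambda>t. exp (- 1 / t) / t ^ m) has_real_derivative flat_exp (Suc (Suc m)) t - real m * flat_exp (Suc m) t) (at t)"
    proof (rule DERIV_cong)
      show "((\<lambda>t. exp (- 1 / t) / t ^ m) has_real_derivative
        (exp (- 1 / t) * (1 / t\<^sup>2) * t ^ m - exp (- 1 / t) * (real m * t ^ (m - 1))) / (t ^ m * t ^ m)) (at t)"
        using 2 by (auto intro!: derivative_eq_intros simp: power2_eq_square field_simps)
      show "(exp (- 1 / t) * (1 / t\<^sup>2) * t ^ m - exp (- 1 / t) * (real m * t ^ (m - 1))) / (t ^ m * t ^ m)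
          = flat_exp (Suc (Suc m)) t - real m * flat_exp (Suc m) t"
        using 2 by (cases m) (simp_all add: flat_exp_def field_simps power2_eq_square)
    qed
    then show ?thesis
      by (rule has_field_derivative_transform_within_open[where S="{0<..}"])
        (use 2 in \<open>auto simp: flat_exp_def\<close>)
  next
    case 3
    have "((\<lambda>h. flat_exp m h / h) \<longlongrightarrow> 0) (at 0)"
    proof (rule filterlim_split_at_real)
      have "\<forall>\<^sub>F h in at_left 0. 0 = flat_exp m h / h"
        using eventually_at_left_real[of "-1" 0, simplified] by eventually_elim (simp add: flat_exp_def)
      then show "((\<lambda>h. flat_exp m h / h) \<longlongrightarrow> 0) (at_left 0)"
        by (rule Lim_transform_eventually[OF tendsto_const])
      have "\<forall>\<^sub>F h in at_right 0. flat_exp (Suc m) h = flat_exp m h / h"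
        using eventually_at_right_less[of "0::real"] by eventually_elim (simp add: flat_exp_def field_simps)
      then show "((\<lambda>h. flat_exp m h / h) \<longlongrightarrow> 0) (at_right 0)"
        by (rule Lim_transform_eventually[OF flat_exp_tendsto_0])
    qed
    then show ?thesis using 3 by (simp add: DERIV_def flat_exp_def)
  qed
qed

lemma continuous_on_flat_exp: "continuous_on A (flat_exp m)"
  using DERIV_flat_exp by (rule continuous_on_of_DERIV)

text \<open>Closed under partial derivatives, hence consisting of smooth functions.\<close>

inductive_set bump_class :: "'a::euclidean_space \<Rightarrow> real \<Rightarrow> ('a \<Rightarrow> real) set" for c e where
  bump_flat: "(\<lambda>y. flat_exp m (e - (norm (c - y))\<^sup>2)) \<in> bump_class c e"
| bump_const: "f \<in> bump_class c e \<Longrightarrow> (\<lambda>y. a * f y) \<in> bump_class c e"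
| bump_coord: "f \<in> bump_class c e \<Longrightarrow> (\<lambda>y. ((c - y) \<bullet> i) * f y) \<in> bump_class c e"
| bump_add: "f \<in> bump_class c e \<Longrightarrow> g \<in> bump_class c e \<Longrightarrow> (\<lambda>y. f y + g y) \<in> bump_class c e"

lemma has_derivative_flat_norm:
  "((\<lambda>y. flat_exp m (e - (norm (c - y))\<^sup>2)) has_derivative
    (\<lambda>h. 2 * (flat_exp (Suc (Suc m)) (e - (norm (c - y))\<^sup>2) - real m * flat_exp (Suc m) (e - (norm (c - y))\<^sup>2)) * ((c - y) \<bullet> h)))
    (at (y::'a::euclidean_space))"
proof -
  have "((\<lambda>y. e - (norm (c - y))\<^sup>2) has_derivative (\<lambda>h. 2 * ((c - y) \<bullet> h))) (at y)"
    unfolding power2_norm_eq_inner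
    by (auto intro!: derivative_eq_intros simp: inner_commute algebra_simps)
  from has_derivative_compose[OF this DERIV_flat_exp[THEN has_field_derivative_imp_has_derivative]]
  show ?thesis by (simp add: algebra_simps)
qed

lemma bump_class_derivative:
  assumes "f \<in> bump_class c e"
  obtains f' where "\<And>y. (f has_derivative f' y) (at y)" "\<And>i. (\<lambda>y. f' y i) \<in> bump_class c e"
  using assms
proof (induction arbitrary: thesis rule: bump_class.induct)
  case (bump_flat m)
  show ?case
  proof (rule bump_flat[OF has_derivative_flat_norm])
    fix i
    have "(\<lambda>y. 2 * (((c - y) \<bullet> i) * (flat_exp (Suc (Suc m)) (e - (norm (c - y))\<^sup>2)
      + (- real m) * flat_exp (Suc m) (e - (norm (c - y))\<^sup>2)))) \<in> bump_class c e"
      by (intro bump_class.intros)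
    then show "(\<lambda>y. 2 * (flat_exp (Suc (Suc m)) (e - (norm (c - y))\<^sup>2) - real m * flat_exp (Suc m) (e - (norm (c - y))\<^sup>2))
       * ((c - y) \<bullet> i)) \<in> bump_class c e" by (simp add: algebra_simps)
  qed
next
  case (bump_const f a)
  then obtain f' where f': "\<And>y. (f has_derivative f' y) (at y)" "\<And>i. (\<lambda>y. f' y i) \<in> bump_class c e" by metis
  show ?case
    by (rule bump_const.prems[of "\<lambda>y h. a * f' y h"])
      (auto intro!: has_derivative_mult_right f' bump_class.bump_const)
next
  case (bump_coord f j)
  then obtain f' where f': "\<And>y. (f has_derivative f' y) (at y)" "\<And>i. (\<lambda>y. f' y i) \<in> bump_class c e" by metis
  show ?case
  proof (rule bump_coord.prems[of "\<lambda>y h. ((c - y) \<bullet> j) * f' y h + (- (h \<bullet> j)) * f y"])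
    show "((\<lambda>y. ((c - y) \<bullet> j) * f y) has_derivative (\<lambda>h. ((c - y) \<bullet> j) * f' y h + (- (h \<bullet> j)) * f y)) (at y)" for y
      by (auto intro!: derivative_eq_intros f')
    show "(\<lambda>y. ((c - y) \<bullet> j) * f' y i + (- (i \<bullet> j)) * f y) \<in> bump_class c e" for i
      by (intro bump_class.bump_add bump_class.bump_const bump_class.bump_coord f' bump_coord)
  qed
next
  case (bump_add f g)
  obtain f' where f': "\<And>y. (f has_derivative f' y) (at y)" "\<And>i. (\<lambda>y. f' y i) \<in> bump_class c e"
    using bump_add by metis
  obtain g' where g': "\<And>y. (g has_derivative g' y) (at y)" "\<And>i. (\<lambda>y. g' y i) \<in> bump_class c e"
    using bump_add by metis
  show ?case
    by (rule bump_add.prems[of "\<lambda>y h. f' y h + g' y h"])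
      (auto intro!: has_derivative_add f' g' bump_class.bump_add)
qed

lemma bump_class_continuously_differentiable:
  "f \<in> bump_class c e \<Longrightarrow> continuously_differentiable k f"
proof (induction k arbitrary: f)
  case 0
  then obtain f' where f': "\<And>y. (f has_derivative f' y) (at y)" using bump_class_derivative by metis
  show ?case
    using f' has_derivative_continuous continuous_at_imp_continuous_on by (metis continuously_differentiable.simps(1))
next
  case (Suc k)
  then obtain f' where f': "\<And>y. (f has_derivative f' y) (at y)" "\<And>i. (\<lambda>y. f' y i) \<in> bump_class c e"
    using bump_class_derivative by metis
  have "frechet_derivative f (at y) = f' y" for y
    using frechet_derivative_at[OF f'(1)] by simp
  then show ?case using f' Suc.IH by (auto simp: differentiable_def)
qed

section \<open>The standard mollifier\<close>

definition bump :: "real \<Rightarrow> 'a::euclidean_space \<Rightarrow> real" where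
  "bump e z = flat_exp 0 (e\<^sup>2 - (norm z)\<^sup>2)"

definition bump' :: "real \<Rightarrow> 'a::euclidean_space \<Rightarrow> 'a" where
  "bump' e z = (- 2 * flat_exp (Suc (Suc 0)) (e\<^sup>2 - (norm z)\<^sup>2)) *\<^sub>R z"

lemma bump_nonneg: "bump e z \<ge> 0" by (simp add: bump_def flat_exp_def)

lemma bump_pos_iff: "e > 0 \<Longrightarrow> bump e z \<noteq> 0 \<longleftrightarrow> norm z < e"
  using half_norm_less_iff[of e z] by (simp add: bump_def flat_exp_def)

lemma bump_outside: "e > 0 \<Longrightarrow> norm z \<ge> e \<Longrightarrow> bump e z = 0"
  using bump_pos_iff[of e z] by simp

lemma C1_grad_bump: "C1_grad (bump e) (bump' e)"
proof (rule C1_gradI)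
  show "(bump e has_derivative (\<lambda>h. bump' e x \<bullet> h)) (at x)" for x :: 'a
    using has_derivative_flat_norm[of 0 "e\<^sup>2" 0 x] by (simp add: bump_def[abs_def] bump'_def)
  show "continuous_on UNIV (bump' e)" unfolding bump'_def
    by (intro continuous_intros continuous_on_compose2[OF continuous_on_flat_exp[of UNIV]]) auto
qed

text \<open>Translates of the bump are the test functions into which the definition of the weak
  gradient is specialised. The minus sign comes from differentiating in y.\<close>

lemma test_function_bump:
  fixes x :: "'a::euclidean_space"
  assumes e: "e > 0" and sub: "cball x e \<subseteq> \<Omega>"
  shows "test_function \<Omega> (\<lambda>y. bump e (x - y))"
    and "frechet_derivative (\<lambda>y. bump e (x - y)) (at y) h = - (bump' e (x - y) \<bullet> h)"
proof -
  have "{y. bump e (x - y) \<noteq> 0} = ball x e"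
    by (auto simp: dist_norm bump_pos_iff[OF e])
  then have cl: "closure {y. bump e (x - y) \<noteq> 0} = cball x e" using e by simp
  have "(\<lambda>y. bump e (x - y)) \<in> bump_class x (e\<^sup>2)"
    unfolding bump_def by (rule bump_flat)
  then show "test_function \<Omega> (\<lambda>y. bump e (x - y))"
    unfolding test_function_def cl using sub
    by (intro conjI allI bump_class_continuously_differentiable[of _ x "e\<^sup>2"] compact_cball)
  have "((\<lambda>y. bump e (x - y)) has_derivative (\<lambda>h. bump' e (x - y) \<bullet> (- h))) (at y)"
    by (rule has_derivative_compose[OF _ C1_grad_has_derivative[OF C1_grad_bump]])
      (auto intro!: derivative_eq_intros)
  from frechet_derivative_at[OF this]
  show "frechet_derivative (\<lambda>y. bump e (x - y)) (at y) h = - (bump' e (x - y) \<bullet> h)"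
    by (metis inner_minus_right)
qed

lemma continuous_bounded_support_uniform:
  fixes f :: "'a::euclidean_space \<Rightarrow> 'b::euclidean_space"
  assumes cont: "continuous_on UNIV f" and supp: "\<And>x. norm x > T \<Longrightarrow> f x = 0"
  shows "uniformly_continuous_on UNIV f" and "\<exists>B\<ge>0. \<forall>x. norm (f x) \<le> B"
proof -
  obtain B where B: "B \<ge> 0" "\<And>x. norm x \<le> T \<Longrightarrow> norm (f x) \<le> B"
    using continuous_bounded_on_cball[OF cont] by metis
  then show "\<exists>B\<ge>0. \<forall>x. norm (f x) \<le> B"
    using supp by (metis norm_zero not_le)
  have uc: "uniformly_continuous_on (cball 0 (T + 1)) f"
    by (rule compact_uniformly_continuous[OF continuous_on_subset[OF cont]]) auto
  show "uniformly_continuous_on UNIV f"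
    unfolding uniformly_continuous_on_def
  proof (intro allI impI)
    fix \<epsilon> :: real assume \<epsilon>: "\<epsilon> > 0"
    obtain d where d: "d > 0" "\<And>x x'. x \<in> cball 0 (T + 1) \<Longrightarrow> x' \<in> cball 0 (T + 1) \<Longrightarrow>
        dist x' x < d \<Longrightarrow> dist (f x') (f x) < \<epsilon>"
      using uc \<epsilon> unfolding uniformly_continuous_on_def by metis
    have "dist (f x') (f x) < \<epsilon>" if "dist x' x < min d 1" for x x'
    proof (cases "x \<in> cball 0 (T + 1) \<and> x' \<in> cball 0 (T + 1)")
      case True
      then show ?thesis using d(2)[of x x'] that by auto
    next
      case False
      have "norm x \<le> norm x' + dist x' x" "norm x' \<le> norm x + dist x' x"
        by (metis add.commute dist_norm norm_triangle_sub norm_minus_commute)+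
      then have "norm x > T" "norm x' > T" using False that by auto
      then show ?thesis using supp \<epsilon> by simp
    qed
    then show "\<exists>d>0. \<forall>x\<in>UNIV. \<forall>x'\<in>UNIV. dist x' x < d \<longrightarrow> dist (f x') (f x) < \<epsilon>"
      using d(1) by (intro exI[of _ "min d 1"]) auto
  qed
qed

lemma borel_measurable_diff_arg:
  assumes "f \<in> borel_measurable borel"
  shows "(\<lambda>y. f (x - y)) \<in> borel_measurable (borel :: 'a::euclidean_space measure)"
  using assms by measurable

lemma integrable_mult_bounded:
  fixes f :: "'a::euclidean_space \<Rightarrow> real" and g :: "'a \<Rightarrow> 'b::euclidean_space"
  assumes f: "integrable lborel f" and g: "g \<in> borel_measurable borel" and B: "\<And>x. norm (g x) \<le> B"
  shows "integrable lborel (\<lambda>y. f y *\<^sub>R g y)"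
proof (rule Bochner_Integration.integrable_bound)
  show "integrable lborel (\<lambda>y. B * f y)" using f by simp
  show "(\<lambda>y. f y *\<^sub>R g y) \<in> borel_measurable lborel"
    using f g by auto
  have "\<bar>f y\<bar> * norm (g y) \<le> \<bar>f y\<bar> * \<bar>B\<bar>" for y
    using B[of y] by (intro mult_left_mono) auto
  then show "AE y in lborel. norm (f y *\<^sub>R g y) \<le> norm (B * f y)"
    by (intro AE_I2) (simp add: abs_mult mult.commute)
qed

text \<open>All derivatives fall on the kernel, so f need only be integrable. Uniform continuity of
  the kernel's gradient controls both the remainder of the derivative and its continuity.\<close>

lemma C1_grad_convolution:
  fixes f :: "'a::euclidean_space \<Rightarrow> real"
  assumes f: "integrable lborel f" and g: "C1_grad g Dg" and supp: "\<And>x. norm x > T \<Longrightarrow> g x = 0"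
  shows "C1_grad (\<lambda>x. \<integral>y. f y * g (x - y) \<partial>lborel) (\<lambda>x. \<integral>y. f y *\<^sub>R Dg (x - y) \<partial>lborel)"
proof -
  have supp': "norm x > T \<Longrightarrow> Dg x = 0" for x by (rule C1_grad_zero_outside[OF g supp])
  note contg = C1_grad_continuous[OF g, of UNIV] and contDg = C1_grad_continuous_grad[OF g, of UNIV]
  note [measurable] = C1_grad_measurable[OF g]
  note ug = continuous_bounded_support_uniform[OF contg supp]
    and uD = continuous_bounded_support_uniform[OF contDg supp']
  obtain B where B: "\<And>x. norm (g x) \<le> B" using ug(2) by auto
  obtain BD where BD: "\<And>x. norm (Dg x) \<le> BD" using uD(2) by auto
  have i1: "integrable lborel (\<lambda>y. f y * g (x - y))" for x
    using integrable_mult_bounded[where g="\<lambda>y. g (x - y)", OF f borel_measurable_diff_arg B] by simp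
  have i2: "integrable lborel (\<lambda>y. f y *\<^sub>R Dg (x - y))" for x
    using integrable_mult_bounded[where g="\<lambda>y. Dg (x - y)", OF f borel_measurable_diff_arg BD] by simp
  define M where "M = (\<integral>y. \<bar>f y\<bar> \<partial>lborel)"
  have M: "M \<ge> 0" unfolding M_def by (intro integral_nonneg_AE) auto
  have mod: "\<exists>d>0. \<forall>x x'. norm (x' - x) < d \<longrightarrow> norm (Dg x' - Dg x) \<le> \<epsilon> / (M + 1)" if "\<epsilon> > 0" for \<epsilon>
    using uD(1) that M unfolding uniformly_continuous_on_def dist_norm
    by (metis UNIV_I add_nonneg_pos divide_pos_pos less_imp_le zero_less_one)
  have small: "\<epsilon> / (M + 1) * M \<le> \<epsilon>" if "\<epsilon> > 0" for \<epsilon>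
    using that M by (simp add: divide_le_eq mult_left_mono)
  show ?thesis
  proof (rule C1_gradI)
    show "continuous_on UNIV (\<lambda>x. \<integral>y. f y *\<^sub>R Dg (x - y) \<partial>lborel)"
      unfolding continuous_on_iff
    proof (intro ballI allI impI)
      fix x and \<epsilon> :: real assume \<epsilon>: "0 < \<epsilon>"
      obtain d where d: "d > 0" "\<And>x x'. norm (x' - x) < d \<Longrightarrow> norm (Dg x' - Dg x) \<le> (\<epsilon> / 2) / (M + 1)"
        using mod[of "\<epsilon> / 2"] \<epsilon> by auto
      have "dist (\<integral>y. f y *\<^sub>R Dg (x' - y) \<partial>lborel) (\<integral>y. f y *\<^sub>R Dg (x - y) \<partial>lborel) < \<epsilon>"
        if x': "dist x' x < d" for x'
      proof -
        have "(\<integral>y. f y *\<^sub>R Dg (x' - y) \<partial>lborel) - (\<integral>y. f y *\<^sub>R Dg (x - y) \<partial>lborel) =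
            (\<integral>y. f y *\<^sub>R (Dg (x' - y) - Dg (x - y)) \<partial>lborel)"
          using i2 by (simp add: scaleR_diff_right)
        then have "dist (\<integral>y. f y *\<^sub>R Dg (x' - y) \<partial>lborel) (\<integral>y. f y *\<^sub>R Dg (x - y) \<partial>lborel) \<le>
            (\<integral>y. norm (f y *\<^sub>R (Dg (x' - y) - Dg (x - y))) \<partial>lborel)"
          by (simp only: dist_norm) (rule integral_norm_bound)
        also have "\<dots> \<le> (\<integral>y. (\<epsilon> / 2) / (M + 1) * \<bar>f y\<bar> \<partial>lborel)"
        proof (rule integral_mono_AE')
          show "integrable lborel (\<lambda>y. (\<epsilon> / 2) / (M + 1) * \<bar>f y\<bar>)" using f by simp
          show "AE y in lborel. norm (f y *\<^sub>R (Dg (x' - y) - Dg (x - y))) \<le> (\<epsilon> / 2) / (M + 1) * \<bar>f y\<bar>"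
          proof (rule AE_I2)
            fix y
            have "norm (Dg (x' - y) - Dg (x - y)) \<le> (\<epsilon> / 2) / (M + 1)"
              using x' by (intro d(2)) (simp add: dist_norm)
            from mult_right_mono[OF this abs_ge_zero[of "f y"]]
            show "norm (f y *\<^sub>R (Dg (x' - y) - Dg (x - y))) \<le> (\<epsilon> / 2) / (M + 1) * \<bar>f y\<bar>"
              by (simp only: norm_scaleR mult.commute)
          qed
        qed (use M \<epsilon> in auto)
        also have "\<dots> = (\<epsilon> / 2) / (M + 1) * M" unfolding M_def by simp
        also have "\<dots> \<le> \<epsilon> / 2" using small[of "\<epsilon> / 2"] \<epsilon> by simp
        finally show ?thesis using \<epsilon> by simp
      qed
      then show "\<exists>d>0. \<forall>x'\<in>UNIV. dist x' x < d \<longrightarrow>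
          dist (\<integral>y. f y *\<^sub>R Dg (x' - y) \<partial>lborel) (\<integral>y. f y *\<^sub>R Dg (x - y) \<partial>lborel) < \<epsilon>"
        using d(1) by blast
    qed
  next
    fix x :: 'a
    let ?D = "\<integral>y. f y *\<^sub>R Dg (x - y) \<partial>lborel"
    show "((\<lambda>x. \<integral>y. f y * g (x - y) \<partial>lborel) has_derivative (\<lambda>h. ?D \<bullet> h)) (at x)"
      unfolding has_derivative_within_alt
    proof (intro conjI allI impI)
      show "bounded_linear (\<lambda>h. ?D \<bullet> h)" by (rule bounded_linear_inner_right)
      fix \<epsilon> :: real assume \<epsilon>: "0 < \<epsilon>"
      obtain d where d: "d > 0" "\<And>x x'. norm (x' - x) < d \<Longrightarrow> norm (Dg x' - Dg x) \<le> \<epsilon> / (M + 1)"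
        using mod[OF \<epsilon>] by auto
      have "norm ((\<integral>y. f y * g (x' - y) \<partial>lborel) - (\<integral>y. f y * g (x - y) \<partial>lborel) - ?D \<bullet> (x' - x))
          \<le> \<epsilon> * norm (x' - x)" if x': "norm (x' - x) < d" for x'
      proof -
        let ?h = "x' - x"
        have eqI: "?D \<bullet> ?h = (\<integral>y. f y * (Dg (x - y) \<bullet> ?h) \<partial>lborel)"
          using i2[of x] by (subst integral_inner_left[symmetric]) auto
        have i3: "integrable lborel (\<lambda>y. f y * (Dg (x - y) \<bullet> ?h))"
          using integrable_inner_left[OF i2[of x], of ?h] by simp
        have "(\<integral>y. f y * g (x' - y) \<partial>lborel) - (\<integral>y. f y * g (x - y) \<partial>lborel) - ?D \<bullet> ?h =
            (\<integral>y. f y * (g (x' - y) - g (x - y) - Dg (x - y) \<bullet> ?h) \<partial>lborel)"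
          unfolding eqI using i1 i3 by (simp add: right_diff_distrib)
        then have "norm ((\<integral>y. f y * g (x' - y) \<partial>lborel) - (\<integral>y. f y * g (x - y) \<partial>lborel) - ?D \<bullet> ?h) \<le>
            (\<integral>y. norm (f y * (g (x' - y) - g (x - y) - Dg (x - y) \<bullet> ?h)) \<partial>lborel)"
          by (simp only:) (rule integral_norm_bound)
        also have "\<dots> \<le> (\<integral>y. \<epsilon> / (M + 1) * norm ?h * \<bar>f y\<bar> \<partial>lborel)"
        proof (rule integral_mono_AE')
          show "integrable lborel (\<lambda>y. \<epsilon> / (M + 1) * norm ?h * \<bar>f y\<bar>)" using f by simp
          show "AE y in lborel. norm (f y * (g (x' - y) - g (x - y) - Dg (x - y) \<bullet> ?h)) \<le>
              \<epsilon> / (M + 1) * norm ?h * \<bar>f y\<bar>"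
          proof (rule AE_I2)
            fix y
            obtain t where t: "0 \<le> t" "t \<le> 1" "g ((x - y) + ?h) - g (x - y) = Dg ((x - y) + t *\<^sub>R ?h) \<bullet> ?h"
              using C1_grad_MVT[OF g] by metis
            have "g (x' - y) - g (x - y) - Dg (x - y) \<bullet> ?h = (Dg ((x - y) + t *\<^sub>R ?h) - Dg (x - y)) \<bullet> ?h"
              using t(3) by (simp add: inner_diff_left)
            also have "\<bar>\<dots>\<bar> \<le> norm (Dg ((x - y) + t *\<^sub>R ?h) - Dg (x - y)) * norm ?h"
              by (rule Cauchy_Schwarz_ineq2)
            also have "\<dots> \<le> \<epsilon> / (M + 1) * norm ?h"
            proof (intro mult_right_mono d(2))
              have "norm (t *\<^sub>R ?h) \<le> 1 * norm ?h" using t by (simp add: mult_left_le_one_le)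
              then show "norm (x - y + t *\<^sub>R ?h - (x - y)) < d" using x' by simp
            qed simp
            finally have "\<bar>g (x' - y) - g (x - y) - Dg (x - y) \<bullet> ?h\<bar> \<le> \<epsilon> / (M + 1) * norm ?h" .
            from mult_right_mono[OF this abs_ge_zero[of "f y"]]
            show "norm (f y * (g (x' - y) - g (x - y) - Dg (x - y) \<bullet> ?h)) \<le>
              \<epsilon> / (M + 1) * norm ?h * \<bar>f y\<bar>"
              by (simp only: real_norm_def abs_mult mult.commute)
          qed
        qed (use M \<epsilon> in auto)
        also have "\<dots> = (\<epsilon> / (M + 1) * M) * norm ?h" unfolding M_def by simp
        also have "\<dots> \<le> \<epsilon> * norm ?h" using small[OF \<epsilon>] by (intro mult_right_mono) auto
        finally show ?thesis .
      qed
      then show "\<exists>d>0. \<forall>y\<in>UNIV. norm (y - x) < d \<longrightarrow>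
        norm ((\<integral>z. f z * g (y - z) \<partial>lborel) - (\<integral>y. f y * g (x - y) \<partial>lborel) - ?D \<bullet> (y - x)) \<le> \<epsilon> * norm (y - x)"
        using d(1) by blast
    qed
  qed
qed

section \<open>Convolution with a mollifier in L^2\<close>

locale mollifier =
  fixes k :: "'a::euclidean_space \<Rightarrow> real" and Dk :: "'a \<Rightarrow> 'a" and e :: real
  assumes C1: "C1_grad k Dk" and nonneg: "k z \<ge> 0" and supp: "norm z \<ge> e \<Longrightarrow> k z = 0"
    and int_1: "(\<integral>z. k z \<partial>lborel) = 1" and e_pos: "e > 0"
begin

lemma cont: "continuous_on A k" by (rule C1_grad_continuous[OF C1])

lemma meas [measurable]: "k \<in> borel_measurable borel"
  by (rule C1_grad_measurable[OF C1])

lemma supp': "norm z > e \<Longrightarrow> k z = 0" by (simp add: supp)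

lemma bounded: obtains B where "B \<ge> 0" "\<And>z. k z \<le> B"
  using continuous_bounded_support_uniform(2)[OF cont supp'] nonneg
  by (metis abs_of_nonneg real_norm_def)

lemma integrable: "integrable lborel k"
  by (rule integrable_continuous_bounded_support[OF cont supp'])

lemma shift: "integrable lborel (\<lambda>y. k (x - y))" "(\<integral>y. k (x - y) \<partial>lborel) = 1"
proof -
  have d: "distr lborel borel (\<lambda>y. x - y) = (lborel :: 'a measure)"
  proof -
    have "distr (lborel::'a measure) borel ((+) x \<circ> (*\<^sub>R) (- 1)) = distr (distr lborel borel ((*\<^sub>R) (- 1))) borel ((+) x)"
      by (subst distr_distr) auto
    also have "((*\<^sub>R) (- 1)) = (uminus :: 'a \<Rightarrow> 'a)" by auto
    also have "distr (lborel::'a measure) borel uminus = lborel"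
      using lborel_affine[of "-1" "0::'a"] by (simp add: density_1)
    finally show ?thesis by (simp add: lborel_distr_plus o_def)
  qed
  show "integrable lborel (\<lambda>y. k (x - y))"
    using integrable_distr[of "\<lambda>y. x - y" lborel borel k] integrable by (simp only: d) simp
  show "(\<integral>y. k (x - y) \<partial>lborel) = 1"
    using integral_distr[of "\<lambda>y. x - y" lborel borel k] int_1 by (simp only: d) simp
qed

lemma shift': "(\<integral>\<^sup>+x. ennreal (k (x - y)) \<partial>lborel) = 1"
proof -
  have d: "distr (lborel::'a measure) borel (\<lambda>x. x - y) = lborel"
    using lborel_distr_plus[of "- y"] by (simp add: add.commute[of "- y"] cong: distr_cong)
  have "(\<integral>\<^sup>+x. ennreal (k (x - y)) \<partial>lborel) = (\<integral>\<^sup>+x. ennreal (k x) \<partial>distr lborel borel (\<lambda>x. x - y))"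
    by (subst nn_integral_distr) auto
  also have "\<dots> = (\<integral>\<^sup>+x. ennreal (k x) \<partial>lborel)" by (simp only: d)
  also have "\<dots> = 1" using nn_integral_eq_integral[OF integrable] nonneg int_1 by simp
  finally show ?thesis .
qed

definition conv :: "('a \<Rightarrow> real) \<Rightarrow> 'a \<Rightarrow> real" where
  "conv F x = (\<integral>y. F y * k (x - y) \<partial>lborel)"

lemma integrable_conv: "integrable lborel F \<Longrightarrow> integrable lborel (\<lambda>y. F y * k (x - y))"
proof -
  assume F: "integrable lborel F"
  obtain B where "\<And>z. k z \<le> B" using bounded by metis
  then have "\<And>y. norm (k (x - y)) \<le> B" using nonneg by simp
  from integrable_mult_bounded[where g="\<lambda>y. k (x - y)", OF F borel_measurable_diff_arg[OF meas] this]
  show ?thesis by simp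
qed

lemma conv_C1: "integrable lborel F \<Longrightarrow> C1_grad (conv F) (\<lambda>x. \<integral>y. F y *\<^sub>R Dk (x - y) \<partial>lborel)"
  unfolding conv_def[abs_def] by (rule C1_grad_convolution[OF _ C1 supp'])

lemma conv_measurable: "integrable lborel F \<Longrightarrow> conv F \<in> borel_measurable borel"
  using conv_C1 C1_grad_measurable by blast

lemma conv_diff:
  "integrable lborel F \<Longrightarrow> integrable lborel G \<Longrightarrow> conv (\<lambda>y. F y - G y) x = conv F x - conv G x"
  unfolding conv_def by (simp add: left_diff_distrib integrable_conv)

text \<open>Jensen's inequality for the probability density k(x - y) in y, obtained from
  Cauchy-Schwarz by splitting k into two square roots.\<close>

lemma conv_square_le:
  assumes F: "integrable lborel F" "integrable lborel (\<lambda>x. (F x)\<^sup>2)"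
  shows "(conv F x)\<^sup>2 \<le> (\<integral>y. (F y)\<^sup>2 * k (x - y) \<partial>lborel)"
proof -
  have eq: "F y * k (x - y) = (F y * sqrt (k (x - y))) * sqrt (k (x - y))" for y
    using nonneg[of "x - y"] by simp
  have sq: "(F y * sqrt (k (x - y)))\<^sup>2 = (F y)\<^sup>2 * k (x - y)" "(sqrt (k (x - y)))\<^sup>2 = k (x - y)" for y
    using nonneg[of "x - y"] by (simp_all add: power_mult_distrib)
  have "(\<integral>y. (F y * sqrt (k (x - y))) * sqrt (k (x - y)) \<partial>lborel)\<^sup>2 \<le>
      (\<integral>y. (F y * sqrt (k (x - y)))\<^sup>2 \<partial>lborel) * (\<integral>y. (sqrt (k (x - y)))\<^sup>2 \<partial>lborel)"
    by (rule Cauchy_Schwarz_integral)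
      (simp_all only: sq eq[symmetric] shift integrable_conv F)
  then show ?thesis unfolding sq shift eq[symmetric] conv_def by simp
qed

text \<open>Integrate the pointwise bound in x and exchange the integrals; the kernel has integral 1
  in x as well.\<close>

lemma conv_L2:
  assumes F: "integrable lborel F" "integrable lborel (\<lambda>x. (F x)\<^sup>2)"
  shows "integrable lborel (\<lambda>x. (conv F x)\<^sup>2)"
    "(\<integral>x. (conv F x)\<^sup>2 \<partial>lborel) \<le> (\<integral>x. (F x)\<^sup>2 \<partial>lborel)"
proof -
  note [measurable] = conv_measurable[OF F(1)]
  have [measurable]: "F \<in> borel_measurable borel" using F(1) by (auto dest: borel_measurable_integrable)
  have "(\<integral>\<^sup>+x. ennreal ((conv F x)\<^sup>2) \<partial>lborel) \<le>
      (\<integral>\<^sup>+x. \<integral>\<^sup>+y. ennreal ((F y)\<^sup>2) * ennreal (k (x - y)) \<partial>lborel \<partial>lborel)"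
  proof (rule nn_integral_mono)
    fix x
    have "ennreal ((conv F x)\<^sup>2) \<le> ennreal (\<integral>y. (F y)\<^sup>2 * k (x - y) \<partial>lborel)"
      by (rule ennreal_leI[OF conv_square_le[OF F]])
    also have "\<dots> = (\<integral>\<^sup>+y. ennreal ((F y)\<^sup>2 * k (x - y)) \<partial>lborel)"
      using nonneg by (intro nn_integral_eq_integral[symmetric] integrable_conv F) auto
    also have "\<dots> = (\<integral>\<^sup>+y. ennreal ((F y)\<^sup>2) * ennreal (k (x - y)) \<partial>lborel)"
      using nonneg by (simp add: ennreal_mult)
    finally show "ennreal ((conv F x)\<^sup>2) \<le> (\<integral>\<^sup>+y. ennreal ((F y)\<^sup>2) * ennreal (k (x - y)) \<partial>lborel)" .
  qed
  also have "\<dots> = (\<integral>\<^sup>+y. \<integral>\<^sup>+x. ennreal ((F y)\<^sup>2) * ennreal (k (x - y)) \<partial>lborel \<partial>lborel)"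
    by (rule lborel_pair.Fubini') measurable
  also have "\<dots> = (\<integral>\<^sup>+y. ennreal ((F y)\<^sup>2) \<partial>lborel)"
    by (subst nn_integral_cmult) (auto simp: shift')
  also have "\<dots> = ennreal (\<integral>x. (F x)\<^sup>2 \<partial>lborel)"
    by (rule nn_integral_eq_integral) (use F in auto)
  finally have le: "(\<integral>\<^sup>+x. ennreal ((conv F x)\<^sup>2) \<partial>lborel) \<le> ennreal (\<integral>x. (F x)\<^sup>2 \<partial>lborel)" .
  show I: "integrable lborel (\<lambda>x. (conv F x)\<^sup>2)"
    by (rule integrableI_nonneg) (auto intro: le_less_trans[OF le])
  have "ennreal (\<integral>x. (conv F x)\<^sup>2 \<partial>lborel) \<le> ennreal (\<integral>x. (F x)\<^sup>2 \<partial>lborel)"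
    using le by (subst (asm) nn_integral_eq_integral[OF I]) auto
  then show "(\<integral>x. (conv F x)\<^sup>2 \<partial>lborel) \<le> (\<integral>x. (F x)\<^sup>2 \<partial>lborel)"
    by (subst (asm) ennreal_le_iff) (auto intro!: integral_nonneg_AE)
qed

lemma conv_uniform:
  assumes g: "integrable lborel g" and \<omega>: "\<And>y. norm (x - y) < e \<Longrightarrow> \<bar>g y - g x\<bar> \<le> \<omega>"
  shows "\<bar>conv g x - g x\<bar> \<le> \<omega>"
proof -
  have "conv g x - g x = (\<integral>y. g y * k (x - y) \<partial>lborel) - (\<integral>y. g x * k (x - y) \<partial>lborel)"
    using shift by (simp add: conv_def)
  also have "\<dots> = (\<integral>y. g y * k (x - y) - g x * k (x - y) \<partial>lborel)"
    by (rule Bochner_Integration.integral_diff[symmetric])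
      (use integrable_conv[OF g] shift in auto)
  also have "\<bar>\<dots>\<bar> \<le> (\<integral>y. \<bar>g y * k (x - y) - g x * k (x - y)\<bar> \<partial>lborel)"
    using integral_norm_bound[of lborel "\<lambda>y. g y * k (x - y) - g x * k (x - y)"] by simp
  also have "\<dots> \<le> (\<integral>y. \<omega> * k (x - y) \<partial>lborel)"
  proof (rule integral_mono)
    show "integrable lborel (\<lambda>y. \<bar>g y * k (x - y) - g x * k (x - y)\<bar>)"
      using integrable_conv[OF g, of x] shift[of x] by (intro integrable_abs Bochner_Integration.integrable_diff) auto
    show "integrable lborel (\<lambda>y. \<omega> * k (x - y))" using shift by simp
    fix y
    have "\<bar>g y - g x\<bar> * k (x - y) \<le> \<omega> * k (x - y)"
      using \<omega>[of y] nonneg[of "x - y"] supp[of "x - y"] by (cases "norm (x - y) < e") (auto intro: mult_right_mono)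
    moreover have "\<bar>g y * k (x - y) - g x * k (x - y)\<bar> = \<bar>g y - g x\<bar> * k (x - y)"
      unfolding left_diff_distrib[symmetric] abs_mult using nonneg[of "x - y"] by simp
    ultimately show "\<bar>g y * k (x - y) - g x * k (x - y)\<bar> \<le> \<omega> * k (x - y)" by simp
  qed
  also have "\<dots> = \<omega>" using shift by simp
  finally show ?thesis .
qed

end

lemma square_sum3: "(a + b + c)\<^sup>2 \<le> 3 * (a\<^sup>2 + b\<^sup>2 + c\<^sup>2)" for a b c :: real
proof -
  have "0 \<le> (a - b)\<^sup>2 + (b - c)\<^sup>2 + (a - c)\<^sup>2" by simp
  then show ?thesis by (simp add: power2_eq_square algebra_simps)
qed

text \<open>F is first clipped to a bounded function H. A measurable H is a pointwise limit of
  continuous functions off a negligible set; clipping those and multiplying by a cutoff supplies a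
  dominating function. Two errors below \<delta>/4 suffice since (a + b)^2 <= 2 a^2 + 2 b^2.\<close>

lemma L2_dense_continuous:
  fixes F :: "'a::euclidean_space \<Rightarrow> real"
  assumes F: "F \<in> borel_measurable borel" "integrable lborel (\<lambda>x. (F x)\<^sup>2)"
    and supp: "\<And>x. norm x \<ge> r \<Longrightarrow> F x = 0" and \<delta>: "\<delta> > 0"
  obtains g where "continuous_on UNIV g" "\<And>x. norm x > r + 1 \<Longrightarrow> g x = 0"
    "integrable lborel (\<lambda>x. (F x - g x)\<^sup>2)" "(\<integral>x. (F x - g x)\<^sup>2 \<partial>lborel) < \<delta>"
proof -
  note [measurable] = F(1)
  define cl where "cl n t = max (- real n) (min (real n) t)" for n and t :: real
  have cl_abs: "\<bar>cl n t\<bar> \<le> \<bar>t\<bar>" "\<bar>cl n t\<bar> \<le> real n" "\<bar>t - cl n t\<bar> \<le> \<bar>t\<bar>" for n t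
    by (auto simp: cl_def)
  have [measurable]: "cl n \<in> borel_measurable borel" for n unfolding cl_def by measurable
  have cl_cont: "continuous_on A (cl n)" for A n unfolding cl_def by (intro continuous_intros)
  have "(\<lambda>n. \<integral>x. (F x - cl n (F x))\<^sup>2 \<partial>lborel) \<longlonglongrightarrow> (\<integral>x. 0 \<partial>(lborel :: 'a measure))"
  proof (rule integral_dominated_convergence[where w="\<lambda>x. (F x)\<^sup>2"])
    show "AE x in lborel. (\<lambda>n. (F x - cl n (F x))\<^sup>2) \<longlonglongrightarrow> 0"
    proof (rule AE_I2)
      fix x
      obtain n0 where "\<bar>F x\<bar> \<le> real n0" using real_arch_simple by blast
      then have "\<forall>n\<ge>n0. (F x - cl n (F x))\<^sup>2 = 0" by (auto simp: cl_def)
      then show "(\<lambda>n. (F x - cl n (F x))\<^sup>2) \<longlonglongrightarrow> 0"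
        by (intro tendsto_eventually) (auto simp: eventually_sequentially)
    qed
    show "AE x in lborel. norm ((F x - cl n (F x))\<^sup>2) \<le> (F x)\<^sup>2" for n
      using cl_abs(3) by (auto simp: abs_le_square_iff)
  qed (use F in auto)
  then have "\<forall>\<^sub>F n in sequentially. (\<integral>x. (F x - cl n (F x))\<^sup>2 \<partial>lborel) < \<delta> / 4"
    using \<delta> by (intro order_tendstoD) auto
  then obtain n where n: "(\<integral>x. (F x - cl n (F x))\<^sup>2 \<partial>lborel) < \<delta> / 4"
    by (auto simp: eventually_sequentially)
  define H where "H x = cl n (F x)" for x
  have [measurable]: "H \<in> borel_measurable borel" unfolding H_def by measurable
  have "H measurable_on UNIV"
    by (rule lebesgue_measurable_imp_measurable_on) (auto intro: measurable_completion)
  then obtain Nn g where g: "negligible Nn" "\<And>j. continuous_on UNIV (g j)"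
    "\<And>x. x \<notin> Nn \<Longrightarrow> (\<lambda>j. g j x) \<longlonglongrightarrow> H x"
    unfolding measurable_on_def by auto
  \<comment> \<open>Equal to 1 where F may be nonzero and to 0 beyond r + 1, so multiplication
    leaves H unchanged and gives the approximants bounded support.\<close>
  define z where "z x = max 0 (min 1 (r + 1 - norm x))" for x :: 'a
  have zc: "continuous_on UNIV z" unfolding z_def by (intro continuous_intros)
  have z01: "0 \<le> z x" "z x \<le> 1" for x by (auto simp: z_def)
  define h where "h j x = cl n (g j x) * z x" for j x
  have hc: "continuous_on UNIV (h j)" for j
    unfolding h_def by (intro continuous_intros zc continuous_on_compose2[OF cl_cont[of UNIV] g(2)]) auto
  note [measurable] = borel_measurable_continuous_onI[OF hc]
  have h0: "h j x = 0" if "norm x > r + 1" for j x using that by (simp add: h_def z_def)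
  have hb: "\<bar>h j x\<bar> \<le> real n" for j x
    unfolding h_def abs_mult using mult_mono[OF cl_abs(2)[of n "g j x"] z01(2)[of x]] z01[of x] by simp
  have Hz: "H x * z x = H x" for x
    using supp[of x] by (cases "norm x \<ge> r") (auto simp: H_def cl_def z_def)
  have HH: "cl n (H x) = H x" for x by (auto simp: H_def cl_def)
  have H0: "H x = 0" if "norm x \<ge> r" for x using supp[OF that] by (simp add: H_def cl_def)
  have Hh: "(H x - h j x)\<^sup>2 \<le> indicator (cball 0 (r + 1)) x *\<^sub>R (2 * real n)\<^sup>2" for j x
  proof (cases "norm x \<le> r + 1")
    case True
    have "\<bar>H x - h j x\<bar> \<le> 2 * real n" using hb[of j x] cl_abs(2)[of n "F x"] by (simp add: H_def)
    from power_mono[OF this, of 2] True show ?thesis by simp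
  qed (use h0 H0 in auto)
  have AEN: "AE x in lborel. x \<notin> Nn"
    using g(1) unfolding negligible_iff_null_sets using AE_not_in AE_completion by (metis AE_completion_iff)
  have "(\<lambda>j. \<integral>x. (H x - h j x)\<^sup>2 \<partial>lborel) \<longlonglongrightarrow> (\<integral>x. 0 \<partial>(lborel :: 'a measure))"
  proof (rule integral_dominated_convergence[where w="\<lambda>x. indicator (cball 0 (r + 1)) x *\<^sub>R (2 * real n)\<^sup>2"])
    show "AE x in lborel. (\<lambda>j. (H x - h j x)\<^sup>2) \<longlonglongrightarrow> 0"
      using AEN
    proof eventually_elim
      fix x assume "x \<notin> Nn"
      then have "(\<lambda>j. g j x) \<longlonglongrightarrow> H x" by (rule g(3))
      then have "(\<lambda>j. cl n (g j x)) \<longlonglongrightarrow> cl n (H x)" unfolding cl_def by (intro tendsto_intros)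
      then have "(\<lambda>j. h j x) \<longlonglongrightarrow> H x * z x" unfolding h_def HH by (intro tendsto_intros)
      then have "(\<lambda>j. (H x - h j x)\<^sup>2) \<longlonglongrightarrow> (H x - H x)\<^sup>2" unfolding Hz by (intro tendsto_intros)
      then show "(\<lambda>j. (H x - h j x)\<^sup>2) \<longlonglongrightarrow> 0" by simp
    qed
    show "AE x in lborel. norm ((H x - h j x)\<^sup>2) \<le> indicator (cball 0 (r + 1)) x *\<^sub>R (2 * real n)\<^sup>2" for j
      using Hh by (intro AE_I2) simp
    show "integrable lborel (\<lambda>x::'a. indicat_real (cball 0 (r + 1)) x *\<^sub>R (2 * real n)\<^sup>2)"
      by (rule integrable_continuous_on_cball[OF continuous_on_const])
  qed auto
  then have "\<forall>\<^sub>F j in sequentially. (\<integral>x. (H x - h j x)\<^sup>2 \<partial>lborel) < \<delta> / 4"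
    using \<delta> by (intro order_tendstoD) auto
  then obtain j where j: "(\<integral>x. (H x - h j x)\<^sup>2 \<partial>lborel) < \<delta> / 4"
    by (auto simp: eventually_sequentially)
  have i1: "integrable lborel (\<lambda>x. (F x - H x)\<^sup>2)"
    by (rule Bochner_Integration.integrable_bound[OF F(2)])
      (use cl_abs(3) in \<open>auto simp: H_def abs_le_square_iff\<close>)
  have i2: "integrable lborel (\<lambda>x. (H x - h j x)\<^sup>2)"
  proof (rule Bochner_Integration.integrable_bound)
    show "integrable lborel (\<lambda>x::'a. indicat_real (cball 0 (r + 1)) x *\<^sub>R (2 * real n)\<^sup>2)"
      by (rule integrable_continuous_on_cball[OF continuous_on_const])
    show "AE x in lborel. norm ((H x - h j x)\<^sup>2) \<le> norm (indicat_real (cball 0 (r + 1)) x *\<^sub>R (2 * real n)\<^sup>2)"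
      using Hh by (intro AE_I2) simp
  qed measurable
  have le: "(F x - h j x)\<^sup>2 \<le> 2 * (F x - H x)\<^sup>2 + 2 * (H x - h j x)\<^sup>2" for x
  proof -
    have "0 \<le> ((F x - H x) - (H x - h j x))\<^sup>2" by simp
    then show ?thesis by (simp add: power2_eq_square algebra_simps)
  qed
  have i12: "integrable lborel (\<lambda>x. 2 * (F x - H x)\<^sup>2 + 2 * (H x - h j x)\<^sup>2)"
    using i1 i2 by simp
  have i3: "integrable lborel (\<lambda>x. (F x - h j x)\<^sup>2)"
  proof (rule Bochner_Integration.integrable_bound[OF i12])
    show "AE x in lborel. norm ((F x - h j x)\<^sup>2) \<le> norm (2 * (F x - H x)\<^sup>2 + 2 * (H x - h j x)\<^sup>2)"
      using le by (intro AE_I2) simp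
  qed measurable
  have "(\<integral>x. (F x - h j x)\<^sup>2 \<partial>lborel) \<le> (\<integral>x. 2 * (F x - H x)\<^sup>2 + 2 * (H x - h j x)\<^sup>2 \<partial>lborel)"
    by (rule integral_mono[OF i3 i12 le])
  also have "\<dots> = 2 * (\<integral>x. (F x - H x)\<^sup>2 \<partial>lborel) + 2 * (\<integral>x. (H x - h j x)\<^sup>2 \<partial>lborel)"
    using i1 i2 by simp
  also have "\<dots> < \<delta>" using n j unfolding H_def by linarith
  finally show thesis using that[OF hc h0 i3] by blast
qed

text \<open>Replace F by a continuous g. Convolution does not increase the L^2 norm of F - g, and
  for g convergence is uniform with supports in a fixed ball.\<close>

lemma mollifier_L2_convergence:
  fixes F :: "'a::euclidean_space \<Rightarrow> real" and k :: "nat \<Rightarrow> 'a \<Rightarrow> real"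
  assumes F: "integrable lborel F" "integrable lborel (\<lambda>x. (F x)\<^sup>2)"
    and supp: "\<And>x. norm x \<ge> r \<Longrightarrow> F x = 0"
    and k: "\<And>j. mollifier (k j) (Dk j) (e j)" and e: "e \<longlonglongrightarrow> 0"
  shows "\<And>j. integrable lborel (\<lambda>x. (mollifier.conv (k j) F x - F x)\<^sup>2)"
    "(\<lambda>j. \<integral>x. (mollifier.conv (k j) F x - F x)\<^sup>2 \<partial>lborel) \<longlonglongrightarrow> 0"
proof -
  let ?c = "\<lambda>j. mollifier.conv (k j)"
  have [measurable]: "F \<in> borel_measurable borel" using F(1) by (auto dest: borel_measurable_integrable)
  have sq2: "(a - b)\<^sup>2 \<le> 2 * a\<^sup>2 + 2 * b\<^sup>2" for a b :: real
  proof -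
    have "0 \<le> (a + b)\<^sup>2" by simp
    then show ?thesis by (simp add: power2_eq_square algebra_simps)
  qed
  show iF: "integrable lborel (\<lambda>x. (?c j F x - F x)\<^sup>2)" for j
  proof (rule Bochner_Integration.integrable_bound)
    show "integrable lborel (\<lambda>x. 2 * (?c j F x)\<^sup>2 + 2 * (F x)\<^sup>2)"
      using F mollifier.conv_L2(1)[OF k F] by simp
    show "AE x in lborel. norm ((?c j F x - F x)\<^sup>2) \<le> norm (2 * (?c j F x)\<^sup>2 + 2 * (F x)\<^sup>2)"
      using sq2 by auto
  qed (use mollifier.conv_measurable[OF k F(1)] in measurable)
  show "(\<lambda>j. \<integral>x. (?c j F x - F x)\<^sup>2 \<partial>lborel) \<longlonglongrightarrow> 0"
  proof (rule LIMSEQ_I)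
    fix \<epsilon> :: real assume \<epsilon>: "0 < \<epsilon>"
    \<comment> \<open>Three squared errors, each at most \<delta>, with the factor 3 of
      \<open>square_sum3\<close> add up to at most 9 \<delta> < \<epsilon>.\<close>
    define \<delta> where "\<delta> = \<epsilon> / 12"
    have "\<delta> > 0" using \<epsilon> by (simp add: \<delta>_def)
    then obtain g where g: "continuous_on UNIV g" "\<And>x. norm x > r + 1 \<Longrightarrow> g x = 0"
      "integrable lborel (\<lambda>x. (F x - g x)\<^sup>2)" "(\<integral>x. (F x - g x)\<^sup>2 \<partial>lborel) < \<delta>"
      using L2_dense_continuous[OF \<open>F \<in> borel_measurable borel\<close> F(2) supp] by auto
    have gi: "integrable lborel g" by (rule integrable_continuous_bounded_support[OF g(1,2)])
    have gi2: "integrable lborel (\<lambda>x. F x - g x)" using F gi by simp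
    define V where "V = measure lborel (cball (0::'a) (r + 2))"
    have V: "V \<ge> 0" by (simp add: V_def)
    \<comment> \<open>A uniform error \<omega> on the ball of radius r + 2, of volume V, contributes
      V \<omega>^2 <= \<delta>.\<close>
    define \<omega> where "\<omega> = sqrt (\<delta> / (V + 1))"
    have \<omega>: "\<omega> > 0" using \<open>\<delta> > 0\<close> V by (simp add: \<omega>_def)
    have ug: "uniformly_continuous_on UNIV g" by (rule continuous_bounded_support_uniform[OF g(1,2)])
    then obtain d where d: "d > 0" "\<And>x y. dist y x < d \<Longrightarrow> dist (g y) (g x) < \<omega>"
      using \<omega> unfolding uniformly_continuous_on_def by (metis UNIV_I)
    have "\<forall>\<^sub>F j in sequentially. e j < min d 1" using e d(1) by (intro order_tendstoD) auto
    then obtain j0 where j0: "\<And>j. j \<ge> j0 \<Longrightarrow> e j < min d 1" by (auto simp: eventually_sequentially)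
    have "norm ((\<integral>x. (?c j F x - F x)\<^sup>2 \<partial>lborel) - 0) < \<epsilon>" if j: "j \<ge> j0" for j
    proof -
      interpret m: mollifier "k j" "Dk j" "e j" by (rule k)
      have ej: "e j < d" "e j < 1" using j0[OF j] by auto
      have unif: "\<bar>m.conv g x - g x\<bar> \<le> \<omega>" for x
      proof (rule m.conv_uniform[OF gi])
        fix y assume "norm (x - y) < e j"
        then have "dist y x < d" using ej by (simp add: dist_norm norm_minus_commute)
        from d(2)[OF this] show "\<bar>g y - g x\<bar> \<le> \<omega>" by (simp add: dist_real_def)
      qed
      have unif0: "\<bar>m.conv g x - g x\<bar> \<le> 0" if x: "norm x > r + 2" for x
      proof (rule m.conv_uniform[OF gi])
        fix y assume "norm (x - y) < e j"
        then have "norm y > r + 1" using x ej norm_triangle_sub[of x y] by linarith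
        then show "\<bar>g y - g x\<bar> \<le> 0" using g(2)[of y] g(2)[of x] x by simp
      qed
      have sqb: "(m.conv g x - g x)\<^sup>2 \<le> indicator (cball 0 (r + 2)) x *\<^sub>R \<omega>\<^sup>2" for x
        using power_mono[OF unif[of x], of 2] unif0[of x] by (cases "norm x > r + 2") auto
      have ind: "integrable lborel (\<lambda>x::'a. indicat_real (cball 0 (r + 2)) x *\<^sub>R \<omega>\<^sup>2)"
        by (rule integrable_continuous_on_cball[OF continuous_on_const])
      have i2: "integrable lborel (\<lambda>x. (m.conv g x - g x)\<^sup>2)"
        by (rule Bochner_Integration.integrable_bound[OF ind])
          (use sqb m.conv_measurable[OF gi] borel_measurable_continuous_onI[OF g(1)] in auto)
      have "(\<integral>x. (m.conv g x - g x)\<^sup>2 \<partial>lborel) \<le> (\<integral>x. indicat_real (cball 0 (r + 2)) x *\<^sub>R \<omega>\<^sup>2 \<partial>(lborel::'a measure))"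
        by (rule integral_mono[OF i2 ind sqb])
      also have "\<dots> = V * \<omega>\<^sup>2" by (simp add: V_def)
      also have "\<dots> \<le> \<delta>" using V \<open>\<delta> > 0\<close> by (simp add: \<omega>_def divide_le_eq mult_left_mono)
      finally have 2: "(\<integral>x. (m.conv g x - g x)\<^sup>2 \<partial>lborel) \<le> \<delta>" .
      note i1 = m.conv_L2[OF gi2 g(3)]
      have i3: "integrable lborel (\<lambda>x. (g x - F x)\<^sup>2)" using g(3) by (simp add: power2_commute)
      have pw: "(m.conv F x - F x)\<^sup>2 \<le> 3 * ((m.conv (\<lambda>x. F x - g x) x)\<^sup>2 + (m.conv g x - g x)\<^sup>2 + (g x - F x)\<^sup>2)" for x
        using square_sum3[of "m.conv F x - m.conv g x" "m.conv g x - g x" "g x - F x"]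
        by (simp add: m.conv_diff[OF F(1) gi])
      have "(\<integral>x. (m.conv F x - F x)\<^sup>2 \<partial>lborel) \<le>
         (\<integral>x. 3 * ((m.conv (\<lambda>x. F x - g x) x)\<^sup>2 + (m.conv g x - g x)\<^sup>2 + (g x - F x)\<^sup>2) \<partial>lborel)"
        by (rule integral_mono[OF iF _ pw]) (use i1 i2 i3 in simp)
      also have "\<dots> = 3 * ((\<integral>x. (m.conv (\<lambda>x. F x - g x) x)\<^sup>2 \<partial>lborel) + (\<integral>x. (m.conv g x - g x)\<^sup>2 \<partial>lborel)
          + (\<integral>x. (g x - F x)\<^sup>2 \<partial>lborel))"
        using i1 i2 i3 by simp
      also have "(\<integral>x. (g x - F x)\<^sup>2 \<partial>lborel) = (\<integral>x. (F x - g x)\<^sup>2 \<partial>lborel)"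
        by (simp add: power2_commute)
      finally have "(\<integral>x. (m.conv F x - F x)\<^sup>2 \<partial>lborel) \<le> 9 * \<delta>" using i1(2) 2 g(4) by fastforce
      moreover have "(\<integral>x. (m.conv F x - F x)\<^sup>2 \<partial>lborel) \<ge> 0" by (intro integral_nonneg_AE) auto
      ultimately show ?thesis using \<epsilon> by (simp add: \<delta>_def)
    qed
    then show "\<exists>no. \<forall>n\<ge>no. norm ((\<integral>x. (?c n F x - F x)\<^sup>2 \<partial>lborel) - 0) < \<epsilon>" by blast
  qed
qed

section \<open>The spectral gap of the ball\<close>

lemma integral_wball_le:
  fixes f :: "'a::euclidean_space \<Rightarrow> real"
  assumes f: "integrable lborel f" "\<And>x. f x \<ge> 0"
  shows "integrable (wball r) f" "(\<integral>x. f x \<partial>wball r) \<le> (\<integral>x. f x \<partial>lborel)"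
proof -
  have [measurable]: "f \<in> borel_measurable borel" using f(1) by (auto dest: borel_measurable_integrable)
  have w: "indicator (ball 0 r) x * gw x \<le> 1" "0 \<le> indicator (ball 0 r) x * gw x" for x :: 'a
    using gw_le_1[of x] gw_pos[of x] by (auto simp: indicator_def)
  have le: "indicator (ball 0 r) x * gw x * f x \<le> f x" for x
    using mult_right_mono[OF w(1) f(2)] by simp
  have i: "integrable lborel (\<lambda>x. indicator (ball 0 r) x * gw x * f x)"
    by (rule Bochner_Integration.integrable_bound[OF f(1)])
      (use le w f(2) in \<open>auto simp: abs_of_nonneg gw_pos less_imp_le abs_mult\<close>)
  then show "integrable (wball r) f"
    unfolding wball_def by (subst integrable_density) (auto simp: w)
  show "(\<integral>x. f x \<partial>wball r) \<le> (\<integral>x. f x \<partial>lborel)"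
    unfolding integral_wball[OF \<open>f \<in> borel_measurable borel\<close>]
    by (rule integral_mono[OF i f(1) le])
qed

lemma wball_indicator:
  fixes f :: "'a::euclidean_space \<Rightarrow> real"
  assumes [measurable]: "f \<in> borel_measurable borel" and "s \<le> r"
  shows "(\<integral>x. f x \<partial>wball s) = (\<integral>x. indicator (ball 0 s) x * f x \<partial>wball r)"
proof -
  have [measurable]: "ball (0::'a) s \<in> sets borel" by simp
  show ?thesis using assms(2)
    by (subst (1 2) integral_wball)
      (auto intro!: Bochner_Integration.integral_cong simp: indicator_def)
qed

text \<open>The functions and the radii vary together, since mollified functions are only used on
  slightly smaller balls. Everything is compared on the ball of radius r with the indicators of the
  smaller balls.\<close>

lemma wball_L2_limits:
  fixes F :: "'a::euclidean_space \<Rightarrow> real"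
  assumes F: "F \<in> borel_measurable borel" "integrable lborel (\<lambda>x. (F x)\<^sup>2)"
    and Fj: "\<And>j. Fj j \<in> borel_measurable borel" "\<And>j. integrable lborel (\<lambda>x. (Fj j x - F x)\<^sup>2)"
    and lim: "(\<lambda>j. \<integral>x. (Fj j x - F x)\<^sup>2 \<partial>lborel) \<longlonglongrightarrow> 0"
    and s: "\<And>j. s j \<le> r" "s \<longlonglongrightarrow> r"
  shows "(\<lambda>j. \<integral>x. (Fj j x)\<^sup>2 \<partial>wball (s j)) \<longlonglongrightarrow> (\<integral>x. (F x)\<^sup>2 \<partial>wball r)"
    and "(\<lambda>j. \<integral>x. Fj j x \<partial>wball (s j)) \<longlonglongrightarrow> (\<integral>x. F x \<partial>wball r)"
proof -
  note [measurable] = F(1) Fj(1)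
  let ?M = "wball r :: 'a measure"
  let ?i = "\<lambda>j. indicat_real (ball (0::'a) (s j))"
  have [measurable]: "ball (0::'a) t \<in> sets borel" for t by simp
  define A where "A j = (\<integral>x. (Fj j x - F x)\<^sup>2 \<partial>?M)" for j
  define a where "a = (\<integral>x. (F x)\<^sup>2 \<partial>?M)"
  define c where "c = (\<integral>x. (1::real) \<partial>?M)"
  have iA: "integrable ?M (\<lambda>x. (Fj j x - F x)\<^sup>2)" "A j \<le> (\<integral>x. (Fj j x - F x)\<^sup>2 \<partial>lborel)" for j
    unfolding A_def by (rule integral_wball_le[OF Fj(2)]; simp)+
  have ia: "integrable ?M (\<lambda>x. (F x)\<^sup>2)" by (rule integral_wball_le[OF F(2)]) simp
  have A0: "A j \<ge> 0" for j unfolding A_def by (intro integral_nonneg_AE) auto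
  have Alim: "A \<longlonglongrightarrow> 0"
    by (rule tendsto_sandwich[OF _ _ tendsto_const lim]) (use A0 iA(2) in auto)
  have prod_int: "integrable ?M (\<lambda>x. f x * g x)"
    if [measurable]: "f \<in> borel_measurable borel" "g \<in> borel_measurable borel"
      and fg: "integrable ?M (\<lambda>x. (f x)\<^sup>2)" "integrable ?M (\<lambda>x. (g x)\<^sup>2)" for f g :: "'a \<Rightarrow> real"
  proof (rule Bochner_Integration.integrable_bound)
    show "integrable ?M (\<lambda>x. (f x)\<^sup>2 + (g x)\<^sup>2)" using fg by simp
    show "AE x in ?M. norm (f x * g x) \<le> norm ((f x)\<^sup>2 + (g x)\<^sup>2)"
    proof (rule AE_I2)
      fix x
      have "0 \<le> (\<bar>f x\<bar> - \<bar>g x\<bar>)\<^sup>2" "0 \<le> (f x)\<^sup>2" "0 \<le> (g x)\<^sup>2" by auto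
      then have "\<bar>f x\<bar> * \<bar>g x\<bar> \<le> (f x)\<^sup>2 + (g x)\<^sup>2"
        unfolding power2_diff power2_abs by linarith
      then show "norm (f x * g x) \<le> norm ((f x)\<^sup>2 + (g x)\<^sup>2)" by (simp add: abs_mult)
    qed
  qed simp
  have c1: "integrable ?M (\<lambda>x. (1::real)\<^sup>2)" by (intro integrable_wball_continuous continuous_intros)
  have i1: "integrable ?M (\<lambda>x. \<bar>F x\<bar> * \<bar>Fj j x - F x\<bar>)" for j
    by (rule prod_int) (use ia iA in auto)
  have i2: "integrable ?M (\<lambda>x. 1 * \<bar>Fj j x - F x\<bar>)" for j
    by (rule prod_int) (use c1 iA in auto)
  have i3: "integrable ?M (\<lambda>x. 1 * F x)"
    by (rule prod_int) (use c1 ia in auto)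
  have CS1: "(\<integral>x. \<bar>F x\<bar> * \<bar>Fj j x - F x\<bar> \<partial>?M) \<le> sqrt (a * A j)" for j
    using Cauchy_Schwarz_integral[of ?M "\<lambda>x. \<bar>F x\<bar>" "\<lambda>x. \<bar>Fj j x - F x\<bar>"] ia iA i1[of j]
    by (intro real_le_rsqrt) (simp add: a_def A_def)
  have CS2: "(\<integral>x. 1 * \<bar>Fj j x - F x\<bar> \<partial>?M) \<le> sqrt (c * A j)" for j
    using Cauchy_Schwarz_integral[of ?M "\<lambda>x. 1" "\<lambda>x. \<bar>Fj j x - F x\<bar>"] c1 iA i2[of j]
    by (intro real_le_rsqrt) (simp add: c_def A_def)
  have ind_lim: "(\<lambda>j. ?i j x) \<longlonglongrightarrow> 1" if "norm x < r" for x
  proof (rule tendsto_eventually)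
    have "\<forall>\<^sub>F j in sequentially. norm x < s j" using s(2) that by (rule order_tendstoD)
    then show "\<forall>\<^sub>F j in sequentially. ?i j x = 1" by eventually_elim simp
  qed
  have base: "(\<lambda>j. \<integral>x. ?i j x * f x \<partial>?M) \<longlonglongrightarrow> (\<integral>x. f x \<partial>?M)"
    if f [measurable]: "f \<in> borel_measurable borel" "integrable ?M f" for f
  proof (rule integral_dominated_convergence[where w="\<lambda>x. \<bar>f x\<bar>"])
    show "AE x in ?M. (\<lambda>j. ?i j x * f x) \<longlonglongrightarrow> f x"
      using AE_wball[of r]
    proof eventually_elim
      fix x :: 'a assume "norm x < r"
      from tendsto_mult[OF ind_lim[OF this] tendsto_const, of "f x"]
      show "(\<lambda>j. ?i j x * f x) \<longlonglongrightarrow> f x" by simp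
    qed
    show "integrable ?M (\<lambda>x. \<bar>f x\<bar>)" using f(2) by simp
  qed (auto simp: indicator_def abs_mult)
  show "(\<lambda>j. \<integral>x. (Fj j x)\<^sup>2 \<partial>wball (s j)) \<longlonglongrightarrow> (\<integral>x. (F x)\<^sup>2 \<partial>wball r)"
  proof (rule Lim_transform2[OF base])
    show "(\<lambda>x. (F x)\<^sup>2) \<in> borel_measurable borel" by measurable
    show "integrable ?M (\<lambda>x. (F x)\<^sup>2)" by (rule ia)
    show "(\<lambda>j. (\<integral>x. ?i j x * (F x)\<^sup>2 \<partial>?M) - (\<integral>x. (Fj j x)\<^sup>2 \<partial>wball (s j))) \<longlonglongrightarrow> 0"
    \<comment> \<open>From Fj^2 - F^2 = (Fj - F)^2 + 2 F (Fj - F), with Cauchy-Schwarz for the mixed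
      term.\<close>
    proof (rule Lim_null_comparison[where g="\<lambda>j. A j + 2 * sqrt (a * A j)", OF always_eventually[OF allI]])
      fix j
      have e: "(Fj j x)\<^sup>2 = (F x)\<^sup>2 + ((Fj j x - F x)\<^sup>2 + 2 * (F x * (Fj j x - F x)))" for x
        by (simp add: power2_eq_square algebra_simps)
      have i4: "integrable ?M (\<lambda>x. F x * (Fj j x - F x))"
        by (rule prod_int) (use ia iA in auto)
      have iF: "integrable ?M (\<lambda>x. (Fj j x)\<^sup>2)"
        unfolding e using ia iA i4 by simp
      have ind_int: "integrable ?M (\<lambda>x. ?i j x * f x)" if "integrable ?M f" for f
        by (rule Bochner_Integration.integrable_bound[OF that]) (use that in \<open>auto simp: indicator_def\<close>)
      have "(\<integral>x. ?i j x * (F x)\<^sup>2 \<partial>?M) - (\<integral>x. (Fj j x)\<^sup>2 \<partial>wball (s j)) =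
          (\<integral>x. ?i j x * (F x)\<^sup>2 - ?i j x * (Fj j x)\<^sup>2 \<partial>?M)"
        using ind_int[OF ia] ind_int[OF iF] wball_indicator[of "\<lambda>x. (Fj j x)\<^sup>2", OF _ s(1)] by simp
      also have "norm \<dots> \<le> (\<integral>x. norm (?i j x * (F x)\<^sup>2 - ?i j x * (Fj j x)\<^sup>2) \<partial>?M)"
        by (rule integral_norm_bound)
      also have "\<dots> \<le> (\<integral>x. (Fj j x - F x)\<^sup>2 + 2 * (\<bar>F x\<bar> * \<bar>Fj j x - F x\<bar>) \<partial>?M)"
      proof (rule integral_mono)
        show "integrable ?M (\<lambda>x. norm (?i j x * (F x)\<^sup>2 - ?i j x * (Fj j x)\<^sup>2))"
          using ind_int[OF ia] ind_int[OF iF] by simp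
        show "integrable ?M (\<lambda>x. (Fj j x - F x)\<^sup>2 + 2 * (\<bar>F x\<bar> * \<bar>Fj j x - F x\<bar>))"
          using iA i1 by simp
        fix x
        have "norm (?i j x * (F x)\<^sup>2 - ?i j x * (Fj j x)\<^sup>2) \<le> \<bar>(Fj j x - F x)\<^sup>2 + 2 * (F x * (Fj j x - F x))\<bar>"
        proof -
          have "?i j x * (F x)\<^sup>2 - ?i j x * (Fj j x)\<^sup>2 =
              - (?i j x * ((Fj j x - F x)\<^sup>2 + 2 * (F x * (Fj j x - F x))))"
            unfolding e[of x] by argo
          then show ?thesis by (auto simp: abs_mult indicator_def)
        qed
        also have "\<dots> \<le> (Fj j x - F x)\<^sup>2 + 2 * (\<bar>F x\<bar> * \<bar>Fj j x - F x\<bar>)"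
          using abs_triangle_ineq[of "(Fj j x - F x)\<^sup>2" "2 * (F x * (Fj j x - F x))"] by (simp add: abs_mult)
        finally show "norm (?i j x * (F x)\<^sup>2 - ?i j x * (Fj j x)\<^sup>2) \<le> (Fj j x - F x)\<^sup>2 + 2 * (\<bar>F x\<bar> * \<bar>Fj j x - F x\<bar>)" .
      qed
      also have "\<dots> = A j + 2 * (\<integral>x. \<bar>F x\<bar> * \<bar>Fj j x - F x\<bar> \<partial>?M)"
        using iA(1) i1 by (simp add: A_def)
      also have "\<dots> \<le> A j + 2 * sqrt (a * A j)" using CS1[of j] by simp
      finally show "norm ((\<integral>x. ?i j x * (F x)\<^sup>2 \<partial>?M) - (\<integral>x. (Fj j x)\<^sup>2 \<partial>wball (s j))) \<le> A j + 2 * sqrt (a * A j)" .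
    next
      have "(\<lambda>j. A j + 2 * sqrt (a * A j)) \<longlonglongrightarrow> 0 + 2 * sqrt (a * 0)"
        by (intro tendsto_intros Alim)
      then show "(\<lambda>j. A j + 2 * sqrt (a * A j)) \<longlonglongrightarrow> 0" by simp
    qed
  qed
  show "(\<lambda>j. \<integral>x. Fj j x \<partial>wball (s j)) \<longlonglongrightarrow> (\<integral>x. F x \<partial>wball r)"
  proof (rule Lim_transform2[OF base])
    show "F \<in> borel_measurable borel" by (rule F)
    show "integrable ?M F" using i3 by simp
    show "(\<lambda>j. (\<integral>x. ?i j x * F x \<partial>?M) - (\<integral>x. Fj j x \<partial>wball (s j))) \<longlonglongrightarrow> 0"
    proof (rule Lim_null_comparison[where g="\<lambda>j. sqrt (c * A j)", OF always_eventually[OF allI]])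
      fix j
      have iD: "integrable ?M (\<lambda>x. Fj j x - F x)"
        by (rule Bochner_Integration.integrable_bound[OF i2[of j]]) auto
      have iF: "integrable ?M (Fj j)" using Bochner_Integration.integrable_add[OF iD, of F] i3 by simp
      have ind_int: "integrable ?M (\<lambda>x. ?i j x * f x)" if "integrable ?M f" for f
        by (rule Bochner_Integration.integrable_bound[OF that]) (use that in \<open>auto simp: indicator_def\<close>)
      have "(\<integral>x. ?i j x * F x \<partial>?M) - (\<integral>x. Fj j x \<partial>wball (s j)) =
          (\<integral>x. ?i j x * F x - ?i j x * Fj j x \<partial>?M)"
        using ind_int[of F] ind_int[OF iF] i3 wball_indicator[of "Fj j", OF _ s(1)] by simp
      also have "norm \<dots> \<le> (\<integral>x. norm (?i j x * F x - ?i j x * Fj j x) \<partial>?M)"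
        by (rule integral_norm_bound)
      also have "\<dots> \<le> (\<integral>x. 1 * \<bar>Fj j x - F x\<bar> \<partial>?M)"
      proof (rule integral_mono[OF _ i2])
        show "integrable ?M (\<lambda>x. norm (?i j x * F x - ?i j x * Fj j x))"
          using ind_int[of F] ind_int[OF iF] i3 by simp
      qed (auto simp: indicator_def)
      also have "\<dots> \<le> sqrt (c * A j)" by (rule CS2)
      finally show "norm ((\<integral>x. ?i j x * F x \<partial>?M) - (\<integral>x. Fj j x \<partial>wball (s j))) \<le> sqrt (c * A j)" .
    next
      have "(\<lambda>j. sqrt (c * A j)) \<longlonglongrightarrow> sqrt (c * 0)" by (intro tendsto_intros Alim)
      then show "(\<lambda>j. sqrt (c * A j)) \<longlonglongrightarrow> 0" by simp
    qed
  qed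
qed

section \<open>Normalised mollifiers and weak gradients\<close>

lemma integral_bump_pos: "e > 0 \<Longrightarrow> (\<integral>z. bump e z \<partial>(lborel :: 'a::euclidean_space measure)) > 0"
proof -
  assume e: "e > 0"
  have i: "integrable lborel (bump e :: 'a \<Rightarrow> real)"
    by (rule integrable_continuous_bounded_support[OF C1_grad_continuous[OF C1_grad_bump], of e])
      (auto intro: bump_outside e)
  have "(\<integral>z. bump e z \<partial>(lborel :: 'a measure)) \<noteq> 0"
  proof
    assume "(\<integral>z. bump e z \<partial>(lborel :: 'a measure)) = 0"
    then have "AE z in (lborel :: 'a measure). bump e z = 0"
      using integral_nonneg_eq_0_iff_AE[OF i] bump_nonneg by auto
    then have "AE z in (lborel :: 'a measure). z \<notin> ball 0 e"
      by eventually_elim (use bump_pos_iff[OF e] in auto)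
    then have "ball (0::'a) e \<in> null_sets lborel" by (subst AE_iff_null_sets) auto
    then have "measure lborel (ball (0::'a) e) = 0" by (simp add: null_setsD1 measure_def)
    then show False using content_ball_pos[OF e, of "0::'a"] by simp
  qed
  moreover have "(\<integral>z. bump e z \<partial>(lborel :: 'a measure)) \<ge> 0"
    by (intro integral_nonneg_AE) (auto simp: bump_nonneg)
  ultimately show ?thesis by simp
qed

definition eta :: "real \<Rightarrow> 'a::euclidean_space \<Rightarrow> real" where
  "eta e z = (1 / (\<integral>z. bump e z \<partial>(lborel :: 'a measure))) * bump e z"

definition eta' :: "real \<Rightarrow> 'a::euclidean_space \<Rightarrow> 'a" where
  "eta' e z = (1 / (\<integral>z. bump e z \<partial>(lborel :: 'a measure))) *\<^sub>R bump' e z"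

lemma mollifier_eta: "e > 0 \<Longrightarrow> mollifier (eta e) (eta' e) e"
proof
  assume e: "e > 0"
  show "C1_grad (eta e :: 'a \<Rightarrow> real) (eta' e)"
    using C1_grad_cmult[OF C1_grad_bump] unfolding eta_def[abs_def] eta'_def[abs_def] .
  show "0 \<le> eta e z" for z :: 'a
    unfolding eta_def by (intro mult_nonneg_nonneg bump_nonneg) (use integral_bump_pos[OF e, where 'a='a] in simp)
  show "norm z \<ge> e \<Longrightarrow> eta e z = 0" for z :: 'a by (simp add: eta_def bump_outside e)
  show "(\<integral>z. eta e z \<partial>(lborel :: 'a measure)) = 1"
    unfolding eta_def using integral_bump_pos[OF e, where 'a='a] by simp
qed

text \<open>Local integrability yields measurability on compact subsets only; the open ball is
  exhausted by closed ones.\<close>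

lemma locally_integrable_ball_measurable:
  fixes f :: "'a::euclidean_space \<Rightarrow> 'b::euclidean_space"
  assumes "locally_integrable (ball 0 r) f"
  shows "(\<lambda>x. indicator (ball 0 r) x *\<^sub>R f x) \<in> borel_measurable borel"
proof (rule borel_measurable_LIMSEQ_metric)
  fix j
  have "set_integrable lborel (cball 0 (r - 1 / (real j + 1))) f"
    using assms unfolding locally_integrable_def by (simp add: cball_subset_ball_iff)
  then show "(\<lambda>x. indicator (cball 0 (r - 1 / (real j + 1))) x *\<^sub>R f x) \<in> borel_measurable borel"
    unfolding set_integrable_def by (auto dest: borel_measurable_integrable)
next
  fix x :: 'a
  have lim: "(\<lambda>j. r - 1 / (real j + 1)) \<longlonglongrightarrow> r" by real_asymp
  show "(\<lambda>j. indicat_real (cball 0 (r - 1 / (real j + 1))) x *\<^sub>R f x) \<longlonglongrightarrow> indicat_real (ball 0 r) x *\<^sub>R f x"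
  proof (rule tendsto_eventually, cases "norm x < r")
    case True
    have "\<forall>\<^sub>F j in sequentially. norm x < r - 1 / (real j + 1)" using lim True by (rule order_tendstoD)
    then show "\<forall>\<^sub>F j in sequentially. indicat_real (cball 0 (r - 1 / (real j + 1))) x *\<^sub>R f x =
        indicat_real (ball 0 r) x *\<^sub>R f x"
      by eventually_elim (use True in auto)
  next
    case False
    have "r - 1 / (real j + 1) < r" for j by simp
    then have "\<not> norm x \<le> r - 1 / (real j + 1)" for j using False by (meson le_less_trans)
    then show "\<forall>\<^sub>F j in sequentially. indicat_real (cball 0 (r - 1 / (real j + 1))) x *\<^sub>R f x =
        indicat_real (ball 0 r) x *\<^sub>R f x"
      using False by auto
  qed
qed

text \<open>Mollification commutes with the weak gradient at points farther than e from the
  complement of the domain, where the shifted bump is an admissible test function.\<close>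

lemma weak_gradient_conv:
  fixes v :: "'a::euclidean_space \<Rightarrow> real"
  assumes w: "has_weak_gradient \<Omega> v Dv" and e: "e > 0" and sub: "cball x e \<subseteq> \<Omega>"
    and F: "integrable lborel (\<lambda>y. indicator \<Omega> y * v y)" and b: "b \<in> Basis"
  shows "(\<integral>y. (indicator \<Omega> y * v y) *\<^sub>R eta' e (x - y) \<partial>lborel) \<bullet> b =
    mollifier.conv (eta e) (\<lambda>y. indicator \<Omega> y * (Dv y \<bullet> b)) x"
proof -
  interpret mollifier "eta e :: 'a \<Rightarrow> real" "eta' e" e by (rule mollifier_eta[OF e])
  let ?Z = "1 / (\<integral>z. bump e z \<partial>(lborel :: 'a measure))"
  note t = test_function_bump[OF e sub]
  have "(LINT y:\<Omega>|lborel. v y * frechet_derivative (\<lambda>y. bump e (x - y)) (at y) b) =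
      - (LINT y:\<Omega>|lborel. (Dv y \<bullet> b) * bump e (x - y))"
    using w t(1) b unfolding has_weak_gradient_def by blast
  then have eq: "(\<integral>y. indicator \<Omega> y * v y * (bump' e (x - y) \<bullet> b) \<partial>lborel) =
      (\<integral>y. indicator \<Omega> y * (Dv y \<bullet> b) * bump e (x - y) \<partial>lborel)"
    unfolding t(2) set_lebesgue_integral_def by (simp add: mult.assoc)
  have D: "continuous_on UNIV (eta' e :: 'a \<Rightarrow> 'a)" by (rule C1_grad_continuous_grad[OF C1])
  have D0: "norm z > e \<Longrightarrow> eta' e z = 0" for z :: 'a by (rule C1_grad_zero_outside[OF C1 supp'])
  obtain B where "\<And>z::'a. norm (eta' e z) \<le> B" using continuous_bounded_support_uniform(2)[OF D D0] by auto
  then have "integrable lborel (\<lambda>y. (indicator \<Omega> y * v y) *\<^sub>R eta' e (x - y))"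
    by (intro integrable_mult_bounded[OF F] borel_measurable_diff_arg borel_measurable_continuous_onI[OF D]) auto
  then have "(\<integral>y. (indicator \<Omega> y * v y) *\<^sub>R eta' e (x - y) \<partial>lborel) \<bullet> b =
      (\<integral>y. (indicator \<Omega> y * v y) * (eta' e (x - y) \<bullet> b) \<partial>lborel)"
    by (subst integral_inner_left[symmetric]) auto
  also have "\<dots> = ?Z * (\<integral>y. indicator \<Omega> y * v y * (bump' e (x - y) \<bullet> b) \<partial>lborel)"
    unfolding eta'_def by (subst integral_mult_right_zero[symmetric]) (simp add: mult_ac)
  also have "\<dots> = ?Z * (\<integral>y. indicator \<Omega> y * (Dv y \<bullet> b) * bump e (x - y) \<partial>lborel)"
    unfolding eq ..
  also have "\<dots> = conv (\<lambda>y. indicator \<Omega> y * (Dv y \<bullet> b)) x"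
    unfolding conv_def eta_def by (subst integral_mult_right_zero[symmetric]) (simp add: mult_ac)
  finally show ?thesis .
qed

context neumann_profile
begin

text \<open>The variance form. Mollifying and shrinking the ball destroys the condition of mean
  zero, so the approximations need an inequality that tolerates a mean.\<close>

lemma poincare_C1:
  fixes v :: "'a::euclidean_space \<Rightarrow> real"
  assumes N: "N = real DIM('a)" and v: "C1_grad v Dv" and r: "r > 0" "r\<^sup>2 / 2 \<le> S"
  shows "\<mu> * ((\<integral>x. (v x)\<^sup>2 \<partial>wball r) - (\<integral>x. v x \<partial>wball r)\<^sup>2 / (\<integral>x. (1::real) \<partial>(wball r :: 'a measure)))
    \<le> (\<integral>x. (norm (Dv x))\<^sup>2 \<partial>wball r)"
proof -
  define M where "M = (\<integral>x. (1::real) \<partial>(wball r :: 'a measure))"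
  define a where "a = (\<integral>x. v x \<partial>wball r)"
  have Mm: "measure (wball r) (UNIV :: 'a set) = M" by (simp add: M_def)
  have M: "M > 0"
  proof -
    have i: "integrable (wball r) (\<lambda>x::'a. exp ((norm x)\<^sup>2 / 2))" "integrable (wball r) (\<lambda>x::'a. exp (r\<^sup>2 / 2))"
      by (intro integrable_wball_continuous continuous_intros; simp)+
    have "0 < (\<integral>x. exp ((norm x)\<^sup>2 / 2) \<partial>(wball r :: 'a measure))" by (rule integral_exp_wball_pos[OF r(1)])
    also have "\<dots> \<le> (\<integral>x. exp (r\<^sup>2 / 2) \<partial>(wball r :: 'a measure))"
    proof (rule integral_mono_AE[OF i])
      show "AE x in (wball r :: 'a measure). exp ((norm x)\<^sup>2 / 2) \<le> exp (r\<^sup>2 / 2)"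
        using AE_wball[of r] by eventually_elim (use half_norm_le in \<open>auto intro: less_imp_le\<close>)
    qed
    also have "\<dots> = exp (r\<^sup>2 / 2) * M"
      unfolding M_def by (subst integral_mult_right_zero[symmetric]) simp
    finally show ?thesis by (simp add: zero_less_mult_iff)
  qed
  note cv = C1_grad_continuous[OF v, of UNIV]
  have i: "integrable (wball r) v" "integrable (wball r) (\<lambda>x. (v x)\<^sup>2)" "integrable (wball r) (\<lambda>x::'a. c::real)" for c
    by (intro integrable_wball_continuous continuous_intros cv)+
  have cM: "(\<integral>x. c \<partial>(wball r :: 'a measure)) = c * M" for c :: real
    unfolding M_def by (subst integral_mult_right_zero[symmetric]) simp
  have d: "C1_grad (\<lambda>x. v x - a / M) (\<lambda>x. Dv x - 0)" by (intro C1_grad_diff v C1_grad_const)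
  have "(\<integral>x. v x - a / M \<partial>wball r) = 0"
    using M by (simp add: i Mm a_def[symmetric])
  from poincare_C1_mean_zero[OF N d r this]
  have "\<mu> * (\<integral>x. (v x - a / M)\<^sup>2 \<partial>wball r) \<le> (\<integral>x. (norm (Dv x))\<^sup>2 \<partial>wball r)"
    by (simp add: deficit_def)
  also have "(\<integral>x. (v x - a / M)\<^sup>2 \<partial>wball r) = (\<integral>x. (v x)\<^sup>2 - (2 * a / M) * v x + (a / M)\<^sup>2 \<partial>wball r)"
    by (intro Bochner_Integration.integral_cong) (auto simp: power2_diff algebra_simps)
  also have "\<dots> = (\<integral>x. (v x)\<^sup>2 \<partial>wball r) - (2 * a / M) * a + (a / M)\<^sup>2 * M"
    using i by (simp add: Mm a_def)
  also have "\<dots> = (\<integral>x. (v x)\<^sup>2 \<partial>wball r) - a\<^sup>2 / M"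
    using M by (simp add: power2_eq_square field_simps)
  finally show ?thesis unfolding M_def a_def .
qed

text \<open>The C^1 inequality is applied to the mollified function on balls of radius R_j < r,
  where its gradient is the mollified weak gradient, always with the same \<mu>. Then R_j tends to
  r.\<close>

lemma poincare_H1:
  fixes v :: "'a::euclidean_space \<Rightarrow> real"
  assumes N: "N = real DIM('a)" and w: "has_weak_gradient (ball 0 r) v Dv" and r: "r > 0" "r\<^sup>2 / 2 \<le> S"
    and v2: "set_integrable lborel (ball 0 r) (\<lambda>x. (v x)\<^sup>2)"
    and Dv2: "set_integrable lborel (ball 0 r) (\<lambda>x. (norm (Dv x))\<^sup>2)"
  defines "F \<equiv> (\<lambda>x. indicator (ball 0 r) x * v x)"
    and "G \<equiv> (\<lambda>x. indicator (ball 0 r) x *\<^sub>R Dv x)"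
  assumes mean: "(\<integral>x. F x \<partial>wball r) = 0"
  shows "\<mu> * (\<integral>x. (F x)\<^sup>2 \<partial>wball r) \<le> (\<integral>x. (norm (G x))\<^sup>2 \<partial>wball r)"
proof -
  define R where "R j = r - r / (real j + 2)" for j :: nat
  \<comment> \<open>The scale is smaller than r - R_j = r / (j + 2), so a ball of radius e_j about a
    point of norm below R_j stays inside the domain.\<close>
  define e where "e j = r / (real j + 3)" for j :: nat
  have R: "R j > 0" "R j < r" for j
  proof -
    have "r / (real j + 2) \<le> r / 2" using r(1) by (intro divide_left_mono) auto
    then show "R j > 0" using r(1) unfolding R_def by linarith
    show "R j < r" using r(1) unfolding R_def by simp
  qed
  have e: "e j > 0" "R j + e j < r" for j
  proof -
    have "r / (real j + 3) < r / (real j + 2)" using r(1) by (intro divide_strict_left_mono) auto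
    then show "R j + e j < r" by (simp add: R_def e_def)
    show "e j > 0" using r(1) by (simp add: e_def)
  qed
  have ind2: "(indicat_real A x)\<^sup>2 = indicat_real A x" for A and x :: 'a by (simp add: indicator_def)
  have Rlim: "R \<longlonglongrightarrow> r" unfolding R_def using r(1) by real_asymp
  have elim: "e \<longlonglongrightarrow> 0" unfolding e_def using r(1) by real_asymp
  have li: "locally_integrable (ball 0 r) v" "locally_integrable (ball 0 r) Dv"
    using w by (auto simp: has_weak_gradient_def)
  have F_meas [measurable]: "F \<in> borel_measurable borel"
    using locally_integrable_ball_measurable[OF li(1)] by (simp add: F_def)
  have G_meas [measurable]: "G \<in> borel_measurable borel"
    using locally_integrable_ball_measurable[OF li(2)] by (simp add: G_def)
  have F2: "integrable lborel (\<lambda>x. (F x)\<^sup>2)"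
    using v2 unfolding set_integrable_def F_def by (simp add: power_mult_distrib ind2)
  have normG2: "integrable lborel (\<lambda>x. (norm (G x))\<^sup>2)"
    using Dv2 unfolding set_integrable_def G_def by (simp add: power_mult_distrib ind2)
  \<comment> \<open>Square integrability implies integrability on a bounded set through |f| <= 1 +
    f^2.\<close>
  have L1: "integrable lborel f"
    if [measurable]: "f \<in> borel_measurable borel" and f: "integrable lborel (\<lambda>x. (f x)\<^sup>2)"
      "\<And>x. norm x \<ge> r \<Longrightarrow> f x = 0" for f :: "'a \<Rightarrow> real"
  proof (rule Bochner_Integration.integrable_bound)
    have "integrable lborel (\<lambda>x::'a. indicat_real (cball 0 r) x *\<^sub>R (1::real))"
      by (rule integrable_continuous_on_cball[OF continuous_on_const])
    then show "integrable lborel (\<lambda>x. indicat_real (cball 0 r) x + (f x)\<^sup>2)" using f(1) by simp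
    show "AE x in lborel. norm (f x) \<le> norm (indicat_real (cball 0 r) x + (f x)\<^sup>2)"
    proof (rule AE_I2)
      fix x
      have "0 \<le> (\<bar>f x\<bar> - 1)\<^sup>2" by simp
      then have "\<bar>f x\<bar> \<le> 1 + (f x)\<^sup>2" unfolding power2_diff by simp
      then show "norm (f x) \<le> norm (indicat_real (cball 0 r) x + (f x)\<^sup>2)"
        using f(2)[of x] by (cases "norm x \<le> r") auto
    qed
  qed simp
  have F0: "F x = 0" if "norm x \<ge> r" for x using that by (simp add: F_def)
  have F1: "integrable lborel F" by (rule L1[OF F_meas F2 F0])
  define Gb where "Gb b x = G x \<bullet> b" for b x
  have Gb_eq: "Gb b = (\<lambda>y. indicator (ball 0 r) y * (Dv y \<bullet> b))" for b
    by (auto simp: Gb_def G_def)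
  have Gb_meas [measurable]: "Gb b \<in> borel_measurable borel" for b unfolding Gb_def by measurable
  have Gb2: "integrable lborel (\<lambda>x. (Gb b x)\<^sup>2)" if "b \<in> Basis" for b
  proof (rule Bochner_Integration.integrable_bound[OF normG2])
    show "AE x in lborel. norm ((Gb b x)\<^sup>2) \<le> norm ((norm (G x))\<^sup>2)"
    proof (rule AE_I2)
      fix x
      have "\<bar>G x \<bullet> b\<bar> \<le> norm (G x)" by (rule Basis_le_norm[OF that])
      from power_mono[OF this, of 2] show "norm ((Gb b x)\<^sup>2) \<le> norm ((norm (G x))\<^sup>2)" by (simp add: Gb_def)
    qed
  qed simp
  have Gb0: "Gb b x = 0" if "norm x \<ge> r" for b x using that by (simp add: Gb_def G_def)
  have Gb1: "integrable lborel (Gb b)" if "b \<in> Basis" for b by (rule L1[OF Gb_meas Gb2[OF that] Gb0])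
  note mol = mollifier_eta[OF e(1)]
  let ?c = "\<lambda>j. mollifier.conv (eta (e j))"
  define DV where "DV j x = (\<integral>y. F y *\<^sub>R eta' (e j) (x - y) \<partial>lborel)" for j x
  have C1V: "C1_grad (?c j F) (DV j)" for j
    unfolding DV_def[abs_def] by (rule mollifier.conv_C1[OF mol F1])
  have DVb: "DV j x \<bullet> b = ?c j (Gb b) x" if "norm x < R j" "b \<in> Basis" for j x b
  proof -
    have "cball x (e j) \<subseteq> ball 0 r"
    proof
      fix y assume "y \<in> cball x (e j)"
      then have "norm y \<le> norm x + e j"
        using norm_triangle_sub[of y x] by (simp add: dist_norm norm_minus_commute)
      then show "y \<in> ball 0 r" using that(1) e(2)[of j] by simp
    qed
    from weak_gradient_conv[OF w e(1) this _ that(2)] show ?thesis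
      using F1 unfolding DV_def Gb_eq F_def by blast
  qed
  have grad: "(\<integral>x. (norm (DV j x))\<^sup>2 \<partial>wball (R j)) = (\<Sum>b\<in>Basis. \<integral>x. (?c j (Gb b) x)\<^sup>2 \<partial>wball (R j))" for j
  proof -
    have ic: "integrable (wball (R j)) (\<lambda>x. (?c j (Gb b) x)\<^sup>2)" if "b \<in> Basis" for b
      by (intro integrable_wball_continuous continuous_intros
          C1_grad_continuous[OF mollifier.conv_C1[OF mol Gb1[OF that]]])
    have "(\<integral>x. (norm (DV j x))\<^sup>2 \<partial>wball (R j)) = (\<integral>x. (\<Sum>b\<in>Basis. (?c j (Gb b) x)\<^sup>2) \<partial>wball (R j))"
    proof (rule integral_cong_AE)
      show "(\<lambda>x. (norm (DV j x))\<^sup>2) \<in> borel_measurable (wball (R j))"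
        using C1_grad_measurable(2)[OF C1V[of j]] by measurable
      show "(\<lambda>x. \<Sum>b\<in>Basis. (?c j (Gb b) x)\<^sup>2) \<in> borel_measurable (wball (R j))"
        using ic by (intro borel_measurable_sum borel_measurable_integrable)
      show "AE x in wball (R j). (norm (DV j x))\<^sup>2 = (\<Sum>b\<in>Basis. (?c j (Gb b) x)\<^sup>2)"
        using AE_wball[of "R j"]
      proof eventually_elim
        fix x :: 'a assume x: "norm x < R j"
        have "(norm (DV j x))\<^sup>2 = (\<Sum>b\<in>Basis. (DV j x \<bullet> b) * (DV j x \<bullet> b))"
          unfolding power2_norm_eq_inner by (rule euclidean_inner)
        also have "\<dots> = (\<Sum>b\<in>Basis. (?c j (Gb b) x)\<^sup>2)"
          by (intro sum.cong refl) (simp add: DVb[OF x] power2_eq_square)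
        finally show "(norm (DV j x))\<^sup>2 = (\<Sum>b\<in>Basis. (?c j (Gb b) x)\<^sup>2)" .
      qed
    qed
    also have "\<dots> = (\<Sum>b\<in>Basis. \<integral>x. (?c j (Gb b) x)\<^sup>2 \<partial>wball (R j))"
      by (rule Bochner_Integration.integral_sum[OF ic])
    finally show ?thesis .
  qed
  have Rle: "R j \<le> r" for j using R(2)[of j] by simp
  have limits: "(\<lambda>j. \<integral>x. (?c j f x)\<^sup>2 \<partial>wball (R j)) \<longlonglongrightarrow> (\<integral>x. (f x)\<^sup>2 \<partial>wball r)"
    "(\<lambda>j. \<integral>x. ?c j f x \<partial>wball (R j)) \<longlonglongrightarrow> (\<integral>x. f x \<partial>wball r)"
    if f: "f \<in> borel_measurable borel" "integrable lborel f" "integrable lborel (\<lambda>x. (f x)\<^sup>2)"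
      "\<And>x. norm x \<ge> r \<Longrightarrow> f x = 0" for f
    using wball_L2_limits[OF f(1,3) mollifier.conv_measurable[OF mol f(2)]
          mollifier_L2_convergence[OF f(2,3,4) mol elim] Rle Rlim] by auto
  have one_lim: "(\<lambda>j. \<integral>x. 1 \<partial>(wball (R j) :: 'a measure)) \<longlonglongrightarrow> (\<integral>x. (1::real) \<partial>(wball r :: 'a measure))"
  proof -
    have eq: "(\<integral>x. (1::real) \<partial>(wball s :: 'a measure)) = (\<integral>x. indicat_real (cball 0 r) x \<partial>(wball s :: 'a measure))"
      if "s \<le> r" for s
    proof (rule integral_cong_AE)
      show "AE x in (wball s :: 'a measure). 1 = indicat_real (cball 0 r) x"
        using AE_wball[of s] by eventually_elim (use that in auto)
      have [measurable]: "cball (0::'a) r \<in> sets borel" by simp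
      show "indicat_real (cball 0 r) \<in> borel_measurable (wball s :: 'a measure)" by measurable
    qed simp
    have "integrable lborel (\<lambda>x::'a. indicat_real (cball 0 r) x *\<^sub>R (1::real))"
      by (rule integrable_continuous_on_cball[OF continuous_on_const])
    then have "integrable lborel (\<lambda>x::'a. (indicat_real (cball 0 r) x)\<^sup>2)"
      by (simp add: ind2)
    then have "(\<lambda>j. \<integral>x. indicat_real (cball 0 r) x \<partial>(wball (R j) :: 'a measure)) \<longlonglongrightarrow>
        (\<integral>x. indicat_real (cball 0 r) x \<partial>(wball r :: 'a measure))"
      using Rle Rlim by (intro wball_L2_limits(2)) (auto intro!: borel_measurable_indicator)
    then show ?thesis unfolding eq[OF Rle] eq[OF order_refl] .
  qed
  have M: "(\<integral>x. (1::real) \<partial>(wball r :: 'a measure)) \<noteq> 0"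
  proof
    assume "(\<integral>x. (1::real) \<partial>(wball r :: 'a measure)) = 0"
    then have "(\<integral>x. (1::real) \<partial>(wball r :: 'a measure)) \<le> 0" by linarith
    from wball_nonneg_integral_zero[OF continuous_on_const _ this, of 0] show False using r by simp
  qed
  have lim_lhs: "(\<lambda>j. \<mu> * ((\<integral>x. (?c j F x)\<^sup>2 \<partial>wball (R j)) - (\<integral>x. ?c j F x \<partial>wball (R j))\<^sup>2 /
      (\<integral>x. (1::real) \<partial>(wball (R j) :: 'a measure)))) \<longlonglongrightarrow>
      \<mu> * ((\<integral>x. (F x)\<^sup>2 \<partial>wball r) - (\<integral>x. F x \<partial>wball r)\<^sup>2 / (\<integral>x. (1::real) \<partial>(wball r :: 'a measure)))"
    by (intro tendsto_intros limits[OF F_meas F1 F2 F0] one_lim M)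
  have lim_rhs: "(\<lambda>j. \<Sum>b\<in>Basis. \<integral>x. (?c j (Gb b) x)\<^sup>2 \<partial>wball (R j)) \<longlonglongrightarrow>
      (\<Sum>b\<in>Basis. \<integral>x. (Gb b x)\<^sup>2 \<partial>wball r)"
    by (intro tendsto_sum limits(1) Gb_meas Gb1 Gb2 Gb0)
  have le: "\<mu> * ((\<integral>x. (?c j F x)\<^sup>2 \<partial>wball (R j)) - (\<integral>x. ?c j F x \<partial>wball (R j))\<^sup>2 /
      (\<integral>x. (1::real) \<partial>(wball (R j) :: 'a measure))) \<le> (\<Sum>b\<in>Basis. \<integral>x. (?c j (Gb b) x)\<^sup>2 \<partial>wball (R j))" for j
  proof -
    have "(R j)\<^sup>2 / 2 \<le> S" using power_mono[OF Rle[of j], of 2] R(1)[of j] r(2) by simp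
    from poincare_C1[OF N C1V[of j] R(1) this] show ?thesis unfolding grad .
  qed
  have "\<mu> * ((\<integral>x. (F x)\<^sup>2 \<partial>wball r) - (\<integral>x. F x \<partial>wball r)\<^sup>2 / (\<integral>x. (1::real) \<partial>(wball r :: 'a measure))) \<le>
      (\<Sum>b\<in>Basis. \<integral>x. (Gb b x)\<^sup>2 \<partial>wball r)"
    by (rule LIMSEQ_le[OF lim_lhs lim_rhs]) (use le in blast)
  also have "\<dots> = (\<integral>x. (\<Sum>b\<in>Basis. (Gb b x)\<^sup>2) \<partial>wball r)"
    by (rule Bochner_Integration.integral_sum[symmetric]) (rule integral_wball_le(1)[OF Gb2]; simp)
  also have "\<dots> = (\<integral>x. (norm (G x))\<^sup>2 \<partial>wball r)"
    unfolding power2_norm_eq_inner euclidean_inner[of "G _" "G _"] Gb_def by (simp add: power2_eq_square)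
  finally show "\<mu> * (\<integral>x. (F x)\<^sup>2 \<partial>wball r) \<le> (\<integral>x. (norm (G x))\<^sup>2 \<partial>wball r)"
    using mean by simp
qed

end

section \<open>Gaussian measure and Lipschitz domains\<close>

lemma open_null_empty:
  fixes U :: "'a::euclidean_space set"
  assumes "open U" "AE x in lborel. x \<notin> U"
  shows "U = {}"
proof -
  have "U \<in> null_sets lborel" using assms by (subst AE_iff_null_sets) auto
  then have "negligible U"
    using null_sets_completionI negligible_iff_null_sets by blast
  then show ?thesis using open_not_negligible[OF assms(1)] by blast
qed

section \<open>The Gaussian measure compared with Lebesgue measure\<close>

lemma gauss_density_pos: "gauss_density x > 0"
  by (simp add: gauss_density_def)

lemma gauss_density_eq:
  "gauss_density (x::'a::euclidean_space) = (2 * pi) powr (- real DIM('a) / 2) * gw x"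
  by (simp add: gauss_density_def gw_def)

lemma borel_measurable_gauss_density [measurable]: "gauss_density \<in> borel_measurable borel"
  unfolding gauss_density_eq[abs_def] by measurable

lemma sets_gauss [simp, measurable_cong]: "sets gauss = sets borel"
  and space_gauss [simp]: "space gauss = UNIV"
  by (auto simp: gauss_def)

lemma AE_gauss_iff: "(AE x in gauss. P x) \<longleftrightarrow> (AE x in lborel. P x)"
  unfolding gauss_def by (subst AE_density) (auto simp: gauss_density_pos)

text \<open>The density is a product over the coordinates, so finiteness reduces to the
  one-dimensional normal density.\<close>

lemma finite_measure_gauss: "finite_measure (gauss :: 'a::euclidean_space measure)"
proof
  have I: "(\<integral>\<^sup>+t. ennreal (exp (- (t\<^sup>2) / 2)) \<partial>(lborel :: real measure)) < \<infinity>"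
  proof -
    have "integrable lborel (\<lambda>t::real. sqrt (2 * pi) * std_normal_density t)"
      by (intro integrable_mult_right integrable_normal_density) auto
    moreover have "sqrt (2 * pi) * std_normal_density t = exp (- (t\<^sup>2) / 2)" for t
      by (simp add: normal_density_def)
    ultimately have "integrable lborel (\<lambda>t::real. exp (- (t\<^sup>2) / 2))" by simp
    then show ?thesis by (simp add: integrable_iff_bounded less_top)
  qed
  have "gw x = (\<Prod>b\<in>Basis. exp (- ((x \<bullet> b)\<^sup>2) / 2))" for x :: 'a
  proof -
    have "(norm x)\<^sup>2 = (\<Sum>b\<in>Basis. (x \<bullet> b)\<^sup>2)"
      unfolding power2_norm_eq_inner euclidean_inner[of x x] by (simp add: power2_eq_square)
    then have "gw x = exp (\<Sum>b\<in>Basis. - ((x \<bullet> b)\<^sup>2) / 2)"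
      by (simp add: gw_def sum_negf sum_divide_distrib)
    then show ?thesis by (simp add: exp_sum)
  qed
  then have "(\<integral>\<^sup>+x. ennreal (gw x) \<partial>(lborel :: 'a measure)) =
      (\<integral>\<^sup>+x. (\<Prod>b\<in>Basis. ennreal (exp (- ((x \<bullet> b)\<^sup>2) / 2))) \<partial>(lborel :: 'a measure))"
    by (simp add: prod_ennreal)
  also have "\<dots> = (\<Prod>b\<in>(Basis::'a set). (\<integral>\<^sup>+t. ennreal (exp (- (t\<^sup>2) / 2)) \<partial>lborel))"
    by (rule nn_integral_lborel_prod) auto
  also have "\<dots> < \<infinity>" using I by (simp add: power_less_top_ennreal)
  finally have gw: "(\<integral>\<^sup>+x. ennreal (gw x) \<partial>(lborel :: 'a measure)) < \<infinity>" .
  have "emeasure (gauss :: 'a measure) (space gauss) = (\<integral>\<^sup>+x. ennreal (gauss_density x) \<partial>(lborel :: 'a measure))"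
    unfolding gauss_def by (subst emeasure_density) auto
  also have "\<dots> = ennreal ((2 * pi) powr (- real DIM('a) / 2)) * (\<integral>\<^sup>+x. ennreal (gw x) \<partial>(lborel :: 'a measure))"
    unfolding gauss_density_eq by (subst nn_integral_cmult[symmetric]) (auto simp: ennreal_mult gw_pos less_imp_le)
  also have "\<dots> < \<infinity>" using gw by (simp add: ennreal_mult_less_top)
  finally show "emeasure (gauss :: 'a measure) (space gauss) \<noteq> \<infinity>" by simp
qed

interpretation gauss: finite_measure gauss by (rule finite_measure_gauss)

lemma integral_gauss_wball:
  fixes h :: "'a::euclidean_space \<Rightarrow> real"
  assumes [measurable]: "h \<in> borel_measurable borel" and "\<And>x. norm x \<ge> r \<Longrightarrow> h x = 0"
  shows "(\<integral>x. h x \<partial>gauss) = (2 * pi) powr (- real DIM('a) / 2) * (\<integral>x. h x \<partial>wball r)"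
proof -
  have "(\<integral>x. h x \<partial>gauss) = (\<integral>x. gauss_density x * h x \<partial>lborel)"
    unfolding gauss_def by (subst integral_density) (auto simp: gauss_density_pos less_imp_le)
  also have "\<dots> = (2 * pi) powr (- real DIM('a) / 2) * (\<integral>x. gw x * h x \<partial>lborel)"
    unfolding gauss_density_eq by (subst integral_mult_right_zero[symmetric]) (simp add: mult.assoc)
  also have "(\<integral>x. gw x * h x \<partial>lborel) = (\<integral>x. h x \<partial>wball r)"
    by (rule integral_lborel_eq_wball[OF assms])
  finally show ?thesis .
qed

lemma set_integrable_gauss_bounded:
  fixes f :: "'a::euclidean_space \<Rightarrow> 'b::euclidean_space"
  assumes [measurable]: "f \<in> borel_measurable borel" "A \<in> sets borel" and "\<And>x. norm (f x) \<le> C"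
  shows "set_integrable gauss A f"
  unfolding set_integrable_def
proof (rule gauss.integrable_const_bound)
  have "norm (f x) \<le> max C 0" for x using assms(3)[of x] by simp
  then show "AE x in gauss. norm (indicat_real A x *\<^sub>R f x) \<le> max C 0"
    by (intro AE_I2) (auto simp: indicator_def)
qed measurable

text \<open>On a ball the Gaussian density is bounded below, so a function in the weighted space can
  be mollified in unweighted L^2.\<close>

lemma set_integrable_lborel_of_gauss:
  fixes f :: "'a::euclidean_space \<Rightarrow> real"
  assumes "set_integrable gauss (ball 0 r) f" "\<And>x. f x \<ge> 0"
  shows "set_integrable lborel (ball 0 r) f"
proof -
  define h where "h x = indicator (ball 0 r) x *\<^sub>R f x" for x
  define C where "C = 1 / ((2 * pi) powr (- real DIM('a) / 2) * exp (- (r\<^sup>2 / 2)))"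
  have i: "integrable gauss h" using assms(1) by (simp add: set_integrable_def h_def[abs_def])
  then have [measurable]: "h \<in> borel_measurable borel" by (auto dest: borel_measurable_integrable)
  have i2: "integrable lborel (\<lambda>x. gauss_density x * h x)"
    using i unfolding gauss_def by (subst (asm) integrable_density) (auto simp: gauss_density_pos less_imp_le)
  have "integrable lborel h"
  proof (rule Bochner_Integration.integrable_bound[OF integrable_mult_right[OF i2, of C]])
    show "AE x in lborel. norm (h x) \<le> norm (C * (gauss_density x * h x))"
    proof (rule AE_I2)
      fix x :: 'a
      show "norm (h x) \<le> norm (C * (gauss_density x * h x))"
      proof (cases "norm x < r")
        case True
        have "exp (- (r\<^sup>2 / 2)) \<le> gw x" using half_norm_le[of x r] True by (simp add: gw_def)
        then have "1 \<le> C * gauss_density x"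
          by (simp add: C_def gauss_density_eq divide_simps)
        then have "1 * \<bar>h x\<bar> \<le> C * gauss_density x * \<bar>h x\<bar>" by (intro mult_right_mono) auto
        then show ?thesis using gauss_density_pos[of x] by (simp add: C_def abs_mult)
      qed (simp add: h_def)
    qed
  qed simp
  then show ?thesis by (simp add: set_integrable_def h_def[abs_def])
qed

lemma test_function_C1_grad:
  fixes \<phi> :: "'a::euclidean_space \<Rightarrow> real"
  assumes "test_function \<Omega> \<phi>"
  obtains D where "C1_grad \<phi> D" "\<And>x h. frechet_derivative \<phi> (at x) h = D x \<bullet> h"
proof -
  have "continuously_differentiable (Suc 0) \<phi>" using assms by (simp add: test_function_def)
  then have d: "\<And>x. \<phi> differentiable (at x)"
    and c: "\<And>i. i \<in> Basis \<Longrightarrow> continuous_on UNIV (\<lambda>x. frechet_derivative \<phi> (at x) i)" by auto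
  define D where "D x = (\<Sum>b\<in>Basis. frechet_derivative \<phi> (at x) b *\<^sub>R b)" for x
  have fd: "frechet_derivative \<phi> (at x) h = D x \<bullet> h" for x h
  proof -
    have lin: "linear (frechet_derivative \<phi> (at x))" by (rule linear_frechet_derivative[OF d])
    have "frechet_derivative \<phi> (at x) h = frechet_derivative \<phi> (at x) (\<Sum>b\<in>Basis. (h \<bullet> b) *\<^sub>R b)"
      by (simp add: euclidean_representation)
    also have "\<dots> = (\<Sum>b\<in>Basis. (h \<bullet> b) * frechet_derivative \<phi> (at x) b)"
      by (simp add: linear_sum[OF lin] linear_scale[OF lin])
    finally show ?thesis by (simp add: D_def inner_sum_right inner_commute[of _ h] mult.commute)
  qed
  have "C1_grad \<phi> D"
  proof (rule C1_gradI)
    show "(\<phi> has_derivative (\<lambda>h. D x \<bullet> h)) (at x)" for x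
    proof -
      have "frechet_derivative \<phi> (at x) = (\<lambda>h. D x \<bullet> h)" using fd by auto
      then show ?thesis using d[of x] unfolding frechet_derivative_works by simp
    qed
    show "continuous_on UNIV D" unfolding D_def by (intro continuous_intros c)
  qed
  then show thesis using that fd by blast
qed

lemma C1_has_weak_gradient:
  fixes u :: "'a::euclidean_space \<Rightarrow> real"
  assumes u: "C1_grad u Du"
  shows "has_weak_gradient \<Omega> u Du"
  unfolding has_weak_gradient_def
proof (intro conjI allI impI ballI)
  show "locally_integrable \<Omega> u" "locally_integrable \<Omega> Du"
    unfolding locally_integrable_def set_integrable_def
    by (intro allI impI borel_integrable_compact C1_grad_continuous[OF u] C1_grad_continuous_grad[OF u];
        simp)+
  fix \<phi> and i :: 'a assume t: "test_function \<Omega> \<phi>" and i: "i \<in> Basis"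
  obtain D where D: "C1_grad \<phi> D" "\<And>x h. frechet_derivative \<phi> (at x) h = D x \<bullet> h"
    using test_function_C1_grad[OF t] by metis
  let ?K = "closure {x. \<phi> x \<noteq> 0}"
  have K: "compact ?K" "?K \<subseteq> \<Omega>" using t by (auto simp: test_function_def)
  have out: "\<phi> x = 0" "D x = 0" if "x \<notin> ?K" for x
  proof -
    have z: "\<phi> y = 0" if "y \<in> - ?K" for y using that closure_subset[of "{x. \<phi> x \<noteq> 0}"] by blast
    have x: "x \<in> - ?K" using that by simp
    show "\<phi> x = 0" by (rule z[OF x])
    show "D x = 0"
      by (rule C1_grad_zero_on_open[OF D(1) open_Compl[OF closed_closure] z x])
  qed
  obtain T where T: "\<And>x. x \<in> ?K \<Longrightarrow> norm x \<le> T"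
    using compact_imp_bounded[OF K(1)] by (auto simp: bounded_iff)
  have outT: "\<phi> x = 0" "D x = 0" if "norm x > T" for x using out[of x] T[of x] that by auto
  note cu = C1_grad_continuous[OF u] C1_grad_continuous_grad[OF u] C1_grad_continuous[OF D(1)]
    C1_grad_continuous_grad[OF D(1)]
  have i1: "integrable lborel (\<lambda>x. u x * (D x \<bullet> i))"
    by (rule integrable_continuous_bounded_support[of _ T]) (auto intro!: continuous_intros cu simp: outT)
  have i2: "integrable lborel (\<lambda>x. (Du x \<bullet> i) * \<phi> x)"
    by (rule integrable_continuous_bounded_support[of _ T]) (auto intro!: continuous_intros cu simp: outT)
  have "(\<integral>x. (u x *\<^sub>R D x + \<phi> x *\<^sub>R Du x) \<bullet> i \<partial>lborel) = 0"
    by (rule C1_grad_integral_zero(2)[OF C1_grad_mult[OF u D(1)], of T]) (simp add: outT)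
  then have "(\<integral>x. u x * (D x \<bullet> i) \<partial>lborel) + (\<integral>x. (Du x \<bullet> i) * \<phi> x \<partial>lborel) = 0"
    using i1 i2 by (simp add: inner_add_left mult.commute)
  moreover have e: "indicator \<Omega> x *\<^sub>R (u x * (D x \<bullet> i)) = u x * (D x \<bullet> i)"
    "indicator \<Omega> x *\<^sub>R ((Du x \<bullet> i) * \<phi> x) = (Du x \<bullet> i) * \<phi> x" for x
  proof -
    have "x \<notin> \<Omega> \<Longrightarrow> x \<notin> ?K" using K(2) by blast
    then show "indicator \<Omega> x *\<^sub>R (u x * (D x \<bullet> i)) = u x * (D x \<bullet> i)"
      "indicator \<Omega> x *\<^sub>R ((Du x \<bullet> i) * \<phi> x) = (Du x \<bullet> i) * \<phi> x"
      using out[of x] by (cases "x \<in> \<Omega>"; simp)+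
  qed
  ultimately show "(LINT x:\<Omega>|lborel. u x * frechet_derivative \<phi> (at x) i) =
      - (LINT x:\<Omega>|lborel. (Du x \<bullet> i) * \<phi> x)"
    unfolding set_lebesgue_integral_def D(2) e by linarith
qed

text \<open>A set which agrees with the ball up to a null set can differ from it only by missing
  boundary points inside the ball; a Lipschitz boundary excludes such points.\<close>

lemma lipschitz_ae_ball_eq:
  fixes \<Omega> :: "'a::euclidean_space set"
  assumes op: "open \<Omega>" and lip: "lipschitz_boundary \<Omega>" and R: "R > 0"
    and 1: "AE x in lborel. x \<notin> ball 0 R - \<Omega>" and 2: "AE x in lborel. x \<notin> \<Omega> - ball 0 R"
  shows "\<Omega> = ball 0 R"
proof
  have "\<Omega> - cball 0 R = {}"
  proof (rule open_null_empty)
    show "open (\<Omega> - cball 0 R)" using op by (simp add: open_Diff)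
    show "AE x in lborel. x \<notin> \<Omega> - cball 0 R" using 2 by eventually_elim auto
  qed
  then have "\<Omega> \<subseteq> interior (cball 0 R)" using op by (intro interior_maximal) auto
  then show "\<Omega> \<subseteq> ball 0 R" by (simp add: interior_cball)
  show "ball 0 R \<subseteq> \<Omega>"
  proof (rule ccontr)
    assume "\<not> ball 0 R \<subseteq> \<Omega>"
    then obtain p where p: "p \<in> ball 0 R" "p \<notin> \<Omega>" by blast
    have "ball 0 R - closure \<Omega> = {}"
    proof (rule open_null_empty)
      show "open (ball 0 R - closure \<Omega>)" by (simp add: open_Diff)
      show "AE x in lborel. x \<notin> ball 0 R - closure \<Omega>"
        using 1 by eventually_elim (use closure_subset[of \<Omega>] in blast)
    qed
    then have "p \<in> frontier \<Omega>" using p op by (auto simp: frontier_def interior_open)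
    then obtain e r L and g :: "'a \<Rightarrow> real" where e: "norm e = 1" "0 < r" "L-lipschitz_on {y. y \<bullet> e = 0} g"
      "\<Omega> \<inter> ball p r = {x \<in> ball p r. x \<bullet> e < g (x - (x \<bullet> e) *\<^sub>R e)}"
      using lip unfolding lipschitz_boundary_def by blast
    have ee: "e \<bullet> e = 1" using e(1) by (simp add: norm_eq_1)
    let ?P = "\<lambda>x. x - (x \<bullet> e) *\<^sub>R e"
    have Pin: "?P x \<in> {y. y \<bullet> e = 0}" for x by (simp add: inner_diff_left ee)
    have contg: "continuous_on UNIV (\<lambda>x. g (?P x))"
      by (rule continuous_on_compose2[OF lipschitz_on_continuous_on[OF e(3)]])
        (use Pin in \<open>auto intro!: continuous_intros\<close>)
    \<comment> \<open>The part of the small ball strictly above the graph misses \<Omega>. It is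
      open and contained in a null set, hence empty.\<close>
    let ?U = "{x \<in> ball p r \<inter> ball 0 R. x \<bullet> e > g (?P x)}"
    have "open ?U"
    proof -
      have "open {x. g (?P x) < x \<bullet> e}" by (intro open_Collect_less contg continuous_intros)
      then have "open (ball p r \<inter> ball 0 R \<inter> {x. g (?P x) < x \<bullet> e})" by (intro open_Int open_ball)
      moreover have "ball p r \<inter> ball 0 R \<inter> {x. g (?P x) < x \<bullet> e} = ?U" by auto
      ultimately show ?thesis by simp
    qed
    moreover have "AE x in lborel. x \<notin> ?U"
      using 1
    proof eventually_elim
      fix x assume x: "x \<notin> ball 0 R - \<Omega>"
      show "x \<notin> ?U"
      proof
        assume xU: "x \<in> ?U"
        then have "x \<in> \<Omega> \<inter> ball p r" using x by auto
        then have "x \<bullet> e < g (?P x)" unfolding e(4) by simp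
        then show False using xU by simp
      qed
    qed
    ultimately have U: "?U = {}" by (rule open_null_empty)
    have pg: "p \<bullet> e \<ge> g (?P p)"
    proof (rule ccontr)
      assume "\<not> ?thesis"
      then have "p \<in> \<Omega> \<inter> ball p r" unfolding e(4) using e(2) by simp
      then show False using p by simp
    qed
    \<comment> \<open>Moving up from p by t along e keeps the base point on the hyperplane, so the
      new point lies strictly above the graph; t is small enough to remain in both balls.\<close>
    define t where "t = min (r / 2) ((R - norm p) / 2)"
    have t: "t > 0" "t < r" "norm p + t < R" using e(2) p(1) by (auto simp: t_def min_def field_simps)
    have P: "?P (p + t *\<^sub>R e) = ?P p" by (simp add: inner_add_left ee algebra_simps)
    have pe: "(p + t *\<^sub>R e) \<bullet> e = p \<bullet> e + t" by (simp add: inner_add_left ee)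
    have "(p + t *\<^sub>R e) \<bullet> e > g (?P (p + t *\<^sub>R e))" using P pe pg t by (smt (verit, best))
    moreover have "norm (p + t *\<^sub>R e) \<le> norm p + t" using norm_triangle_ineq[of p "t *\<^sub>R e"] e(1) t by simp
    moreover have "dist p (p + t *\<^sub>R e) = t" using e(1) t by (simp add: dist_norm)
    moreover from calculation(2) have "p + t *\<^sub>R e \<in> ball 0 R" using t(3) by simp
    ultimately have "p + t *\<^sub>R e \<in> ?U" using t(2) unfolding mem_Collect_eq Int_iff mem_ball by simp
    then show False using U by blast
  qed
qed

section \<open>Weinberger's test functions\<close>

lemma has_real_derivative_of_halflines:
  fixes f :: "real \<Rightarrow> real"
  assumes "(f has_real_derivative D) (at a within {..a})" "(f has_real_derivative D) (at a within {a..})"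
  shows "(f has_real_derivative D) (at a)"
proof -
  have "((\<lambda>y. (f y - f a) / (y - a)) \<longlongrightarrow> D) (at a within {..a} \<union> {a..})"
    using assms unfolding has_field_derivative_iff by (rule Lim_Un)
  moreover have "{..a} \<union> {a..} = (UNIV :: real set)" by auto
  ultimately show ?thesis by (simp add: has_field_derivative_iff)
qed

context neumann_profile
begin

text \<open>Weinberger's extension: \<open>|x| ext(s)\<close> is constant beyond the radius of the ball.\<close>

definition ext :: "real \<Rightarrow> real" where
  "ext s = (if s \<le> S then \<kappa> s else \<kappa> S * sqrt (S / s))"

definition ext' :: "real \<Rightarrow> real" where
  "ext' s = (if s \<le> S then \<kappa>1 s else - \<kappa> S * sqrt (S / s) / (2 * s))"

lemma DERIV_outer: "s > 0 \<Longrightarrow> ((\<lambda>s. \<kappa> S * sqrt (S / s)) has_real_derivative - \<kappa> S * sqrt (S / s) / (2 * s)) (at s)"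
proof -
  assume s: "s > 0"
  have "((\<lambda>s. \<kappa> S * sqrt (S / s)) has_real_derivative \<kappa> S * ((inverse (sqrt (S / s)) / 2) * (- S / s\<^sup>2))) (at s)"
  proof -
    have "S / s > 0" using s S_pos by simp
    then show ?thesis using s by (auto intro!: derivative_eq_intros simp: power2_eq_square)
  qed
  moreover have h: "inverse (sqrt (S / s)) * (S / s) = sqrt (S / s)"
    using s S_pos by (metis divide_pos_pos real_div_sqrt divide_inverse mult.commute less_imp_le)
  have "\<kappa> S * ((inverse (sqrt (S / s)) / 2) * (- S / s\<^sup>2)) =
      - \<kappa> S * (inverse (sqrt (S / s)) * (S / s)) / (2 * s)"
    using s by (simp add: power2_eq_square)
  then have "\<kappa> S * ((inverse (sqrt (S / s)) / 2) * (- S / s\<^sup>2)) = - \<kappa> S * sqrt (S / s) / (2 * s)"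
    unfolding h .
  ultimately show ?thesis by simp
qed

text \<open>The Neumann condition says precisely that the two branches of \<open>ext\<close> have
  the same derivative at S, which makes the extension C^1.\<close>

lemma \<kappa>1_S: "\<kappa>1 S = - \<kappa> S * sqrt (S / S) / (2 * S)"
  using flux_zero S_pos by (simp add: field_simps)

lemma DERIV_ext: "(ext has_real_derivative ext' s) (at s)"
proof -
  consider "s < S" | "s > S" | "s = S" by linarith
  then show ?thesis
  proof cases
    case 1
    have "(ext has_real_derivative \<kappa>1 s) (at s)"
      by (rule has_field_derivative_transform_within_open[OF DERIV_\<kappa>, where S="{..<S}"])
        (use 1 in \<open>auto simp: ext_def\<close>)
    then show ?thesis using 1 by (simp add: ext'_def)
  next
    case 2
    have "(ext has_real_derivative - \<kappa> S * sqrt (S / s) / (2 * s)) (at s)"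
      by (rule has_field_derivative_transform_within_open[OF DERIV_outer, where S="{S<..}"])
        (use 2 S_pos in \<open>auto simp: ext_def\<close>)
    then show ?thesis using 2 by (simp add: ext'_def)
  next
    case 3
    show ?thesis unfolding 3
    proof (rule has_real_derivative_of_halflines)
      show "(ext has_real_derivative ext' S) (at S within {..S})"
      proof (rule has_field_derivative_transform_within[where d=1])
        show "(\<kappa> has_real_derivative ext' S) (at S within {..S})"
          using DERIV_\<kappa>[of S] by (simp add: ext'_def has_field_derivative_at_within)
      qed (auto simp: ext_def)
      show "(ext has_real_derivative ext' S) (at S within {S..})"
      proof (rule has_field_derivative_transform_within[where d=1])
        show "((\<lambda>s. \<kappa> S * sqrt (S / s)) has_real_derivative ext' S) (at S within {S..})"
          using has_field_derivative_at_within[OF DERIV_outer[OF S_pos]] \<kappa>1_S by (simp add: ext'_def)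
      qed (use S_pos in \<open>auto simp: ext_def\<close>)
    qed
  qed
qed

lemma continuous_ext: "continuous_on A ext"
  using DERIV_ext by (rule continuous_on_of_DERIV)

lemma continuous_ext': "continuous_on UNIV ext'"
proof -
  have "continuous_on ({..S} \<union> {S..}) (\<lambda>s. if s \<le> S then \<kappa>1 s else - \<kappa> S * sqrt (S / s) / (2 * s))"
  proof (rule continuous_on_cases)
    show "continuous_on {S..} (\<lambda>s. - \<kappa> S * sqrt (S / s) / (2 * s))"
      using S_pos by (intro continuous_intros) auto
  qed (use continuous_\<kappa>1 \<kappa>1_S in auto)
  moreover have "{..S} \<union> {S..} = (UNIV :: real set)" by auto
  ultimately show ?thesis by (simp add: ext'_def[abs_def])
qed

lemma ext_pos: "0 \<le> s \<Longrightarrow> ext s > 0"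
  using \<kappa>_pos[of s] \<kappa>_pos[of S] S_pos by (auto simp: ext_def)

definition trial :: "'a::euclidean_space \<Rightarrow> 'a \<Rightarrow> real" where
  "trial n x = (x \<bullet> n) * ext ((norm x)\<^sup>2 / 2)"

definition trial' :: "'a::euclidean_space \<Rightarrow> 'a \<Rightarrow> 'a" where
  "trial' n x = ext ((norm x)\<^sup>2 / 2) *\<^sub>R n + ((x \<bullet> n) * ext' ((norm x)\<^sup>2 / 2)) *\<^sub>R x"

lemma C1_grad_trial: "C1_grad (trial n) (trial' n)"
  by (rule C1_grad_cong[OF C1_grad_mult[OF C1_grad_inner[of n] C1_grad_radial[OF DERIV_ext continuous_ext']]])
    (auto simp: trial_def trial'_def)

text \<open>In terms of \<rho> = |x| and G = \<rho> ext, \<open>gsq\<close> is G^2 and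
  \<open>dsq\<close> is G'^2 + (N - 1) G^2 / \<rho>^2, Weinberger's denominator and
  numerator.\<close>

definition gsq :: "real \<Rightarrow> real" where "gsq s = 2 * s * (ext s)\<^sup>2"

definition dsq :: "real \<Rightarrow> real" where "dsq s = (ext s + 2 * s * ext' s)\<^sup>2 + (N - 1) * (ext s)\<^sup>2"

lemma sum_trial_sq: "(\<Sum>b\<in>Basis. (trial b x)\<^sup>2) = gsq ((norm x)\<^sup>2 / 2)" for x :: "'a::euclidean_space"
proof -
  have "(\<Sum>b\<in>Basis. (trial b x)\<^sup>2) = (\<Sum>b\<in>Basis. (x \<bullet> b) * (x \<bullet> b)) * (ext ((norm x)\<^sup>2 / 2))\<^sup>2"
    unfolding trial_def sum_distrib_right by (simp add: power2_eq_square mult_ac)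
  then show ?thesis unfolding euclidean_inner[symmetric] gsq_def power2_norm_eq_inner by simp
qed

lemma sum_trial'_sq:
  fixes x :: "'a::euclidean_space"
  assumes N: "N = real DIM('a)"
  shows "(\<Sum>b\<in>Basis. (norm (trial' b x))\<^sup>2) = dsq ((norm x)\<^sup>2 / 2)"
proof -
  define s where "s = (norm x)\<^sup>2 / 2"
  have xx: "x \<bullet> x = 2 * s" by (simp add: s_def power2_norm_eq_inner)
  have "trial' b x = (x \<bullet> b) *\<^sub>R ext' s *\<^sub>R x + ext s *\<^sub>R b" for b
    by (simp add: trial'_def s_def add.commute)
  then have "(\<Sum>b\<in>Basis. (norm (trial' b x))\<^sup>2) = dsq s"
    using sum_norm_radial_gradient[where x=x and a="ext' s" and c="ext s"] unfolding xx N[symmetric]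
    by (simp add: dsq_def power2_eq_square algebra_simps)
  then show ?thesis unfolding s_def .
qed

lemma gsq_outer: "s \<ge> S \<Longrightarrow> gsq s = 2 * S * (\<kappa> S)\<^sup>2"
  using S_pos by (auto simp: gsq_def ext_def power_mult_distrib)

lemma dsq_outer: "s \<ge> S \<Longrightarrow> dsq s = (N - 1) * (\<kappa> S)\<^sup>2 * (S / s)"
  using S_pos flux_zero by (cases "s = S") (auto simp: dsq_def ext_def ext'_def power_mult_distrib)

text \<open>On the inner branch the derivative of \<open>gsq\<close> is 2 \<kappa> times the flux,
  hence positive. This is the only strict inequality in the comparison.\<close>

lemma gsq_inner: "0 \<le> s \<Longrightarrow> s < S \<Longrightarrow> gsq s < 2 * S * (\<kappa> S)\<^sup>2"
proof -
  assume s: "0 \<le> s" "s < S"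
  have D: "((\<lambda>s. 2 * s * (\<kappa> s)\<^sup>2) has_real_derivative 2 * (\<kappa> s * (\<kappa> s + 2 * s * \<kappa>1 s))) (at s)" for s
    by (rule derivative_eq_intros DERIV_\<kappa> refl)+ (simp add: power2_eq_square algebra_simps)
  have "2 * s * (\<kappa> s)\<^sup>2 < 2 * S * (\<kappa> S)\<^sup>2"
  proof (rule DERIV_pos_imp_increasing_open[OF s(2)])
    fix x assume x: "s < x" "x < S"
    have "0 < 2 * (\<kappa> x * (\<kappa> x + 2 * x * \<kappa>1 x))" using \<kappa>_pos[of x] flux_pos[of x] x s by simp
    then show "\<exists>y. ((\<lambda>s. 2 * s * (\<kappa> s)\<^sup>2) has_real_derivative y) (at x) \<and> 0 < y" using D by blast
  qed (intro continuous_intros continuous_\<kappa>)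
  then show ?thesis using s by (simp add: gsq_def ext_def)
qed

text \<open>The equation eliminates the second derivative of \<kappa> from the derivative of
  \<open>dsq\<close>; every remaining term is nonpositive because \<kappa> is nonincreasing, the
  flux is nonnegative and \<mu> >= 1.\<close>

lemma dsq_inner:
  assumes N: "N \<ge> 1" and s: "0 \<le> s" "s \<le> S"
  shows "dsq s \<ge> (N - 1) * (\<kappa> S)\<^sup>2"
proof -
  define f where "f s = (\<kappa> s + 2 * s * \<kappa>1 s)\<^sup>2 + (N - 1) * (\<kappa> s)\<^sup>2" for s
  define f' where "f' s = 2 * ((\<kappa> s + 2 * s * \<kappa>1 s) * (2 * s * \<kappa>1 s - (\<mu> - 1) * \<kappa> s) - 2 * s * (N - 1) * (\<kappa>1 s)\<^sup>2)" for s
  have D: "(f has_real_derivative f' s) (at s)" for s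
  proof -
    have "(f has_real_derivative 2 * (\<kappa> s + 2 * s * \<kappa>1 s) * (\<kappa>1 s + (2 * \<kappa>1 s + 2 * s * \<kappa>2 s))
        + (N - 1) * (2 * \<kappa> s * \<kappa>1 s)) (at s)"
      unfolding f_def[abs_def]
      by (rule derivative_eq_intros DERIV_\<kappa> DERIV_\<kappa>1 refl)+ (simp add: algebra_simps)
    moreover have o: "2 * s * \<kappa>2 s = - ((N + 2 - 2 * s) * \<kappa>1 s) - (\<mu> - 1) * \<kappa> s"
      using ode[of s] by linarith
    have "2 * (\<kappa> s + 2 * s * \<kappa>1 s) * (\<kappa>1 s + (2 * \<kappa>1 s + 2 * s * \<kappa>2 s))
        + (N - 1) * (2 * \<kappa> s * \<kappa>1 s) = f' s"
      unfolding o f'_def by (simp add: power2_eq_square algebra_simps)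
    ultimately show ?thesis by simp
  qed
  have "f s \<ge> f S"
  proof (rule DERIV_nonpos_imp_nonincreasing[where f=f])
    fix x assume x: "s \<le> x" "x \<le> S"
    have "2 * x * \<kappa>1 x \<le> 0" using \<kappa>1_nonpos[of x] x s by (simp add: mult_nonneg_nonpos)
    moreover have "(\<mu> - 1) * \<kappa> x \<ge> 0" using \<mu>_ge_1 \<kappa>_pos[of x] x s by (simp add: less_imp_le)
    ultimately have "(\<kappa> x + 2 * x * \<kappa>1 x) * (2 * x * \<kappa>1 x - (\<mu> - 1) * \<kappa> x) \<le> 0"
      using flux_nonneg[of x] x s by (intro mult_nonneg_nonpos) auto
    moreover have "2 * x * (N - 1) * (\<kappa>1 x)\<^sup>2 \<ge> 0" using N x s by simp
    ultimately have "f' x \<le> 0" unfolding f'_def by argo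
    then show "\<exists>y. (f has_real_derivative y) (at x) \<and> y \<le> 0" using D by blast
  qed (use s in simp)
  moreover have "dsq s = f s" using s by (simp add: dsq_def f_def ext_def ext'_def)
  moreover have "f S = (N - 1) * (\<kappa> S)\<^sup>2" using flux_zero by (simp add: f_def)
  ultimately show ?thesis by simp
qed

text \<open>gw (dsq - \<mu> gsq) is the divergence of gw q(s) x with q = \<kappa> times the flux,
  and q vanishes on the sphere. This field is half the weighted gradient of
  \<open>gsq\<close>.\<close>

lemma rayleigh_ball:
  assumes N: "N = real DIM('a)" and r: "r > 0" "r\<^sup>2 / 2 = S"
  shows "(\<integral>x. dsq ((norm x)\<^sup>2 / 2) \<partial>(wball r :: 'a::euclidean_space measure)) =
     \<mu> * (\<integral>x. gsq ((norm x)\<^sup>2 / 2) \<partial>(wball r :: 'a measure))"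
proof -
  let ?s = "\<lambda>x::'a. (norm x)\<^sup>2 / 2"
  define q where "q s = \<kappa> s * (\<kappa> s + 2 * s * \<kappa>1 s)" for s
  define q' where "q' s = \<kappa>1 s * (\<kappa> s + 2 * s * \<kappa>1 s) + \<kappa> s * (\<kappa>1 s + (2 * \<kappa>1 s + 2 * s * \<kappa>2 s))" for s
  have q: "(q has_real_derivative q' s) (at s)" for s
    unfolding q_def[abs_def] q'_def
    by (rule derivative_eq_intros DERIV_\<kappa> DERIV_\<kappa>1 refl)+ (simp add: algebra_simps)
  have q'c: "continuous_on UNIV q'"
    unfolding q'_def by (intro continuous_intros continuous_\<kappa> continuous_\<kappa>1 continuous_\<kappa>2)
  have "q S = 0" using flux_zero by (simp add: q_def)
  then obtain C where C: "C \<ge> 0" "\<And>s. 0 \<le> s \<Longrightarrow> s \<le> S \<Longrightarrow> \<bar>q s\<bar> \<le> C * (S - s)"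
    using radial_vanish[OF q q'c] by metis
  have Cx: "\<bar>q (?s x)\<bar> \<le> C * (r\<^sup>2 / 2 - ?s x)" if "norm x < r" for x :: 'a
    using C(2)[of "?s x"] half_norm_le[of x r] that r by simp
  from wball_divergence_radial[OF C1_grad_radial[OF q q'c] r(1) Cx]
  have "(\<integral>x. (q' (?s x) *\<^sub>R x) \<bullet> x + (real DIM('a) - (norm x)\<^sup>2) * q (?s x) \<partial>(wball r::'a measure)) = 0" .
  moreover have "(\<integral>x. (q' (?s x) *\<^sub>R x) \<bullet> x + (real DIM('a) - (norm x)\<^sup>2) * q (?s x) \<partial>(wball r::'a measure)) =
     (\<integral>x. dsq (?s x) - \<mu> * gsq (?s x) \<partial>(wball r::'a measure))"
  proof (rule integral_cong_AE)
    have m [measurable]: "ext \<in> borel_measurable borel" "ext' \<in> borel_measurable borel"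
      "q \<in> borel_measurable borel" "q' \<in> borel_measurable borel"
      using continuous_on_of_DERIV[OF q]
      by (auto intro!: borel_measurable_continuous_onI continuous_ext continuous_ext' q'c)
    show "(\<lambda>x. (q' (?s x) *\<^sub>R x) \<bullet> x + (real DIM('a) - (norm x)\<^sup>2) * q (?s x)) \<in> borel_measurable (wball r::'a measure)"
      by measurable
    show "(\<lambda>x. dsq (?s x) - \<mu> * gsq (?s x)) \<in> borel_measurable (wball r::'a measure)"
      unfolding dsq_def gsq_def by measurable
    show "AE x in (wball r::'a measure). (q' (?s x) *\<^sub>R x) \<bullet> x + (real DIM('a) - (norm x)\<^sup>2) * q (?s x) =
        dsq (?s x) - \<mu> * gsq (?s x)"
      using AE_wball[of r]
    proof eventually_elim
      fix x :: 'a assume x: "norm x < r"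
      define s where "s = ?s x"
      have s: "0 \<le> s" "s \<le> S" using half_norm_le[of x r] x r by (auto simp: s_def)
      have xx: "x \<bullet> x = 2 * s" "(norm x)\<^sup>2 = 2 * s" by (simp_all add: s_def power2_norm_eq_inner)
      have o: "2 * s * \<kappa>2 s = - ((N + 2 - 2 * s) * \<kappa>1 s) - (\<mu> - 1) * \<kappa> s"
        using ode[of s] by linarith
      have e: "ext s = \<kappa> s" "ext' s = \<kappa>1 s" using s by (simp_all add: ext_def ext'_def)
      have "q' s * (2 * s) + (N - 2 * s) * q s = dsq s - \<mu> * gsq s"
        unfolding q'_def q_def dsq_def gsq_def e o by (simp add: power2_eq_square algebra_simps)
      then show "(q' (?s x) *\<^sub>R x) \<bullet> x + (real DIM('a) - (norm x)\<^sup>2) * q (?s x) =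
        dsq (?s x) - \<mu> * gsq (?s x)"
        unfolding s_def[symmetric] unfolding N[symmetric] inner_scaleR_left xx .
    qed
  qed
  moreover have "(\<integral>x. dsq (?s x) - \<mu> * gsq (?s x) \<partial>(wball r::'a measure)) =
      (\<integral>x. dsq (?s x) \<partial>(wball r::'a measure)) - \<mu> * (\<integral>x. gsq (?s x) \<partial>(wball r::'a measure))"
  proof -
    have "integrable (wball r::'a measure) (\<lambda>x. dsq (?s x))" "integrable (wball r::'a measure) (\<lambda>x. gsq (?s x))"
      unfolding dsq_def gsq_def
      by (intro integrable_wball_continuous continuous_intros continuous_on_compose2[OF continuous_ext[of UNIV]]
          continuous_on_compose2[OF continuous_ext']; simp)+
    then show ?thesis by simp
  qed
  ultimately show ?thesis by simp
qed

end

section \<open>Comparison of Rayleigh quotients\<close>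

lemma gauss_integral_odd:
  fixes f :: "'a::euclidean_space \<Rightarrow> real"
  assumes [measurable]: "f \<in> borel_measurable borel" and odd: "\<And>x. f (- x) = - f x"
  shows "(\<integral>x. f x \<partial>gauss) = 0"
proof -
  have d: "distr (lborel::'a measure) borel uminus = lborel"
    using lborel_affine[of "-1" "0::'a"] by (simp add: density_1)
  have eq: "(\<integral>x. f x \<partial>gauss) = (\<integral>x. gauss_density x * f x \<partial>lborel)"
    unfolding gauss_def by (subst integral_density) (auto simp: gauss_density_pos less_imp_le)
  also have "\<dots> = (\<integral>x. gauss_density x * f x \<partial>distr lborel borel uminus)" by (simp only: d)
  also have "\<dots> = (\<integral>x. gauss_density (- x) * f (- x) \<partial>lborel)" by (rule integral_distr) measurable
  also have "\<dots> = - (\<integral>x. gauss_density x * f x \<partial>lborel)"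
    by (simp add: odd gauss_density_def)
  finally show ?thesis using eq by simp
qed

lemma neumann_mu1_le:
  fixes v :: "'a::euclidean_space \<Rightarrow> real"
  assumes "(v, Dv) \<in> gauss_H1 \<Omega>" "\<not> (AE x in gauss. x \<in> \<Omega> \<longrightarrow> v x = 0)" "(LINT x:\<Omega>|gauss. v x) = 0"
  shows "neumann_mu1 \<Omega> \<le> (LINT x:\<Omega>|gauss. (norm (Dv x))\<^sup>2) / (LINT x:\<Omega>|gauss. (v x)\<^sup>2)"
  unfolding neumann_mu1_def
proof (rule cInf_lower)
  show "bdd_below {(LINT x:\<Omega>|gauss. (norm (Dv x))\<^sup>2) / (LINT x:\<Omega>|gauss. (v x)\<^sup>2) |v Dv.
      (v, Dv) \<in> gauss_H1 \<Omega> \<and> \<not> (AE x in gauss. x \<in> \<Omega> \<longrightarrow> v x = 0) \<and> (LINT x:\<Omega>|gauss. v x) = 0}"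
    by (rule bdd_belowI[of _ 0])
      (auto simp: set_lebesgue_integral_def intro!: divide_nonneg_nonneg integral_nonneg_AE)
qed (use assms in blast)

text \<open>The product (1_A - 1_B)(f - c) is nonnegative everywhere, and the constant c drops out
  of its integral because A and B have equal measure. Equality makes the product vanish almost
  everywhere, so B - A is null if f < c on B.\<close>

lemma bathtub:
  fixes f :: "'a::euclidean_space \<Rightarrow> real"
  assumes f [measurable]: "f \<in> borel_measurable borel" and bnd: "\<And>x. \<bar>f x\<bar> \<le> C"
    and [measurable]: "A \<in> sets borel" "B \<in> sets borel"
    and eq: "measure gauss A = measure gauss B"
    and inside: "\<And>x. x \<in> B \<Longrightarrow> f x \<le> c" and outside: "\<And>x. x \<notin> B \<Longrightarrow> c \<le> f x"
  shows "(LINT x:B|gauss. f x) \<le> (LINT x:A|gauss. f x)"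
    and "\<lbrakk>\<And>x. x \<in> B \<Longrightarrow> f x < c; (LINT x:A|gauss. f x) \<le> (LINT x:B|gauss. f x)\<rbrakk>
      \<Longrightarrow> AE x in gauss. x \<notin> B - A"
proof -
  let ?h = "\<lambda>x. (indicator A x - indicator B x) * (f x - c)"
  have i: "integrable gauss (\<lambda>x. indicator D x * f x)" "integrable gauss (\<lambda>x. indicator D x * c)"
    if "D \<in> sets borel" for D
    using set_integrable_gauss_bounded[of f D C] set_integrable_gauss_bounded[of "\<lambda>_. c" D "\<bar>c\<bar>"] that bnd
    by (auto simp: set_integrable_def)
  have ih: "integrable gauss ?h"
    using i[of A] i[of B] by (simp add: algebra_simps)
  have c: "(\<integral>x. indicator D x * c \<partial>gauss) = measure gauss D * c" if "D \<in> sets borel" for D :: "'a set"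
    using that by simp
  have "(\<integral>x. ?h x \<partial>gauss) = (\<integral>x. (indicator A x * f x - indicator A x * c) - (indicator B x * f x - indicator B x * c) \<partial>gauss)"
    by (intro Bochner_Integration.integral_cong) (auto simp: algebra_simps)
  also have "\<dots> = (LINT x:A|gauss. f x) - (LINT x:B|gauss. f x)"
    using i[of A] i[of B] eq by (simp add: set_lebesgue_integral_def)
  finally have H: "(\<integral>x. ?h x \<partial>gauss) = (LINT x:A|gauss. f x) - (LINT x:B|gauss. f x)" .
  have h0: "?h x \<ge> 0" for x
    using inside[of x] outside[of x] by (auto simp: indicator_def)
  then have "(\<integral>x. ?h x \<partial>gauss) \<ge> 0" by (intro integral_nonneg_AE) auto
  then show "(LINT x:B|gauss. f x) \<le> (LINT x:A|gauss. f x)" using H by simp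
  assume strict: "\<And>x. x \<in> B \<Longrightarrow> f x < c" and le: "(LINT x:A|gauss. f x) \<le> (LINT x:B|gauss. f x)"
  have "(\<integral>x. ?h x \<partial>gauss) = 0" using H le \<open>(\<integral>x. ?h x \<partial>gauss) \<ge> 0\<close> by simp
  then have "AE x in gauss. ?h x = 0"
    using integral_nonneg_eq_0_iff_AE[OF ih] h0 by auto
  then show "AE x in gauss. x \<notin> B - A"
  proof eventually_elim
    fix x assume "?h x = 0"
    then show "x \<notin> B - A" using strict[of x] by (auto simp: indicator_def)
  qed
qed

context neumann_profile
begin

lemma borel_measurable_gsq_dsq [measurable]: "gsq \<in> borel_measurable borel" "dsq \<in> borel_measurable borel"
proof -
  have "continuous_on UNIV gsq" "continuous_on UNIV dsq"
    unfolding gsq_def dsq_def by (intro continuous_intros continuous_ext continuous_ext')+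
  then show "gsq \<in> borel_measurable borel" "dsq \<in> borel_measurable borel"
    by (auto intro: borel_measurable_continuous_onI)
qed

lemma gsq_bounds: "0 \<le> s \<Longrightarrow> 0 \<le> gsq s" "0 \<le> s \<Longrightarrow> gsq s \<le> 2 * S * (\<kappa> S)\<^sup>2"
  using gsq_inner[of s] gsq_outer[of s] by (force simp: gsq_def, force)

lemma dsq_outer_le: "N \<ge> 1 \<Longrightarrow> S \<le> s \<Longrightarrow> dsq s \<le> (N - 1) * (\<kappa> S)\<^sup>2"
  unfolding dsq_outer using S_pos by (intro mult_left_le) auto

lemma dsq_bounds:
  assumes "N \<ge> 1"
  obtains C where "\<And>s. 0 \<le> s \<Longrightarrow> 0 \<le> dsq s" "\<And>s. 0 \<le> s \<Longrightarrow> dsq s \<le> C"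
proof -
  have "compact (dsq ` {0..S})"
    unfolding dsq_def by (intro compact_continuous_image continuous_intros continuous_ext
      continuous_on_subset[OF continuous_ext']) auto
  then have "bounded (dsq ` {0..S})" by (rule compact_imp_bounded)
  then obtain C where "\<forall>y\<in>dsq ` {0..S}. norm y \<le> C" unfolding bounded_iff by blast
  then have C: "0 \<le> s \<Longrightarrow> s \<le> S \<Longrightarrow> dsq s \<le> C" for s by force
  have "dsq s \<le> max C ((N - 1) * (\<kappa> S)\<^sup>2)" if "0 \<le> s" for s
    using C[of s] dsq_outer_le[OF assms, of s] that by (cases "s \<le> S") auto
  moreover have "0 \<le> dsq s" for s unfolding dsq_def using assms by simp
  ultimately show thesis using that by blast
qed

lemma trial_sq_le: "b \<in> Basis \<Longrightarrow> (trial b x)\<^sup>2 \<le> 2 * S * (\<kappa> S)\<^sup>2" for b :: "'a::euclidean_space"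
proof -
  assume b: "b \<in> Basis"
  have "(trial b x)\<^sup>2 \<le> (\<Sum>b\<in>Basis. (trial b x)\<^sup>2)"
    using b by (intro member_le_sum) auto
  also have "\<dots> \<le> 2 * S * (\<kappa> S)\<^sup>2" unfolding sum_trial_sq by (rule gsq_bounds) simp
  finally show ?thesis .
qed

lemma trial'_sq_le:
  assumes N: "N = real DIM('a::euclidean_space)"
  obtains C where "\<And>b x::'a. b \<in> Basis \<Longrightarrow> (norm (trial' b x))\<^sup>2 \<le> C"
proof -
  have "N \<ge> 1" unfolding N using DIM_positive[where 'a='a] by simp
  then obtain C where C: "\<And>s. 0 \<le> s \<Longrightarrow> dsq s \<le> C" using dsq_bounds by metis
  have "(norm (trial' b x))\<^sup>2 \<le> C" if "b \<in> Basis" for b x :: 'a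
  proof -
    have "(norm (trial' b x))\<^sup>2 \<le> (\<Sum>b\<in>Basis. (norm (trial' b x))\<^sup>2)"
      using that by (intro member_le_sum) auto
    also have "\<dots> \<le> C" unfolding sum_trial'_sq[OF N] by (rule C) simp
    finally show ?thesis .
  qed
  then show thesis by (rule that)
qed

lemma trial_integrable:
  fixes \<Omega> :: "'a::euclidean_space set"
  assumes N: "N = real DIM('a)" and [measurable]: "\<Omega> \<in> sets borel" and b: "b \<in> Basis"
  shows "set_integrable gauss \<Omega> (\<lambda>x. (trial b x)\<^sup>2)" "set_integrable gauss \<Omega> (\<lambda>x. (norm (trial' b x))\<^sup>2)"
proof -
  note [measurable] = C1_grad_measurable[OF C1_grad_trial]
  show "set_integrable gauss \<Omega> (\<lambda>x. (trial b x)\<^sup>2)"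
    by (rule set_integrable_gauss_bounded) (use trial_sq_le[OF b] in auto)
  obtain C where "\<And>x. (norm (trial' b x))\<^sup>2 \<le> C" using trial'_sq_le[OF N] b by metis
  then show "set_integrable gauss \<Omega> (\<lambda>x. (norm (trial' b x))\<^sup>2)"
    by (intro set_integrable_gauss_bounded[of _ _ C]) auto
qed

text \<open>Symmetry of the domain and oddness of the trial function give mean zero. It is not zero
  almost everywhere because \<open>ext\<close> is positive and a nonempty open set does not lie in a
  hyperplane.\<close>

lemma trial_admissible:
  fixes \<Omega> :: "'a::euclidean_space set"
  assumes N: "N = real DIM('a)" and op: "open \<Omega>" and ne: "\<Omega> \<noteq> {}"
    and sym: "\<forall>x. x \<in> \<Omega> \<longleftrightarrow> - x \<in> \<Omega>" and b: "b \<in> Basis"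
  shows "(trial b, trial' b) \<in> gauss_H1 \<Omega>" "\<not> (AE x in gauss. x \<in> \<Omega> \<longrightarrow> trial b x = 0)"
    "(LINT x:\<Omega>|gauss. trial b x) = 0" "(LINT x:\<Omega>|gauss. (trial b x)\<^sup>2) > 0"
proof -
  note [measurable] = C1_grad_measurable[OF C1_grad_trial]
  have [measurable]: "\<Omega> \<in> sets borel" using op by simp
  note ti = trial_integrable[OF N \<open>\<Omega> \<in> sets borel\<close> b]
  show "(trial b, trial' b) \<in> gauss_H1 \<Omega>"
    using ti C1_has_weak_gradient[OF C1_grad_trial] by (simp add: gauss_H1_def)
  show nz: "\<not> (AE x in gauss. x \<in> \<Omega> \<longrightarrow> trial b x = 0)"
  proof
    assume "AE x in gauss. x \<in> \<Omega> \<longrightarrow> trial b x = 0"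
    then have ae: "AE x in lborel. x \<notin> {x \<in> \<Omega>. x \<bullet> b \<noteq> 0}"
      unfolding AE_gauss_iff
    proof eventually_elim
      fix x :: 'a assume "x \<in> \<Omega> \<longrightarrow> trial b x = 0"
      moreover have "ext ((norm x)\<^sup>2 / 2) > 0" by (rule ext_pos) simp
      ultimately show "x \<notin> {x \<in> \<Omega>. x \<bullet> b \<noteq> 0}" by (auto simp: trial_def)
    qed
    have "open (\<Omega> \<inter> {x. x \<bullet> b \<noteq> 0})"
      by (intro open_Int op open_Collect_neq continuous_intros)
    moreover have "\<Omega> \<inter> {x. x \<bullet> b \<noteq> 0} = {x \<in> \<Omega>. x \<bullet> b \<noteq> 0}" by auto
    ultimately have "{x \<in> \<Omega>. x \<bullet> b \<noteq> 0} = {}" using open_null_empty[OF _ ae] by simp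
    then have flat: "x \<in> \<Omega> \<Longrightarrow> x \<bullet> b = 0" for x by auto
    obtain x where x: "x \<in> \<Omega>" using ne by auto
    then obtain d where d: "d > 0" "ball x d \<subseteq> \<Omega>" using op open_contains_ball by blast
    have "x + (d / 2) *\<^sub>R b \<in> \<Omega>" using d b by (intro subsetD[OF d(2)]) (simp add: dist_norm)
    from flat[OF this] flat[OF x] show False using d b by (simp add: inner_add_left inner_same_Basis)
  qed
  show "(LINT x:\<Omega>|gauss. trial b x) = 0"
    unfolding set_lebesgue_integral_def
  proof (rule gauss_integral_odd)
    show "indicat_real \<Omega> (- x) *\<^sub>R trial b (- x) = - (indicat_real \<Omega> x *\<^sub>R trial b x)" for x
      using sym by (auto simp: indicator_def trial_def)
  qed measurable
  have nn: "(LINT x:\<Omega>|gauss. (trial b x)\<^sup>2) \<ge> 0"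
    unfolding set_lebesgue_integral_def by (intro integral_nonneg_AE) auto
  moreover have "(LINT x:\<Omega>|gauss. (trial b x)\<^sup>2) \<noteq> 0"
  proof
    assume "(LINT x:\<Omega>|gauss. (trial b x)\<^sup>2) = 0"
    then have "AE x in gauss. indicat_real \<Omega> x *\<^sub>R (trial b x)\<^sup>2 = 0"
      using integral_nonneg_eq_0_iff_AE[OF ti(1)[unfolded set_integrable_def]]
      by (simp add: set_lebesgue_integral_def)
    then have "AE x in gauss. x \<in> \<Omega> \<longrightarrow> trial b x = 0" by eventually_elim auto
    then show False using nz by simp
  qed
  ultimately show "(LINT x:\<Omega>|gauss. (trial b x)\<^sup>2) > 0" by simp
qed

text \<open>Single trial functions have squares that are not radial. Summing their inequalities over
  an orthonormal basis makes both integrands radial.\<close>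

lemma mu1_trial_sum:
  fixes \<Omega> :: "'a::euclidean_space set"
  assumes N: "N = real DIM('a)" and op: "open \<Omega>" and ne: "\<Omega> \<noteq> {}"
    and sym: "\<forall>x. x \<in> \<Omega> \<longleftrightarrow> - x \<in> \<Omega>"
  shows "neumann_mu1 \<Omega> * (LINT x:\<Omega>|gauss. gsq ((norm x)\<^sup>2 / 2)) \<le> (LINT x:\<Omega>|gauss. dsq ((norm x)\<^sup>2 / 2))"
    and "(LINT x:\<Omega>|gauss. gsq ((norm x)\<^sup>2 / 2)) > 0"
proof -
  note adm = trial_admissible[OF N op ne sym]
  have "\<Omega> \<in> sets borel" using op by simp
  note ti = trial_integrable[OF N this]
  have g: "(LINT x:\<Omega>|gauss. gsq ((norm x)\<^sup>2 / 2)) = (\<Sum>b\<in>Basis. LINT x:\<Omega>|gauss. (trial b x)\<^sup>2)"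
    unfolding sum_trial_sq[symmetric] set_lebesgue_integral_def scaleR_sum_right
    by (rule Bochner_Integration.integral_sum) (use ti(1) in \<open>simp add: set_integrable_def\<close>)
  have d: "(LINT x:\<Omega>|gauss. dsq ((norm x)\<^sup>2 / 2)) = (\<Sum>b\<in>Basis. LINT x:\<Omega>|gauss. (norm (trial' b x))\<^sup>2)"
    unfolding sum_trial'_sq[OF N, symmetric] set_lebesgue_integral_def scaleR_sum_right
    by (rule Bochner_Integration.integral_sum) (use ti(2) in \<open>simp add: set_integrable_def\<close>)
  have "neumann_mu1 \<Omega> * (LINT x:\<Omega>|gauss. (trial b x)\<^sup>2) \<le> (LINT x:\<Omega>|gauss. (norm (trial' b x))\<^sup>2)"
    if b: "b \<in> Basis" for b
    using neumann_mu1_le[OF adm(1-3)[OF b]] adm(4)[OF b] by (simp add: le_divide_eq)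
  then show "neumann_mu1 \<Omega> * (LINT x:\<Omega>|gauss. gsq ((norm x)\<^sup>2 / 2)) \<le> (LINT x:\<Omega>|gauss. dsq ((norm x)\<^sup>2 / 2))"
    unfolding g d sum_distrib_left by (rule sum_mono)
  show "(LINT x:\<Omega>|gauss. gsq ((norm x)\<^sup>2 / 2)) > 0"
    unfolding g by (intro sum_pos adm(4)) auto
qed

text \<open>Both bathtub comparisons go the right way: \<open>gsq\<close> is below its constant
  outer value inside the ball, strictly, and \<open>dsq\<close> is at least (N - 1) \<kappa>(S)^2
  inside and at most that outside. So passing from the ball to \<Omega> strictly increases the
  denominator and does not increase the numerator.\<close>

lemma mu1_less:
  fixes \<Omega> :: "'a::euclidean_space set"
  assumes N: "N = real DIM('a)" and r: "r > 0" "r\<^sup>2 / 2 = S" and op: "open \<Omega>" and ne: "\<Omega> \<noteq> {}"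
    and sym: "\<forall>x. x \<in> \<Omega> \<longleftrightarrow> - x \<in> \<Omega>"
    and meq: "measure gauss \<Omega> = measure gauss (ball (0::'a) r)"
    and nae: "\<not> (AE x in gauss. x \<notin> ball 0 r - \<Omega>)"
  shows "neumann_mu1 \<Omega> < \<mu>"
proof -
  let ?s = "\<lambda>x::'a. (norm x)\<^sup>2 / 2" and ?B = "ball (0::'a) r"
  have [measurable]: "\<Omega> \<in> sets borel" "?B \<in> sets borel" using op by auto
  have N1: "N \<ge> 1" unfolding N using DIM_positive[where 'a='a] by simp
  have B: "x \<in> ?B \<longleftrightarrow> ?s x < S" for x using half_norm_less_iff[OF r(1), of x] r(2) by simp
  have gB: "(LINT x:?B|gauss. gsq (?s x)) < (LINT x:\<Omega>|gauss. gsq (?s x))"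
  proof (rule ccontr)
    assume "\<not> ?thesis"
    then have "(LINT x:\<Omega>|gauss. gsq (?s x)) \<le> (LINT x:?B|gauss. gsq (?s x))" by simp
    then have "AE x in gauss. x \<notin> ?B - \<Omega>"
      by (intro bathtub(2)[where f="\<lambda>x. gsq (?s x)" and c="2 * S * (\<kappa> S)\<^sup>2" and C="2 * S * (\<kappa> S)\<^sup>2"] meq)
        (use B gsq_inner gsq_outer gsq_bounds in \<open>auto simp: abs_le_iff less_imp_le intro: order_trans[OF _ gsq_bounds(1)]\<close>)
    then show False using nae by simp
  qed
  obtain C where C: "\<And>s. 0 \<le> s \<Longrightarrow> 0 \<le> dsq s" "\<And>s. 0 \<le> s \<Longrightarrow> dsq s \<le> C"
    using dsq_bounds[OF N1] by metis
  have "(LINT x:?B|gauss. - dsq (?s x)) \<le> (LINT x:\<Omega>|gauss. - dsq (?s x))"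
    by (rule bathtub(1)[where c="- ((N - 1) * (\<kappa> S)\<^sup>2)" and C=C])
      (use meq B C dsq_inner[OF N1] dsq_outer_le[OF N1] in auto)
  then have dB: "(LINT x:\<Omega>|gauss. dsq (?s x)) \<le> (LINT x:?B|gauss. dsq (?s x))"
    by (simp add: set_lebesgue_integral_def)
  have conv: "(LINT x:?B|gauss. f (?s x)) = (2 * pi) powr (- N / 2) * (\<integral>x. f (?s x) \<partial>(wball r :: 'a measure))"
    if [measurable]: "f \<in> borel_measurable borel" for f
  proof -
    have "(LINT x:?B|gauss. f (?s x)) = (2 * pi) powr (- N / 2) * (\<integral>x. indicator ?B x *\<^sub>R f (?s x) \<partial>(wball r :: 'a measure))"
      unfolding set_lebesgue_integral_def N by (rule integral_gauss_wball) auto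
    also have "(\<integral>x. indicator ?B x *\<^sub>R f (?s x) \<partial>(wball r :: 'a measure)) = (\<integral>x. f (?s x) \<partial>(wball r :: 'a measure))"
    proof (rule integral_cong_AE)
      show "AE x in wball r. indicator ?B x *\<^sub>R f (?s x) = f (?s x)"
        using AE_wball[of r] by eventually_elim simp
    qed measurable
    finally show ?thesis .
  qed
  have ball: "(LINT x:?B|gauss. dsq (?s x)) = \<mu> * (LINT x:?B|gauss. gsq (?s x))"
    unfolding conv[OF borel_measurable_gsq_dsq(1)] conv[OF borel_measurable_gsq_dsq(2)]
    using rayleigh_ball[OF N r] by simp
  note sum = mu1_trial_sum[OF N op ne sym]
  have "neumann_mu1 \<Omega> * (LINT x:\<Omega>|gauss. gsq (?s x)) \<le> \<mu> * (LINT x:?B|gauss. gsq (?s x))"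
    using sum(1) dB ball by linarith
  also have "\<dots> < \<mu> * (LINT x:\<Omega>|gauss. gsq (?s x))"
    using gB \<mu>_ge_1 by (intro mult_strict_left_mono) auto
  finally show ?thesis using sum(2) by simp
qed

text \<open>Translates \<open>poincare_H1\<close> into the normalised measure; both sides acquire
  the same constant c.\<close>

lemma mu_le_mu1_ball:
  assumes N: "N = real DIM('a::euclidean_space)" and r: "r > 0" "r\<^sup>2 / 2 = S"
  shows "\<mu> \<le> neumann_mu1 (ball (0::'a) r)"
  unfolding neumann_mu1_def
proof (rule cInf_greatest)
  let ?B = "ball (0::'a) r"
  obtain b :: 'a where b: "b \<in> Basis" using nonempty_Basis by blast
  have "?B \<noteq> {}" using r by auto
  note adm = trial_admissible[OF N open_ball this _ b]
  show "{(LINT x:?B|gauss. (norm (Dv x))\<^sup>2) / (LINT x:?B|gauss. (v x)\<^sup>2) |v Dv.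
      (v, Dv) \<in> gauss_H1 ?B \<and> \<not> (AE x in gauss. x \<in> ?B \<longrightarrow> v x = 0) \<and> (LINT x:?B|gauss. v x) = 0} \<noteq> {}"
    using adm by auto
  fix q assume "q \<in> {(LINT x:?B|gauss. (norm (Dv x))\<^sup>2) / (LINT x:?B|gauss. (v x)\<^sup>2) |v Dv.
      (v, Dv) \<in> gauss_H1 ?B \<and> \<not> (AE x in gauss. x \<in> ?B \<longrightarrow> v x = 0) \<and> (LINT x:?B|gauss. v x) = 0}"
  then obtain v Dv where q: "q = (LINT x:?B|gauss. (norm (Dv x))\<^sup>2) / (LINT x:?B|gauss. (v x)\<^sup>2)"
    and w: "has_weak_gradient ?B v Dv" and v2: "set_integrable gauss ?B (\<lambda>x. (v x)\<^sup>2)"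
    and Dv2: "set_integrable gauss ?B (\<lambda>x. (norm (Dv x))\<^sup>2)"
    and nz: "\<not> (AE x in gauss. x \<in> ?B \<longrightarrow> v x = 0)" and mean: "(LINT x:?B|gauss. v x) = 0"
    by (auto simp: gauss_H1_def)
  let ?F = "\<lambda>x. indicator ?B x * v x" and ?G = "\<lambda>x. indicator ?B x *\<^sub>R Dv x"
  define c where "c = (2 * pi) powr (- real DIM('a) / 2)"
  have c: "c > 0" by (simp add: c_def)
  have ind2: "(indicat_real A x)\<^sup>2 = indicat_real A x" for A and x :: 'a by (simp add: indicator_def)
  have l2: "set_integrable lborel ?B (\<lambda>x. (v x)\<^sup>2)" "set_integrable lborel ?B (\<lambda>x. (norm (Dv x))\<^sup>2)"
    by (rule set_integrable_lborel_of_gauss[OF v2], simp, rule set_integrable_lborel_of_gauss[OF Dv2], simp)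
  note P = poincare_H1[OF N w r(1) eq_refl[OF r(2)] l2]
  have [measurable]: "?F \<in> borel_measurable borel" "?G \<in> borel_measurable borel"
    using w locally_integrable_ball_measurable[of r v] locally_integrable_ball_measurable[of r Dv]
    by (simp_all add: has_weak_gradient_def)
  have [measurable]: "(\<lambda>x. (?F x)\<^sup>2) \<in> borel_measurable borel" "(\<lambda>x. (norm (?G x))\<^sup>2) \<in> borel_measurable borel"
    by measurable
  have F: "(LINT x:?B|gauss. (v x)\<^sup>2) = c * (\<integral>x. (?F x)\<^sup>2 \<partial>wball r)"
    using integral_gauss_wball[OF \<open>(\<lambda>x. (?F x)\<^sup>2) \<in> borel_measurable borel\<close>, of r]
    by (simp add: set_lebesgue_integral_def power_mult_distrib ind2 c_def)
  have G: "(LINT x:?B|gauss. (norm (Dv x))\<^sup>2) = c * (\<integral>x. (norm (?G x))\<^sup>2 \<partial>wball r)"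
    using integral_gauss_wball[OF \<open>(\<lambda>x. (norm (?G x))\<^sup>2) \<in> borel_measurable borel\<close>, of r]
    by (simp add: set_lebesgue_integral_def power_mult_distrib ind2 c_def)
  have "(LINT x:?B|gauss. v x) = c * (\<integral>x. ?F x \<partial>wball r)"
    using integral_gauss_wball[OF \<open>?F \<in> borel_measurable borel\<close>, of r] by (simp add: set_lebesgue_integral_def c_def)
  then have "(\<integral>x. ?F x \<partial>wball r) = 0" using mean c by simp
  from P[OF this] have le: "\<mu> * (\<integral>x. (?F x)\<^sup>2 \<partial>wball r) \<le> (\<integral>x. (norm (?G x))\<^sup>2 \<partial>wball r)" .
  have nn: "(LINT x:?B|gauss. (v x)\<^sup>2) \<ge> 0"
    unfolding set_lebesgue_integral_def by (intro integral_nonneg_AE) auto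
  have "(LINT x:?B|gauss. (v x)\<^sup>2) \<noteq> 0"
  proof
    assume "(LINT x:?B|gauss. (v x)\<^sup>2) = 0"
    then have "AE x in gauss. indicat_real ?B x *\<^sub>R (v x)\<^sup>2 = 0"
      using integral_nonneg_eq_0_iff_AE[OF v2[unfolded set_integrable_def]]
      by (simp add: set_lebesgue_integral_def)
    then have "AE x in gauss. x \<in> ?B \<longrightarrow> v x = 0" by eventually_elim auto
    then show False using nz by simp
  qed
  then have pos: "(LINT x:?B|gauss. (v x)\<^sup>2) > 0" using nn by simp
  have "c * (\<mu> * (\<integral>x. (?F x)\<^sup>2 \<partial>wball r)) \<le> c * (\<integral>x. (norm (?G x))\<^sup>2 \<partial>wball r)"
    using le c by simp
  then have "\<mu> * (LINT x:?B|gauss. (v x)\<^sup>2) \<le> (LINT x:?B|gauss. (norm (Dv x))\<^sup>2)"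
    unfolding F G by (simp add: mult_ac)
  then show "\<mu> \<le> q" unfolding q using pos by (simp add: le_divide_eq)
qed

end

theorem theorem4p1:
  fixes \<Omega> :: "'a::euclidean_space set" and R :: real
  assumes "open \<Omega>" and "connected \<Omega>" and "\<Omega> \<noteq> {}"
    and "lipschitz_boundary \<Omega>"
    and "\<forall>x. x \<in> \<Omega> \<longleftrightarrow> - x \<in> \<Omega>"
    and "measure gauss \<Omega> < 1"
    and "measure gauss (ball (0::'a) R) = measure gauss \<Omega>"
  shows "neumann_mu1 \<Omega> \<le> neumann_mu1 (ball (0::'a) R) \<and>
    (neumann_mu1 \<Omega> = neumann_mu1 (ball (0::'a) R) \<longleftrightarrow> \<Omega> = ball 0 R)"
proof -
  have [measurable]: "\<Omega> \<in> sets borel" using assms(1) by simp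
  \<comment> \<open>Otherwise the ball is empty and \<Omega> is a null set, impossible for a
    nonempty open set.\<close>
  have R: "R > 0"
  proof (rule ccontr)
    assume "\<not> R > 0"
    then have "ball (0::'a) R = {}" by simp
    then have "measure gauss \<Omega> = 0" using assms(7) by (metis measure_empty)
    then have "AE x in gauss. x \<notin> \<Omega>"
      by (subst AE_iff_null_sets[symmetric]) (auto simp: null_sets_def gauss.emeasure_eq_measure)
    then show False using open_null_empty[OF assms(1)] assms(3) by (simp add: AE_gauss_iff)
  qed
  have "real DIM('a) \<ge> 0" "R\<^sup>2 / 2 > 0" using R by simp_all
  from neumann_profile_exists[OF this]
  obtain \<kappa> \<kappa>1 \<kappa>2 \<mu> where "neumann_profile (real DIM('a)) \<kappa> \<kappa>1 \<kappa>2 (R\<^sup>2 / 2) \<mu>" .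
  then interpret neumann_profile "real DIM('a)" \<kappa> \<kappa>1 \<kappa>2 "R\<^sup>2 / 2" \<mu> .
  have "neumann_mu1 \<Omega> < neumann_mu1 (ball (0::'a) R)" if ne: "\<Omega> \<noteq> ball 0 R"
  proof -
    have "\<not> (AE x in gauss. x \<notin> ball 0 R - \<Omega>)"
    proof
      assume 1: "AE x in gauss. x \<notin> ball 0 R - \<Omega>"
      have [measurable]: "ball (0::'a) R \<in> sets borel" by simp
      have "measure gauss (ball 0 R - \<Omega>) = 0"
        using 1 by (subst (asm) AE_iff_null_sets[symmetric]) (auto simp: null_sets_def gauss.emeasure_eq_measure)
      \<comment> \<open>The two sets have the same finite measure, so if one difference is null, so
        is the other.\<close>
      moreover have "measure gauss (ball 0 R - \<Omega>) = measure gauss (ball (0::'a) R) - measure gauss (ball 0 R \<inter> \<Omega>)"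
        "measure gauss (\<Omega> - ball 0 R) = measure gauss \<Omega> - measure gauss (\<Omega> \<inter> ball 0 R)"
        using gauss.finite_measure_Diff'[of "ball (0::'a) R" \<Omega>] gauss.finite_measure_Diff'[of \<Omega> "ball (0::'a) R"] assms(1)
        by simp_all
      ultimately have "measure gauss (\<Omega> - ball 0 R) = 0" using assms(7) by (simp add: Int_commute)
      then have "AE x in gauss. x \<notin> \<Omega> - ball 0 R"
        by (subst AE_iff_null_sets[symmetric]) (auto simp: null_sets_def gauss.emeasure_eq_measure)
      then have "\<Omega> = ball 0 R"
        using lipschitz_ae_ball_eq[OF assms(1,4) R] 1 by (simp add: AE_gauss_iff)
      then show False using ne by simp
    qed
    then have "neumann_mu1 \<Omega> < \<mu>"
      by (intro mu1_less[OF refl R refl assms(1,3,5)]) (simp_all add: assms(7))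
    also have "\<mu> \<le> neumann_mu1 (ball (0::'a) R)" by (rule mu_le_mu1_ball[OF refl R refl])
    finally show ?thesis .
  qed
  then show ?thesis by (cases "\<Omega> = ball 0 R") auto
qed

end
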